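(* Let $\alpha\in(0,1)$, $T,L,\varrho>0$, $f\in C([0,L]\times[0,T])$, $\varphi\in C[0,L]$. For positive integers $K_t,K_x$ let $\tau=T/K_t$, $t_n=n\tau$ for $0\le n\le K_t$ (uniform mesh, i.e. grading parameter $r=1$), $h=L/K_x$, $x_i=ih$ for $0\le i\le K_x$, and $f_i^n=f(x_i,t_n)$. Then the finite difference scheme $$\frac{1}{\Gamma(2-\alpha)}\sum_{j=0}^{n}p_j^{(n)}u_i^{n-j}=\varrho\,\frac{u_{i+1}^n-2u_i^n+u_{i-1}^n}{h^2}+f_i^n,\qquad 1\le i\le K_x-1,\ 1\le n\le K_t,$$ $$u_0^n=0=u_{K_x}^n,\quad 0<n\le K_t,\qquad u_i^0=\varphi(x_i),\quad 0\le i\le K_x,$$ with the coefficients $p_j^{(n)}$ defined in the context, is unconditionally stable (in the sense defined in the context).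
   Context: The coefficients $p_j^{(n)}$ ($0\le j\le n$, depending on $n$, $\alpha$ and the temporal mesh) are the real numbers determined by the identity, for all mesh functions $v$ with $v^m=v(t_m)$, $$\frac{1}{\Gamma(2-\alpha)}\sum_{j=0}^{n}p_j^{(n)}v^{n-j}=\frac{1}{\Gamma(1-\alpha)}\Big[\int_{t_0}^{t_1}(t_n-s)^{-\alpha}(I_{11}v)'(s)\,ds+\int_{t_1}^{t_2}(t_n-s)^{-\alpha}(I_{22}v)'(s)\,ds+\sum_{k=3}^{n}\int_{t_{k-1}}^{t_k}(t_n-s)^{-\alpha}(I_{3k}v)'(s)\,ds\Big],$$ where for $n=1$ only the first integral is present and for $n=2$ only the first two. Here $I_{11}v$ is the linear polynomial interpolating $v$ at $t_0,t_1$; $I_{22}v$ is the quadratic polynomial interpolating $v$ at $t_0,t_1,t_2$; and for $k\ge3$, $I_{3k}v$ is the cubic polynomial interpolating $v$ at $t_{k-3},t_{k-2},t_{k-1},t_k$. Unconditional stability: there is a positive constant $C$, independent of $h$, $\tau$ and $n$ (with no restriction relating $h$ and $\tau$), such that whenever $(u_i^n)$ and $(\tilde u_i^n)$ are solutions of the difference equations with the same $f$ and the same zero boundary values but with different initial values, the difference $v_i^n=u_i^n-\tilde u_i^n$, $v^n=(v_1^n,\ldots,v_{K_x-1}^n)^T$, satisfies $\|v^n\|_\infty\le C\|v^0\|_\infty$ for $n=0,1,\ldots,K_t$, where $\|v^n\|_\infty=\max_i|v_i^n|$. *)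

theory Defs
  imports "HOL-Analysis.Analysis" "HOL-Computational_Algebra.Polynomial"
begin

definition interp_poly :: "(nat \<Rightarrow> real) \<Rightarrow> nat set \<Rightarrow> (nat \<Rightarrow> real) \<Rightarrow> real poly" where
  "interp_poly t S v = (THE q. degree q < card S \<and> (\<forall>i\<in>S. poly q (t i) = v i))"

lemma interp_poly_unique:
  fixes t v :: "nat \<Rightarrow> real" and S :: "nat set"
  assumes "finite S" "S \<noteq> {}" "inj_on t S"
  shows "\<exists>!q. degree q < card S \<and> (\<forall>i\<in>S. poly q (t i) = v i)"
proof (rule ex_ex1I)
  define b where "b = (\<lambda>i. \<Prod>j\<in>S - {i}. smult (1 / (t i - t j)) [:- t j, 1:])"
  define q where "q = (\<Sum>i\<in>S. smult (v i) (b i))"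
  have deg: "degree (b i) \<le> card S - 1" if "i \<in> S" for i
  proof -
    have "degree (b i) \<le> (\<Sum>j\<in>S - {i}. degree (smult (1 / (t i - t j)) [:- t j, 1:]))"
      unfolding b_def using degree_prod_sum_le[of "S - {i}" "\<lambda>j. smult (1 / (t i - t j)) [:- t j, 1:]"] assms(1)
      by (simp add: o_def)
    also have "\<dots> \<le> (\<Sum>j\<in>S - {i}. 1)"
      by (intro sum_mono) simp
    also have "\<dots> = card S - 1"
      using assms(1) that by simp
    finally show ?thesis .
  qed
  have "degree q \<le> card S - 1"
    unfolding q_def
    by (rule degree_sum_le[OF assms(1)]) (meson deg degree_smult_le order_trans)
  moreover have "card S > 0"
    using assms by (simp add: card_gt_0_iff)
  moreover have "poly q (t k) = v k" if k: "k \<in> S" for k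
  proof -
    have "poly (b i) (t k) = (if i = k then 1 else 0)" if "i \<in> S" for i
    proof (cases "i = k")
      case True
      have "t k \<noteq> t j" if "j \<in> S - {k}" for j
        using that k assms(3) by (auto dest: inj_onD)
      then show ?thesis
        using True by (auto simp: b_def poly_prod divide_simps intro!: prod.neutral)
    next
      case False
      then show ?thesis
        using assms(1) k by (auto simp: b_def poly_prod intro!: bexI[of _ k])
    qed
    then have "poly q (t k) = (\<Sum>i\<in>S. v i * (if i = k then 1 else 0))"
      by (simp add: q_def poly_sum)
    then show ?thesis
      using assms(1) k by (simp add: if_distrib cong: if_cong)
  qed
  ultimately show "\<exists>q. degree q < card S \<and> (\<forall>i\<in>S. poly q (t i) = v i)"
    by (intro exI[of _ q]) auto
next
  fix q r
  assume q: "degree q < card S \<and> (\<forall>i\<in>S. poly q (t i) = v i)"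
    and r: "degree r < card S \<and> (\<forall>i\<in>S. poly r (t i) = v i)"
  show "q = r"
  proof (rule ccontr)
    assume "q \<noteq> r"
    then have "q - r \<noteq> 0" by simp
    have "card S = card (t ` S)"
      using assms(3) by (simp add: card_image)
    also have "\<dots> \<le> card {x. poly (q - r) x = 0}"
      using q r by (intro card_mono poly_roots_finite[OF \<open>q - r \<noteq> 0\<close>]) auto
    also have "\<dots> \<le> degree (q - r)"
      using card_poly_roots_bound[OF \<open>q - r \<noteq> 0\<close>] .
    also have "\<dots> < card S"
      using q r by (intro degree_diff_less) auto
    finally show False by simp
  qed
qed

definition stencil :: "nat \<Rightarrow> nat set" where
  "stencil k = (if k = 1 then {0, 1} else if k = 2 then {0, 1, 2} else {k - 3..k})"

text \<open>
  The integrand is singular at \<open>s = t n\<close> when \<open>k = n\<close>; there the convention \<open>0 powr x = 0\<close>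
  changes it on a null set only.
\<close>

definition caputo_approx :: "real \<Rightarrow> (nat \<Rightarrow> real) \<Rightarrow> nat \<Rightarrow> (nat \<Rightarrow> real) \<Rightarrow> real" where
  "caputo_approx \<alpha> t n v =
     1 / Gamma (1 - \<alpha>) *
       (\<Sum>k = 1..n. integral {t (k - 1)..t k}
          (\<lambda>s. (t n - s) powr (- \<alpha>) * poly (pderiv (interp_poly t (stencil k) v)) s))"

text \<open>
  The identity determines \<open>p j\<close> for \<open>j \<le> n\<close> only; the values at \<open>j > n\<close> are set to 0 to make the
  function unique, and are never used.
\<close>

definition scheme_coeff :: "real \<Rightarrow> (nat \<Rightarrow> real) \<Rightarrow> nat \<Rightarrow> nat \<Rightarrow> real" where
  "scheme_coeff \<alpha> t n =
     (THE p. (\<forall>v. 1 / Gamma (2 - \<alpha>) * (\<Sum>j = 0..n. p j * v (n - j)) = caputo_approx \<alpha> t n v) \<and>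
             (\<forall>j>n. p j = 0))"

lemma stencil_props: "k \<ge> 1 \<Longrightarrow> finite (stencil k) \<and> stencil k \<noteq> {} \<and> stencil k \<subseteq> {0..k}"
  by (auto simp: stencil_def)

lemma caputo_integrand_integrable:
  fixes a b c :: real
  assumes "0 < \<alpha>" "\<alpha> < 1" "a \<le> b" "b \<le> c"
  shows "(\<lambda>s. (c - s) powr (- \<alpha>) * poly q s) integrable_on {a..b}"
proof -
  have "(\<lambda>x. x powr (-\<alpha>)) integrable_on {0..c - a}"
    using assms by (intro integrable_on_powr_from_0) auto
  then have "(\<lambda>x. x powr (-\<alpha>)) integrable_on {c-b..c - a}"
    by (rule integrable_subinterval_real) (use assms in auto)
  then have "(\<lambda>x. (-1 * x + c) powr (-\<alpha>)) integrable_on {a..b}"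
    using integrable_affinity[of "\<lambda>x. x powr (-\<alpha>)" "c-b" "c-a" "-1" c] assms by (simp add: image_affinity_atLeastAtMost)
  then have 1: "(\<lambda>x. (c - x) powr (-\<alpha>)) absolutely_integrable_on {a..b}"
    by (intro nonnegative_absolutely_integrable_1) auto
  have "(\<lambda>s. poly q s *\<^sub>R (c - s) powr (- \<alpha>)) absolutely_integrable_on {a..b}"
    unfolding real_scaleR_def
  proof (rule absolutely_integrable_bounded_measurable_product_real[OF _ _ _ 1])
    show "poly q \<in> borel_measurable (lebesgue_on {a..b})"
      by (intro continuous_imp_measurable_on_sets_lebesgue continuous_intros) simp
    show "bounded (poly q ` {a..b})"
      by (intro compact_imp_bounded compact_continuous_image continuous_intros) simp
  qed simp
  then show ?thesis
    using set_lebesgue_integral_eq_integral(1) by (auto simp: mult.commute)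
qed

lemma interp_poly_linear:
  assumes "finite S" "S \<noteq> {}" "inj_on t S"
  shows "interp_poly t S (\<lambda>i. a * v i + b * w i) = smult a (interp_poly t S v) + smult b (interp_poly t S w)"
proof -
  note T = theI'[OF interp_poly_unique[OF assms], folded interp_poly_def]
  show ?thesis
    unfolding interp_poly_def[of _ _ "\<lambda>i. a * v i + b * w i"]
  proof (rule the1_equality[OF interp_poly_unique[OF assms]])
    show "degree (smult a (interp_poly t S v) + smult b (interp_poly t S w)) < card S \<and>
      (\<forall>i\<in>S. poly (smult a (interp_poly t S v) + smult b (interp_poly t S w)) (t i) = a * v i + b * w i)"
      using T[of v] T[of w] by (auto intro!: degree_add_less order_le_less_trans[OF degree_smult_le])
  qed
qed

lemma caputo_approx_linear:
  assumes "0 < \<alpha>" "\<alpha> < 1" "strict_mono t"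
  shows "caputo_approx \<alpha> t n (\<lambda>i. a * v i + b * w i) = a * caputo_approx \<alpha> t n v + b * caputo_approx \<alpha> t n w"
proof -
  have "integral {t (k - 1)..t k} (\<lambda>s. (t n - s) powr (- \<alpha>) * poly (pderiv (interp_poly t (stencil k) (\<lambda>i. a * v i + b * w i))) s)
    = a * integral {t (k - 1)..t k} (\<lambda>s. (t n - s) powr (- \<alpha>) * poly (pderiv (interp_poly t (stencil k) v)) s)
    + b * integral {t (k - 1)..t k} (\<lambda>s. (t n - s) powr (- \<alpha>) * poly (pderiv (interp_poly t (stencil k) w)) s)"
    (is "?l = a * integral ?I ?f + b * integral ?I ?g")
    if k: "k \<in> {1..n}" for k
  proof -
    have i: "inj_on t (stencil k)" using assms(3) strict_mono_imp_inj_on inj_on_subset by blast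
    have mm: "t (k-1) \<le> t k" "t k \<le> t n" using k assms(3) by (auto simp: strict_mono_less_eq)
    have "?l = integral ?I (\<lambda>s. a * ?f s + b * ?g s)"
      using stencil_props[of k] k interp_poly_linear[OF _ _ i] by (simp add: pderiv_add pderiv_smult algebra_simps)
    also have "\<dots> = a * integral ?I ?f + b * integral ?I ?g"
      using caputo_integrand_integrable[OF assms(1,2) mm]
      by (subst integral_add) (auto intro!: integrable_on_mult_right)
    finally show ?thesis .
  qed
  then show ?thesis unfolding caputo_approx_def
    by (simp add: sum.distrib sum_distrib_left algebra_simps)
qed

lemma caputo_approx_cong:
  assumes "\<And>i. i \<le> n \<Longrightarrow> v i = w i"
  shows "caputo_approx \<alpha> t n v = caputo_approx \<alpha> t n w"
proof -
  have "interp_poly t (stencil k) v = interp_poly t (stencil k) w" if "k \<in> {1..n}" for k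
  proof -
    have "\<forall>i\<in>stencil k. v i = w i" using that stencil_props[of k] assms by fastforce
    then show ?thesis unfolding interp_poly_def by (metis (no_types, lifting))
  qed
  then show ?thesis unfolding caputo_approx_def by simp
qed

lemma scheme_coeff_unique:
  assumes "0 < \<alpha>" "\<alpha> < 1" "strict_mono t"
  shows "\<exists>!p. (\<forall>v. 1 / Gamma (2 - \<alpha>) * (\<Sum>j = 0..n. p j * v (n - j)) = caputo_approx \<alpha> t n v) \<and> (\<forall>j>n. p j = 0)"
proof -
  have G: "Gamma (2-\<alpha>) > 0" using assms by (simp add: Gamma_real_pos)
  let ?e = "\<lambda>m i. if i = m then 1 else (0::real)"
  define p where "p j = (if j \<le> n then Gamma (2-\<alpha>) * caputo_approx \<alpha> t n (?e (n-j)) else 0)" for j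
  have z: "caputo_approx \<alpha> t n (\<lambda>i. 0) = 0"
    using caputo_approx_linear[OF assms, of n 0 "\<lambda>i. 0" 0 "\<lambda>i. 0"] by simp
  have s: "caputo_approx \<alpha> t n (\<lambda>i. \<Sum>m\<in>A. v m * ?e m i) = (\<Sum>m\<in>A. v m * caputo_approx \<alpha> t n (?e m))" if "finite A" for A v
    using that
  proof induction
    case (insert x A)
    then show ?case
      using caputo_approx_linear[OF assms, of n "v x" "?e x" 1 "\<lambda>i. \<Sum>m\<in>A. v m * ?e m i"] by simp
  qed (simp add: z)
  have P: "1 / Gamma (2 - \<alpha>) * (\<Sum>j = 0..n. p j * v (n - j)) = caputo_approx \<alpha> t n v" for v
  proof -
    have "1 / Gamma (2 - \<alpha>) * (\<Sum>j = 0..n. p j * v (n - j)) = (\<Sum>j = 0..n. v (n-j) * caputo_approx \<alpha> t n (?e (n-j)))"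
      using G by (simp add: p_def sum_distrib_left mult_ac)
    also have "\<dots> = (\<Sum>m = 0..n. v m * caputo_approx \<alpha> t n (?e m))"
      by (rule sum.reindex_bij_witness[of _ "\<lambda>i. n - i" "\<lambda>i. n - i"]) auto
    also have "\<dots> = caputo_approx \<alpha> t n (\<lambda>i. \<Sum>m\<in>{0..n}. v m * ?e m i)" by (rule s[symmetric]) simp
    also have "\<dots> = caputo_approx \<alpha> t n v" by (rule caputo_approx_cong) (simp add: if_distrib cong: if_cong)
    finally show ?thesis .
  qed
  show ?thesis
  proof (rule ex1I[of _ p])
    fix q assume q: "(\<forall>v. 1 / Gamma (2 - \<alpha>) * (\<Sum>j = 0..n. q j * v (n - j)) = caputo_approx \<alpha> t n v) \<and> (\<forall>j>n. q j = 0)"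
    show "q = p"
    proof
      fix j
      show "q j = p j"
      proof (cases "j \<le> n")
        case True
        have "(\<Sum>i = 0..n. q i * ?e (n-j) (n - i)) = (\<Sum>i = 0..n. q i * (if i = j then 1 else 0))"
          using True by (intro sum.cong) auto
        also have "\<dots> = q j" using True by (simp add: if_distrib cong: if_cong)
        finally have "1 / Gamma (2 - \<alpha>) * q j = caputo_approx \<alpha> t n (?e (n-j))" using q[THEN conjunct1, rule_format, of "?e (n - j)"] by (simp only:)
        then show ?thesis using G True by (simp add: p_def field_simps)
      qed (use q in \<open>auto simp: p_def\<close>)
    qed
  qed (use P in \<open>auto simp: p_def\<close>)
qed

definition uniform_mesh :: "real \<Rightarrow> nat \<Rightarrow> nat \<Rightarrow> real" where
  "uniform_mesh X K m = real m * (X / real K)"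

lemma strict_mono_uniform_mesh:
  "X > 0 \<Longrightarrow> K > 0 \<Longrightarrow> strict_mono (uniform_mesh X K)"
  unfolding uniform_mesh_def by (intro strict_monoI mult_strict_right_mono) auto

text \<open>A grid function \<open>u\<close> has the time level as its first and the space index as its second argument.\<close>

definition scheme_solution ::
  "real \<Rightarrow> real \<Rightarrow> real \<Rightarrow> real \<Rightarrow> (real \<times> real \<Rightarrow> real) \<Rightarrow> (real \<Rightarrow> real) \<Rightarrow>
   nat \<Rightarrow> nat \<Rightarrow> (nat \<Rightarrow> nat \<Rightarrow> real) \<Rightarrow> bool" where
  "scheme_solution \<alpha> T L \<rho> f \<phi> Kt Kx u \<longleftrightarrow>
     (let t = uniform_mesh T Kt; x = uniform_mesh L Kx; h = L / real Kx in
       (\<forall>n\<in>{1..Kt}. \<forall>i\<in>{1..<Kx}.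
          1 / Gamma (2 - \<alpha>) * (\<Sum>j = 0..n. scheme_coeff \<alpha> t n j * u (n - j) i) =
          \<rho> * ((u n (i + 1) - 2 * u n i + u n (i - 1)) / h\<^sup>2) + f (x i, t n)) \<and>
       (\<forall>n\<in>{1..Kt}. u n 0 = 0 \<and> u n Kx = 0) \<and>
       (\<forall>i\<in>{0..Kx}. u 0 i = \<phi> (x i)))"

text \<open>
  The maximum norm runs over the interior nodes; inserting 0 only matters for \<open>Kx = 1\<close>, where there
  are none.
\<close>

definition max_norm :: "nat \<Rightarrow> (nat \<Rightarrow> real) \<Rightarrow> real" where
  "max_norm Kx w = Max (insert 0 ((\<lambda>i. \<bar>w i\<bar>) ` {1..<Kx}))"

text \<open>
  The constant is chosen before the two mesh sizes, the initial data and the solutions. The perturbed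
  initial values \<open>\<psi>\<close> are arbitrary.
\<close>

definition unconditionally_stable ::
  "real \<Rightarrow> real \<Rightarrow> real \<Rightarrow> real \<Rightarrow> (real \<times> real \<Rightarrow> real) \<Rightarrow> bool" where
  "unconditionally_stable \<alpha> T L \<rho> f \<longleftrightarrow>
     (\<exists>C>0. \<forall>Kt\<ge>1. \<forall>Kx\<ge>1. \<forall>\<phi> \<psi> u w.
        continuous_on {0..L} \<phi> \<longrightarrow>
        scheme_solution \<alpha> T L \<rho> f \<phi> Kt Kx u \<longrightarrow>
        scheme_solution \<alpha> T L \<rho> f \<psi> Kt Kx w \<longrightarrow>
        (\<forall>n\<le>Kt. max_norm Kx (\<lambda>i. u n i - w n i) \<le> C * max_norm Kx (\<lambda>i. u 0 i - w 0 i)))"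

end

(*
On the uniform mesh the difference of two solutions satisfies a discrete convolution equation
whose generating function U at the positive time levels solves (symbol + A) U = G, where A is the
scaled negative Dirichlet Laplacian and the scaling (the only trace of h and tau) is arbitrary.

The resolvent (z + A)^(-1) is bounded in the maximum norm by 2 / (|z| + Re z), uniformly in the
scaling: extend oddly and periodically to the integers and factor the tridiagonal operator into
(1 - q S)(1 - q S^(-1)), S being the shift. It remains to keep the symbol away from the negative
real axis: |symbol| + Re symbol >= k |1 - zeta|^alpha in the unit disc. The kernels are moment
sequences (mixtures of geometric sequences), so the sign of Im symbol can be checked on geometric
sequences, where it is a polynomial inequality; and Re symbol >= c |1 - zeta|^alpha - M |Im zeta|.

Together with |symbol'| <= C |1 - zeta|^(alpha - 1) and similar bounds for G this gives
|U'| <= C / |1 - zeta|^2. Cauchy's formula for the n-th coefficient on the circle of radius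
n / (n + 1), on which the Poisson kernel has mean one, bounds the solution at time level n.
*)
theory Submission
  imports Defs "HOL-Complex_Analysis.Complex_Analysis"
begin

subsection \<open>Resolvent of the discrete Laplacian in the maximum norm\<close>

text \<open>The two usual routes are closed. As \<alpha> tends to 1 the scheme approaches the
  third-order backward differentiation formula, in which the level n - 2 has a coefficient of the
  wrong sign, so the sign pattern behind a discrete maximum principle is lost; and energy or Fourier
  arguments control the Euclidean norm, not the maximum norm. The weight norm z + Re z is twice the
  square of the real part of the root of z. The symbol vanishes at \<zeta> = 1 like |1 -
  \<zeta>|^\<alpha>, and the weight must not vanish faster, or the constant would depend on n. U' is
  estimated because U itself is only O(1 / |1 - \<zeta>|), whose mean on the circle of radius n / (n
  + 1) grows like log n. The mean of the bound for U' is of order n, which the factor n in the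
  coefficient of U' compensates. A solution is given up to the last time level only. Hence U is not
  built from it: it is the holomorphic solution of the system in the disc, and its coefficients are
  identified with the solution by uniqueness. The right-hand side G contains the levels 1 and 2,
  which are bounded beforehand.\<close>

lemma shifted_difference_bound:
  fixes Y :: "int \<Rightarrow> complex"
  assumes q: "norm q < 1" and bdd: "bounded (range Y)"
    and E: "\<And>k. norm (Y k - q * Y (s k)) \<le> E"
  shows "norm (Y k) * (1 - norm q) \<le> E"
proof -
  define S where "S = (SUP k. norm (Y k))"
  have bd: "bdd_above (range (\<lambda>k. norm (Y k)))"
    using bdd by (auto simp: bounded_iff bdd_above_def)
  have le: "norm (Y k) \<le> S" for k
    unfolding S_def by (rule cSUP_upper[OF _ bd]) simp
  have "norm (Y k) \<le> E + norm q * S" for k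
  proof -
    have "norm (Y k) \<le> norm (Y k - q * Y (s k)) + norm (q * Y (s k))"
      using norm_triangle_sub by (metis add.commute)
    also have "\<dots> \<le> E + norm q * S"
      using E[of k] le[of "s k"] by (intro add_mono) (auto simp: norm_mult mult_left_mono)
    finally show ?thesis .
  qed
  \<comment> \<open>The term norm q * S can be absorbed because S is a finite real number, by
    boundedness of Y.\<close>
  then have "S \<le> E + norm q * S"
    unfolding S_def by (intro cSUP_least) (auto simp: S_def)
  then have "S * (1 - norm q) \<le> E" by (simp add: algebra_simps)
  moreover have "norm (Y k) * (1 - norm q) \<le> S * (1 - norm q)"
    using le q by (intro mult_right_mono) auto
  ultimately show ?thesis by linarith
qed

text \<open>The two roots of p^2 + \<sigma> p = 1 have product -1, so one lies in the closed unit
  disc; on the unit circle 1 / p is the conjugate of p, which would make \<sigma> purely imaginary.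
  This parametrisation serves because \<sigma>^2 = 1 / q - 2 + q with q = p^2 is the characteristic
  equation of the second difference.\<close>

lemma exists_inverse_minus_self:
  fixes \<sigma> :: complex
  assumes "Re \<sigma> > 0"
  obtains p where "p \<noteq> 0" "norm p < 1" "\<sigma> = 1 / p - p"
proof -
  define r where "r = csqrt (\<sigma>\<^sup>2 + 4)"
  have r2: "r\<^sup>2 = \<sigma>\<^sup>2 + 4" by (simp add: r_def)
  define p1 p2 where "p1 = (r - \<sigma>) / 2" and "p2 = (- r - \<sigma>) / 2"
  have prod: "p1 * p2 = -1"
    using r2 by (simp add: p1_def p2_def field_simps power2_eq_square)
  have root: "p \<noteq> 0 \<and> \<sigma> = 1 / p - p" if "p = p1 \<or> p = p2" for p
  proof -
    have "p * p + \<sigma> * p = 1"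
    proof -
      have "(2 * p + \<sigma>)\<^sup>2 = \<sigma>\<^sup>2 + 4" proof (rule disjE[OF that])
          assume "p = p1"
          moreover have "2 * p1 = r - \<sigma>" by (simp add: p1_def)
          ultimately have "2 * p + \<sigma> = r" by simp
          then show ?thesis using r2 by simp
        next
          assume "p = p2"
          moreover have "2 * p2 = - r - \<sigma>" by (simp add: p2_def)
          ultimately have "2 * p + \<sigma> = - r" by simp
          then show ?thesis using r2 by simp
        qed
      then have "4 * (p * p + \<sigma> * p) = 4 * 1" by (simp add: power2_eq_square algebra_simps)
      then show ?thesis by (simp only: mult_cancel_left) simp
    qed
    moreover from this have "p \<noteq> 0" by auto
    ultimately show ?thesis by (simp add: field_simps)
  qed
  have "norm p1 * norm p2 = 1" using prod by (metis norm_minus_cancel norm_mult norm_one)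
  then have "norm p1 \<le> 1 \<or> norm p2 \<le> 1"
    by (metis less_1_mult linorder_le_less_linear order_less_irrefl)
  then obtain p where p: "p \<noteq> 0" "\<sigma> = 1 / p - p" "norm p \<le> 1" using root by metis
  have "norm p \<noteq> 1"
  proof
    assume "norm p = 1"
    moreover have "Re (1 / p) = Re p / (norm p)\<^sup>2" by (simp add: Re_divide cmod_power2)
    moreover have "Re \<sigma> = Re (1 / p) - Re p" by (simp add: p(2))
    ultimately have "Re \<sigma> = 0" by simp
    with assms show False by simp
  qed
  with p that show ?thesis by force
qed

text \<open>For z = \<kappa> (1 / q - 2 + q) the operator z - \<kappa> (S - 2 + S^(-1)) is (\<kappa>
  / q) (1 - q S) (1 - q S^(-1)), and inverting each factor costs 1 / (1 - norm q). The detour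
  through the square root \<sigma> of z / \<kappa> expresses the outcome in z, since (Re \<sigma>)^2
  = (norm z + Re z) / (2 \<kappa>).\<close>

lemma laplacian_resolvent_bound_int:
  fixes Y g :: "int \<Rightarrow> complex" and \<kappa> M :: real and z :: complex
  assumes \<kappa>: "\<kappa> > 0" and bdd: "bounded (range Y)"
    and eq: "\<And>k. z * Y k - \<kappa> * (Y (k + 1) - 2 * Y k + Y (k - 1)) = g k"
    and g: "\<And>k. norm (g k) \<le> M"
  shows "norm (Y k) * (norm z + Re z) \<le> 2 * M"
proof (cases "norm z + Re z > 0")
  case False
  moreover have "M \<ge> 0" using g[of 0] norm_ge_zero order_trans by blast
  ultimately show ?thesis
    by (meson mult_nonneg_nonpos norm_ge_zero not_less order_trans zero_le_mult_iff zero_le_numeral)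
next
  case True
  define \<sigma> where "\<sigma> = csqrt (z / \<kappa>)"
  have sq: "\<sigma>\<^sup>2 = z / \<kappa>" by (simp add: \<sigma>_def)
  have Re2: "(Re \<sigma>)\<^sup>2 = (norm z + Re z) / (2 * \<kappa>)"
  proof -
    have "(Re \<sigma>)\<^sup>2 = (norm (z / \<kappa>) + Re (z / \<kappa>)) / 2"
      unfolding \<sigma>_def using complex_Re_le_cmod[of "- (z / \<kappa>)"] by simp
    also have "\<dots> = (norm z + Re z) / (2 * \<kappa>)"
      using \<kappa> by (simp add: norm_divide add_divide_distrib)
    finally show ?thesis .
  qed
  have "Re \<sigma> \<noteq> 0" using Re2 True \<kappa> by auto
  moreover have "Re \<sigma> \<ge> 0" unfolding \<sigma>_def using csqrt_principal[of "z / \<kappa>"] by auto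
  ultimately have "Re \<sigma> > 0" by simp
  then obtain p where p: "p \<noteq> 0" "norm p < 1" "\<sigma> = 1 / p - p"
    by (rule exists_inverse_minus_self)
  define q where "q = p\<^sup>2"
  have q: "norm q < 1" "q \<noteq> 0"
    using p by (auto simp: q_def norm_power power_less_one_iff)
  have zq: "z = \<kappa> * (1 / q - 2 + q)"
  proof -
    have "z = \<kappa> * \<sigma>\<^sup>2" using sq \<kappa> by simp
    also have "\<sigma>\<^sup>2 = 1 / q - 2 + q"
      using p(1) unfolding p(3) q_def by (simp add: field_simps power2_eq_square)
    finally show ?thesis .
  qed
  define u where "u = (\<lambda>k. Y k - q * Y (k + 1))"
  have u_eq: "u k - q * u (k - 1) = q / \<kappa> * g k" for k
    using q \<kappa> unfolding u_def eq[of k, symmetric] zq by (simp add: field_simps)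
  have "bounded (range u)"
  proof -
    obtain B where B: "\<And>k. norm (Y k) \<le> B" using bdd by (auto simp: bounded_iff)
    have "norm (u k) \<le> B + norm q * B" for k
      unfolding u_def using B[of k] B[of "k + 1"]
      by (intro order_trans[OF norm_triangle_ineq4] add_mono) (auto simp: norm_mult mult_left_mono)
    then show ?thesis by (auto simp: bounded_iff)
  qed
  then have "norm (u k) * (1 - norm q) \<le> norm q * M / \<kappa>" for k
    by (intro shifted_difference_bound[where s = "\<lambda>k. k - 1"] q)
       (use u_eq \<kappa> g in \<open>auto simp: norm_mult norm_divide mult_left_mono divide_right_mono\<close>)
  then have "norm (Y k - q * Y (k + 1)) \<le> norm q * M / \<kappa> / (1 - norm q)" for k
    using q by (simp add: u_def pos_le_divide_eq del: divide_divide_eq_left divide_divide_eq_right)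
  from shifted_difference_bound[OF q(1) bdd this]
  have "norm (Y k) * (1 - norm q) \<le> norm q * M / \<kappa> / (1 - norm q)" .
  then have "norm (Y k) * (1 - norm q) * (1 - norm q) \<le> norm q * M / \<kappa>"
    using q by (simp add: pos_le_divide_eq del: divide_divide_eq_left divide_divide_eq_right)
  then have "norm (Y k) * (1 - norm q) * (1 - norm q) / norm q \<le> norm q * M / \<kappa> / norm q"
    by (rule divide_right_mono) simp
  then have fin: "norm (Y k) * ((1 - norm q)\<^sup>2 / norm q) \<le> M / \<kappa>"
    using q by (simp add: power2_eq_square mult.assoc)
  \<comment> \<open>Re (1 / p - p) = Re p * (1 - norm q) / norm q, and (Re p)^2 is at most (norm
    p)^2 = norm q.\<close>
  have "(Re \<sigma>)\<^sup>2 \<le> (1 - norm q)\<^sup>2 / norm q"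
  proof -
    have "Re (1 / p) = Re p / norm q"
      using p(1) by (simp add: Re_divide q_def norm_power cmod_power2)
    then have "(Re \<sigma>)\<^sup>2 = (Re p)\<^sup>2 * ((1 - norm q)\<^sup>2 / (norm q)\<^sup>2)"
      using q unfolding p(3) by (simp add: diff_divide_distrib power2_eq_square) (simp add: field_simps)
    also have "\<dots> \<le> norm q * ((1 - norm q)\<^sup>2 / (norm q)\<^sup>2)"
      by (intro mult_right_mono) (auto simp: q_def norm_power cmod_power2)
    also have "\<dots> = (1 - norm q)\<^sup>2 / norm q"
      using q by (simp add: power2_eq_square)
    finally show ?thesis .
  qed
  then have "norm (Y k) * (Re \<sigma>)\<^sup>2 \<le> M / \<kappa>"
    using fin by (meson mult_left_mono norm_ge_zero order_trans)
  then have "2 * \<kappa> * (norm (Y k) * (Re \<sigma>)\<^sup>2) \<le> 2 * \<kappa> * (M / \<kappa>)"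
    using \<kappa> by (intro mult_left_mono) auto
  moreover have "2 * \<kappa> * (norm (Y k) * (Re \<sigma>)\<^sup>2) = norm (Y k) * (norm z + Re z)"
    using \<kappa> unfolding Re2 by simp
  ultimately show ?thesis using \<kappa> by simp
qed

text \<open>Period 2 K and oddness about both 0 and K turn the Dirichlet problem into an equation on
  all integers: at a multiple of K the value is zero and the two neighbours are opposite, so the
  second difference vanishes there. The branch m > K is the reflection of m to 2 K - m with a change
  of sign.\<close>

definition odd_extension :: "nat \<Rightarrow> (nat \<Rightarrow> complex) \<Rightarrow> int \<Rightarrow> complex" where
  "odd_extension K y k = (let m = k mod (2 * int K) in
     if m \<le> int K then y (nat m) else - y (nat (2 * int K - m)))"

lemma odd_extension_neighbours:
  fixes y :: "nat \<Rightarrow> complex" and K :: nat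
  assumes K: "K > 0" and y0: "y 0 = 0" and yK: "y K = 0"
  shows "odd_extension K y (k + 1) = (let m = k mod (2 * int K) in
             if m < int K then y (nat m + 1) else - y (nat (2 * int K - m) - 1))"
    and "odd_extension K y (k - 1) = (let m = k mod (2 * int K) in
             if m = 0 then - y 1 else if m \<le> int K then y (nat m - 1) else - y (nat (2 * int K - m) + 1))"
proof -
  define m where "m = k mod (2 * int K)"
  have m: "0 \<le> m" "m < 2 * int K" using K by (auto simp: m_def)
  have up: "(k + 1) mod (2 * int K) = (if m = 2 * int K - 1 then 0 else m + 1)"
  proof -
    have "(k + 1) mod (2 * int K) = (m + 1) mod (2 * int K)" by (simp add: m_def mod_add_left_eq)
    then show ?thesis using m by auto
  qed
  have dn: "(k - 1) mod (2 * int K) = (if m = 0 then 2 * int K - 1 else m - 1)"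
  proof -
    have "(k - 1) mod (2 * int K) = (m - 1) mod (2 * int K)" by (simp add: m_def mod_diff_left_eq)
    moreover have "(-1) mod (2 * int K) = 2 * int K - 1" using K by (simp add: zmod_minus1)
    ultimately show ?thesis using m by auto
  qed
  show "odd_extension K y (k + 1) = (let m = k mod (2 * int K) in
             if m < int K then y (nat m + 1) else - y (nat (2 * int K - m) - 1))"
  proof -
    have s: "nat (m + 1) = nat m + 1" using m by simp
    have s2: "nat (2 * int K - (m + 1)) = nat (2 * int K - m) - 1" using m by simp
    consider "m < int K" | "m = int K" | "m > int K" by linarith
    then show ?thesis
    proof cases
      case 1
      then show ?thesis unfolding odd_extension_def up Let_def m_def[symmetric] using s by auto
    next
      case 2
      have "nat (2 * int K - m) - 1 = K - 1" using 2 by simp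
      then show ?thesis unfolding odd_extension_def up Let_def m_def[symmetric] using 2 s s2 K y0 by auto
    next
      case 3
      then show ?thesis unfolding odd_extension_def up Let_def m_def[symmetric] using s s2 y0 by auto
    qed
  qed
  show "odd_extension K y (k - 1) = (let m = k mod (2 * int K) in
             if m = 0 then - y 1 else if m \<le> int K then y (nat m - 1) else - y (nat (2 * int K - m) + 1))"
  proof -
    have s: "nat (m - 1) = nat m - 1" using m by simp
    have s2: "nat (2 * int K - (m - 1)) = nat (2 * int K - m) + 1" using m by simp
    consider "m = 0" | "0 < m" "m \<le> int K" | "m = int K + 1" | "m > int K + 1" using m by linarith
    then show ?thesis
    proof cases
      case 1
    show ?thesis
      \<comment> \<open>For \<open>K = 1\<close> the residue 2 K - 1 equals K and falls into the
        unreflected branch; both sides are then zero because of \<open>y K = 0\<close>.\<close>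
      proof (cases "K = 1")
        case True
        then show ?thesis unfolding odd_extension_def dn Let_def m_def[symmetric] using 1 yK by auto
      next
        case False
        then have "nat (2 * int K - (2 * int K - 1)) = 1" "\<not> 2 * int K - 1 \<le> int K" using K by auto
        then show ?thesis unfolding odd_extension_def dn Let_def m_def[symmetric] using 1 by auto
      qed
    next
      case 2
      then show ?thesis unfolding odd_extension_def dn Let_def m_def[symmetric] using s by auto
    next
      case 3
      have "nat (2 * int K - m) + 1 = K" using 3 m by simp
      then show ?thesis unfolding odd_extension_def dn Let_def m_def[symmetric] using 3 yK by auto
    next
      case 4
      then show ?thesis unfolding odd_extension_def dn Let_def m_def[symmetric] using s2 by auto
    qed
  qed
qed

lemma laplacian_resolvent_bound:
  fixes y g :: "nat \<Rightarrow> complex" and \<kappa> M :: real and z :: complex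
  assumes \<kappa>: "\<kappa> > 0" and M: "M \<ge> 0" and y0: "y 0 = 0" and yK: "y K = 0"
    and eq: "\<And>i. 1 \<le> i \<Longrightarrow> i < K \<Longrightarrow> z * y i - \<kappa> * (y (i + 1) - 2 * y i + y (i - 1)) = g i"
    and g: "\<And>i. 1 \<le> i \<Longrightarrow> i < K \<Longrightarrow> norm (g i) \<le> M"
    and i: "i \<le> K"
  shows "norm (y i) * (norm z + Re z) \<le> 2 * M"
proof (cases "K = 0")
  case True
  then show ?thesis using i y0 M by simp
next
  case False
  then have K: "K > 0" by simp
  define Y where "Y = odd_extension K y"
  note ext = odd_extension_neighbours[of K y, OF K y0 yK, folded Y_def]
  \<comment> \<open>The right-hand side is read off from the extended solution: zero at the
    multiples of \<open>K\<close>, and elsewhere \<open>g\<close> at the original or, with opposite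
    sign, at the reflected index.\<close>
  define G where "G k = z * Y k - \<kappa> * (Y (k + 1) - 2 * Y k + Y (k - 1))" for k
  have "norm (G k) \<le> M" for k
  proof -
    define m where "m = k mod (2 * int K)"
    have m: "0 \<le> m" "m < 2 * int K" using K by (auto simp: m_def)
    consider "m = 0" | "m = int K" | "0 < m" "m < int K" | "m > int K" using m by linarith
    then show ?thesis
    proof cases
      case 1
      then show ?thesis
        unfolding G_def ext unfolding Y_def odd_extension_def Let_def m_def[symmetric] using K y0 yK M by simp
    next
      case 2
      then show ?thesis
        unfolding G_def ext unfolding Y_def odd_extension_def Let_def m_def[symmetric] using K y0 yK M by simp
    next
      case 3
      then have "1 \<le> nat m" "nat m < K" by auto
      from g[OF this] eq[OF this] show ?thesis
        unfolding G_def ext unfolding Y_def odd_extension_def Let_def m_def[symmetric] using 3 by simp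
    next
      case 4
      then have *: "1 \<le> nat (2 * int K - m)" "nat (2 * int K - m) < K" using m by auto
      have "G k = - (z * y (nat (2 * int K - m)) - \<kappa> * (y (nat (2 * int K - m) + 1)
         - 2 * y (nat (2 * int K - m)) + y (nat (2 * int K - m) - 1)))"
        unfolding G_def ext unfolding Y_def odd_extension_def Let_def m_def[symmetric] using 4 K by (simp add: algebra_simps)
      with g[OF *] eq[OF *] show ?thesis by simp
    qed
  qed
  moreover have "bounded (range Y)"
  proof -
    have "range Y \<subseteq> y ` {..K} \<union> (\<lambda>i. - y i) ` {..K}"
    proof clarify
      fix k assume *: "Y k \<notin> (\<lambda>i. - y i) ` {..K}"
      define m where "m = k mod (2 * int K)"
      have m: "0 \<le> m" "m < 2 * int K" using K by (auto simp: m_def)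
      show "Y k \<in> y ` {..K}"
        using * m unfolding Y_def odd_extension_def Let_def m_def[symmetric] by (auto split: if_splits simp: image_iff)
    qed
    then show ?thesis by (meson bounded_subset finite_UnI finite_atMost finite_imageI finite_imp_bounded)
  qed
  ultimately have "norm (Y (int i)) * (norm z + Re z) \<le> 2 * M"
    by (intro laplacian_resolvent_bound_int[OF \<kappa>, where g = G]) (auto simp: G_def)
  moreover have "Y (int i) = y i"
    using i K by (auto simp: Y_def odd_extension_def Let_def)
  ultimately show ?thesis by simp
qed

subsection \<open>Moment sequences and the kernels of the scheme\<close>

text \<open>Dual description of the Hausdorff moment sequences \<open>f m = \<integral> \<eta> ^ m d\<mu>(\<eta>)\<close> on \<open>[0, 1]\<close>, which
  avoids the representing measure.\<close>

definition moment_sequence :: "(nat \<Rightarrow> real) \<Rightarrow> bool" where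
  "moment_sequence f \<longleftrightarrow> (\<forall>N h. (\<forall>\<eta>\<in>{0..1}. 0 \<le> (\<Sum>m<N. h m * \<eta> ^ m)) \<longrightarrow> 0 \<le> (\<Sum>m<N. h m * f m))"

lemma moment_sequence_nonneg:
  assumes "moment_sequence f"
  shows "0 \<le> f n"
proof -
  have s: "(\<Sum>m<Suc n. (if m = n then 1 else 0) * g m) = g n" for g :: "nat \<Rightarrow> real"
    by (simp add: if_distrib[of "\<lambda>x. x * _"] cong: if_cong)
  show ?thesis
    using assms[unfolded moment_sequence_def, rule_format, of "\<lambda>m. if m = n then 1 else 0" "Suc n"]
    unfolding s by simp
qed

lemma moment_sequence_Suc_le:
  assumes "moment_sequence f"
  shows "f (Suc n) \<le> f n"
proof -
  define h where "h m = (if m = n then 1 else if m = Suc n then -1 else (0::real))" for m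
  have s: "(\<Sum>m<Suc (Suc n). h m * g m) = g n - g (Suc n)" for g :: "nat \<Rightarrow> real"
  proof -
    have "(\<Sum>m<n. h m * g m) = 0" by (intro sum.neutral) (auto simp: h_def)
    then show ?thesis by (simp add: h_def)
  qed
  have "\<eta> ^ Suc n \<le> \<eta> ^ n" if "\<eta> \<in> {0..1}" for \<eta> :: real
    using that power_decreasing[of n "Suc n" \<eta>] by simp
  then show ?thesis
    using assms[unfolded moment_sequence_def, rule_format, of h "Suc (Suc n)"]
    unfolding s by simp
qed

lemma moment_sequence_decseq: "moment_sequence f \<Longrightarrow> m \<le> n \<Longrightarrow> f n \<le> f m"
  using lift_Suc_antimono_le[of f m n] moment_sequence_Suc_le by blast

text \<open>The definition tests with polynomials, and a truncation of a nonnegative power series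
  may be negative on [0, 1]. Adding the tail \<open>e (Suc N)\<close> to the constant coefficient
  restores nonnegativity and costs only \<open>e (Suc N) * f 0\<close>, which tends to 0.\<close>

lemma moment_sequence_suminf_nonneg:
  assumes f: "moment_sequence f" and h: "summable (\<lambda>m. \<bar>h m\<bar>)"
    and geometric: "\<And>\<eta>. \<eta> \<in> {0..1} \<Longrightarrow> 0 \<le> (\<Sum>m. h m * \<eta> ^ m)"
  shows "0 \<le> (\<Sum>m. h m * f m)"
proof -
  have summ: "summable (\<lambda>m. \<bar>h m * g m\<bar>)" if "\<And>m. 0 \<le> g m" "\<And>m. g m \<le> B" for g B
  proof (rule summable_comparison_test'[where N = 0])
    show "summable (\<lambda>m. \<bar>h m\<bar> * B)" using h by (rule summable_mult2)
    show "norm \<bar>h m * g m\<bar> \<le> \<bar>h m\<bar> * B" for m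
      using that by (simp add: abs_mult mult_left_mono)
  qed
  have le0: "f m \<le> f 0" for m using moment_sequence_decseq[OF f] by simp
  define e where "e N = (\<Sum>m. \<bar>h (m + N)\<bar>)" for N
  have e_lim: "e \<longlonglongrightarrow> 0"
    unfolding e_def using suminf_exist_split2[OF h] by simp
  have ge: "0 \<le> (\<Sum>m<Suc N. h m * f m) + e (Suc N) * f 0" for N
  proof -
    define h' where "h' m = h m + (if m = 0 then e (Suc N) else 0)" for m
    have s: "(\<Sum>m<Suc N. h' m * g m) = (\<Sum>m<Suc N. h m * g m) + e (Suc N) * g 0" for g :: "nat \<Rightarrow> real"
      by (simp add: h'_def algebra_simps sum.distrib if_distrib[of "\<lambda>x. _ * x"] sum.delta del: sum.lessThan_Suc cong: if_cong)
    have "0 \<le> (\<Sum>m<Suc N. h' m * \<eta> ^ m)" if \<eta>: "\<eta> \<in> {0..1}" for \<eta>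
    proof -
      have pow: "0 \<le> \<eta> ^ m" "\<eta> ^ m \<le> 1" for m using \<eta> by (auto simp: power_le_one)
      note S = summ[of "\<lambda>m. \<eta> ^ m" 1, OF pow]
      have "0 \<le> (\<Sum>m. h m * \<eta> ^ m)" by (rule geometric[OF \<eta>])
      also have "\<dots> = (\<Sum>m. h (m + Suc N) * \<eta> ^ (m + Suc N)) + (\<Sum>m<Suc N. h m * \<eta> ^ m)"
        by (rule suminf_split_initial_segment) (rule summable_rabs_cancel[OF S])
      also have "(\<Sum>m. h (m + Suc N) * \<eta> ^ (m + Suc N)) \<le> e (Suc N)"
        unfolding e_def
      proof (rule suminf_le)
        show "summable (\<lambda>m. h (m + Suc N) * \<eta> ^ (m + Suc N))"
          using summable_rabs_cancel[OF S] by (rule summable_ignore_initial_segment)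
        show "summable (\<lambda>m. \<bar>h (m + Suc N)\<bar>)"
          using h by (rule summable_ignore_initial_segment)
        show "h (m + Suc N) * \<eta> ^ (m + Suc N) \<le> \<bar>h (m + Suc N)\<bar>" for m
          using pow[of "m + Suc N"] by (meson abs_ge_self abs_ge_zero mult_left_le mult_right_mono order_trans)
      qed
      finally show ?thesis unfolding s by simp
    qed
    then show ?thesis using f[unfolded moment_sequence_def, rule_format, of h' "Suc N"] unfolding s by simp
  qed
  have "(\<lambda>N. (\<Sum>m<Suc N. h m * f m) + e (Suc N) * f 0) \<longlonglongrightarrow> (\<Sum>m. h m * f m) + 0 * f 0"
    by (intro tendsto_intros LIMSEQ_Suc[OF e_lim] LIMSEQ_Suc[OF summable_LIMSEQ]
          summable_rabs_cancel[OF summ[OF moment_sequence_nonneg[OF f] le0]])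
  then show ?thesis
    using ge by (intro tendsto_lowerbound[of _ "\<Sum>m. h m * f m"]) auto
qed

section \<open>Negative powers as mixtures of geometric sequences\<close>

lemma Gamma_integral_scaled:
  assumes \<beta>: "\<beta> > 0" and s: "s > (0::real)"
  shows "((\<lambda>t. t powr (\<beta> - 1) * exp (- s * t)) has_integral Gamma \<beta> * s powr - \<beta>) {0..}"
proof -
  define f :: "real \<Rightarrow> real" where "f t = indicator {0..} t * t powr (\<beta> - 1) / exp t" for t
  have f_nn: "0 \<le> f t" for t by (simp add: f_def)
  have meas: "f \<in> borel_measurable borel" unfolding f_def by measurable
  have "ennreal (Gamma \<beta>) = (\<integral>\<^sup>+ t. ennreal (f t) \<partial>lborel)"
    unfolding f_def by (rule Gamma_conv_nn_integral_real[OF \<beta>])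
  also have "\<dots> = ennreal s * (\<integral>\<^sup>+ t. ennreal (f (s * t)) \<partial>lborel)"
    using nn_integral_real_affine[of "\<lambda>t. ennreal (f t)" s 0] meas s by simp
  also have "\<dots> = (\<integral>\<^sup>+ t. ennreal (s * f (s * t)) \<partial>lborel)"
    using s meas f_nn by (subst nn_integral_cmult[symmetric]) (auto simp: ennreal_mult)
  finally have "((\<lambda>t. s * f (s * t)) has_integral Gamma \<beta>) UNIV"
    using \<beta> s meas f_nn by (intro nn_integral_has_integral) (auto simp: Gamma_real_nonneg)
  then have "((\<lambda>t. s powr - \<beta> * (s * f (s * t))) has_integral s powr - \<beta> * Gamma \<beta>) UNIV"
    by (rule has_integral_mult_right)
  moreover have "s powr - \<beta> * (s * f (s * t)) = (if t \<in> {0..} then t powr (\<beta> - 1) * exp (- s * t) else 0)" for t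
  proof (cases "t \<ge> 0")
    case True
    have "s powr - \<beta> * (s * s powr (\<beta> - 1)) = 1"
      using s by (simp add: powr_minus powr_diff field_simps)
    then show ?thesis
      using True s by (simp add: f_def powr_mult exp_minus field_simps)
  next
    case False
    then have "\<not> 0 \<le> s * t" using s by (simp add: zero_le_mult_iff)
    then show ?thesis using False by (simp add: f_def)
  qed
  ultimately show ?thesis
    using has_integral_restrict_UNIV[of "{0..}" "\<lambda>t. t powr (\<beta> - 1) * exp (- s * t)"]
    by (simp add: mult.commute cong: if_cong)
qed

text \<open>By the Gamma integral, (m + u)^(-\<beta>) is a positive mixture over t >= 0 of the
  geometric sequences with ratio exp (-t), weighted by t^(\<beta> - 1) exp (-u t).\<close>

lemma moment_sequence_powr:
  assumes \<beta>: "\<beta> > 0" and u: "u > 0"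
  shows "moment_sequence (\<lambda>m. (real m + u) powr - \<beta>)"
  unfolding moment_sequence_def
proof (intro allI impI)
  fix N and h :: "nat \<Rightarrow> real"
  assume h: "\<forall>\<eta>\<in>{0..1}. 0 \<le> (\<Sum>m<N. h m * \<eta> ^ m)"
  have "((\<lambda>t. \<Sum>m<N. h m * (t powr (\<beta> - 1) * exp (- (real m + u) * t)))
          has_integral (\<Sum>m<N. h m * (Gamma \<beta> * (real m + u) powr - \<beta>))) {0..}"
    using u by (intro has_integral_sum has_integral_mult_right Gamma_integral_scaled \<beta>) auto
  moreover have "0 \<le> (\<Sum>m<N. h m * (t powr (\<beta> - 1) * exp (- (real m + u) * t)))" if "t \<in> {0..}" for t
  proof -
    have "exp (- (real m + u) * t) = exp (- u * t) * exp (- t) ^ m" for m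
      by (simp add: exp_of_nat_mult[symmetric] exp_add[symmetric] algebra_simps)
    then have "(\<Sum>m<N. h m * (t powr (\<beta> - 1) * exp (- (real m + u) * t)))
        = t powr (\<beta> - 1) * exp (- u * t) * (\<Sum>m<N. h m * exp (- t) ^ m)"
      by (simp add: sum_distrib_left mult_ac)
    also have "\<dots> \<ge> 0"
      using h that by (intro mult_nonneg_nonneg) auto
    finally show ?thesis .
  qed
  ultimately have "0 \<le> (\<Sum>m<N. h m * (Gamma \<beta> * (real m + u) powr - \<beta>))"
    by (rule has_integral_nonneg)
  also have "\<dots> = Gamma \<beta> * (\<Sum>m<N. h m * (real m + u) powr - \<beta>)"
    by (simp add: sum_distrib_left mult_ac)
  finally show "0 \<le> (\<Sum>m<N. h m * (real m + u) powr - \<beta>)"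
    using Gamma_real_pos[OF \<beta>] by (simp add: zero_le_mult_iff)
qed

text \<open>Nonnegative mixtures preserve the defining inequalities. The conditions are imposed in
  the open interval because the kernels with m = 0 are singular at \<theta> = 1.\<close>

lemma moment_sequence_integral:
  fixes w :: "real \<Rightarrow> real"
  assumes int: "\<And>m. ((\<lambda>\<theta>. w \<theta> * f \<theta> m) has_integral g m) {0..1}"
    and w: "\<And>\<theta>. \<theta> \<in> {0<..<1} \<Longrightarrow> 0 \<le> w \<theta>"
    and f: "\<And>\<theta>. \<theta> \<in> {0<..<1} \<Longrightarrow> moment_sequence (f \<theta>)"
  shows "moment_sequence g"
  unfolding moment_sequence_def
proof (intro allI impI)
  fix N and h :: "nat \<Rightarrow> real"
  assume h: "\<forall>\<eta>\<in>{0..1}. 0 \<le> (\<Sum>m<N. h m * \<eta> ^ m)"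
  have "((\<lambda>\<theta>. \<Sum>m<N. h m * (w \<theta> * f \<theta> m)) has_integral (\<Sum>m<N. h m * g m)) {0<..<1}"
    using int by (intro has_integral_sum has_integral_mult_right) (auto simp: has_integral_Icc_iff_Ioo)
  moreover have "0 \<le> (\<Sum>m<N. h m * (w \<theta> * f \<theta> m))" if "\<theta> \<in> {0<..<1}" for \<theta>
  proof -
    have "(\<Sum>m<N. h m * (w \<theta> * f \<theta> m)) = w \<theta> * (\<Sum>m<N. h m * f \<theta> m)"
      by (simp add: sum_distrib_left mult_ac)
    also have "\<dots> \<ge> 0"
      using f[OF that] h w[OF that] unfolding moment_sequence_def by (intro mult_nonneg_nonneg) auto
    finally show ?thesis .
  qed
  ultimately show "0 \<le> (\<Sum>m<N. h m * g m)" by (rule has_integral_nonneg)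
qed

section \<open>The kernels of the linear, quadratic and cubic parts\<close>

text \<open>Coefficients of the first, second and third backward differences on one mesh cell, up to the
  factor \<open>\<tau> powr (-\<alpha>) / Gamma (1 - \<alpha>)\<close>; the polynomials are the derivatives of the Newton basis.\<close>

definition kernel :: "real \<Rightarrow> (real \<Rightarrow> real) \<Rightarrow> nat \<Rightarrow> real" where
  "kernel \<alpha> w m = integral {0..1} (\<lambda>\<theta>. w \<theta> * (real m + 1 - \<theta>) powr - \<alpha>)"

abbreviation "lin_kernel \<alpha> \<equiv> kernel \<alpha> (\<lambda>\<theta>. 1)"
abbreviation "quad_kernel \<alpha> \<equiv> kernel \<alpha> (\<lambda>\<theta>. \<theta> - 1 / 2)"
abbreviation "cubic_kernel \<alpha> \<equiv> kernel \<alpha> (\<lambda>\<theta>. (3 * \<theta>\<^sup>2 - 1) / 6)"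

lemma kernel_has_integral:
  assumes "0 < \<alpha>" "\<alpha> < 1" and w: "\<And>\<theta>. w \<theta> = poly q \<theta>"
  shows "((\<lambda>\<theta>. w \<theta> * (real m + 1 - \<theta>) powr - \<alpha>) has_integral kernel \<alpha> w m) {0..1}"
proof -
  have "(\<lambda>\<theta>. w \<theta> * (real m + 1 - \<theta>) powr - \<alpha>) integrable_on {0..1}"
    using caputo_integrand_integrable[OF assms(1,2), of 0 1 "real m + 1" q]
    by (simp add: w mult.commute)
  then show ?thesis unfolding kernel_def by (rule integrable_integral)
qed

text \<open>Integration by parts: a weight with vanishing mean is replaced by its negative primitive \<open>W\<close>,
  which raises the order of decay by one.\<close>

lemma kernel_by_parts:
  assumes \<alpha>: "0 < \<alpha>" "\<alpha> < 1" and w: "\<And>\<theta>. w \<theta> = poly q \<theta>"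
    and W: "\<And>\<theta>. W \<theta> = (1 - \<theta>) * poly r \<theta>" and W0: "W 0 = 0"
    and deriv: "\<And>\<theta>. (W has_real_derivative - w \<theta>) (at \<theta>)"
  shows "((\<lambda>\<theta>. \<alpha> * W \<theta> * (real m + 1 - \<theta>) powr (- \<alpha> - 1)) has_integral kernel \<alpha> w m) {0..1}"
proof -
  define F where "F \<theta> = W \<theta> * (real m + 1 - \<theta>) powr - \<alpha>" for \<theta>
  define F' where "F' \<theta> = - (w \<theta> * (real m + 1 - \<theta>) powr - \<alpha>) + \<alpha> * W \<theta> * (real m + 1 - \<theta>) powr (- \<alpha> - 1)" for \<theta>
  have "(F' has_integral (F 1 - F 0)) {0..1}"
  proof (rule fundamental_theorem_of_calculus_interior)
    have "continuous_on {0..1} (\<lambda>\<theta>. (1 - \<theta>) * (real m + 1 - \<theta>) powr - \<alpha>)"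
    \<comment> \<open>For m = 0 the power is singular at \<theta> = 1; the factor 1 - \<theta> of
      \<open>W\<close> turns it into (1 - \<theta>)^(1 - \<alpha>), which is continuous up to the
      endpoint.\<close>
    proof (cases "m = 0")
      case True
      have "continuous_on {0..1} (\<lambda>\<theta>::real. (1 - \<theta>) powr (1 - \<alpha>))"
        using \<alpha> by (intro continuous_on_powr' continuous_intros) auto
      moreover have "(1 - \<theta>) powr (1 - \<alpha>) = (1 - \<theta>) * (real m + 1 - \<theta>) powr - \<alpha>" if "\<theta> \<in> {0..1}" for \<theta>
        using that True powr_mult_base[of "1 - \<theta>" "- \<alpha>"] by simp
      ultimately show ?thesis by (rule continuous_on_eq)
    next
      case False
      then have "\<forall>\<theta>\<in>{0..1}. real m + 1 - \<theta> \<noteq> 0" by auto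
      then show ?thesis by (intro continuous_intros)
    qed
    then have "continuous_on {0..1} (\<lambda>\<theta>. poly r \<theta> * ((1 - \<theta>) * (real m + 1 - \<theta>) powr - \<alpha>))"
      by (intro continuous_on_mult[OF continuous_on_poly[OF continuous_on_id]])
    then show "continuous_on {0..1} F" unfolding F_def W by (simp add: mult_ac)
  next
    fix \<theta> :: real assume \<theta>: "\<theta> \<in> {0<..<1}"
    have "((\<lambda>\<theta>. (real m + 1 - \<theta>) powr - \<alpha>) has_real_derivative \<alpha> * (real m + 1 - \<theta>) powr (- \<alpha> - 1)) (at \<theta>)"
      using \<theta> by (auto intro!: derivative_eq_intros)
    from DERIV_mult[OF deriv this] have "(F has_real_derivative F' \<theta>) (at \<theta>)"
      unfolding F_def F'_def by (rule DERIV_cong) simp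
    then show "(F has_vector_derivative F' \<theta>) (at \<theta>)"
      by (simp add: has_real_derivative_iff_has_vector_derivative)
  qed simp
  moreover have "F 1 - F 0 = 0" by (simp add: F_def W0) (simp add: W)
  ultimately have "(F' has_integral 0) {0..1}" by simp
  from has_integral_add[OF this kernel_has_integral[OF \<alpha> w, of m]] show ?thesis
    by (simp add: F'_def)
qed

text \<open>The weights \<theta> - 1/2 and (3 \<theta>^2 - 1) / 6 change sign but have mean zero.
  Their negative primitives vanish at both endpoints and are nonnegative in between, which is what
  makes these kernels moment sequences.\<close>

lemma
  assumes \<alpha>: "0 < \<alpha>" "\<alpha> < 1"
  shows quad_kernel_by_parts:
      "((\<lambda>\<theta>. \<alpha> * (\<theta> * (1 - \<theta>) / 2) * (real m + 1 - \<theta>) powr (- \<alpha> - 1)) has_integral quad_kernel \<alpha> m) {0..1}"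
    and cubic_kernel_by_parts:
      "((\<lambda>\<theta>. \<alpha> * (\<theta> * (1 - \<theta>\<^sup>2) / 6) * (real m + 1 - \<theta>) powr (- \<alpha> - 1)) has_integral cubic_kernel \<alpha> m) {0..1}"
proof -
  have "((\<lambda>\<theta>. \<theta> * (1 - \<theta>) / 2) has_real_derivative - (\<theta> - 1 / 2)) (at \<theta>)" for \<theta> :: real
    by (rule derivative_eq_intros refl | simp)+
  then show "((\<lambda>\<theta>. \<alpha> * (\<theta> * (1 - \<theta>) / 2) * (real m + 1 - \<theta>) powr (- \<alpha> - 1)) has_integral quad_kernel \<alpha> m) {0..1}"
    by (intro kernel_by_parts[OF \<alpha>, of _ "[:-1/2, 1:]" _ "[:0, 1/2:]"]) auto
  have "((\<lambda>\<theta>. \<theta> * (1 - \<theta>\<^sup>2) / 6) has_real_derivative - ((3 * \<theta>\<^sup>2 - 1) / 6)) (at \<theta>)" for \<theta> :: real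
  proof -
    have "((\<lambda>\<theta>. \<theta> * (1 - \<theta>\<^sup>2) / 6) has_real_derivative (1 * (1 - \<theta>\<^sup>2) + - (2 * \<theta>) * \<theta>) / 6) (at \<theta>)"
      by (rule derivative_eq_intros refl | simp)+
    then show ?thesis by (rule DERIV_cong) (simp add: power2_eq_square field_simps)
  qed
  then show "((\<lambda>\<theta>. \<alpha> * (\<theta> * (1 - \<theta>\<^sup>2) / 6) * (real m + 1 - \<theta>) powr (- \<alpha> - 1)) has_integral cubic_kernel \<alpha> m) {0..1}"
    by (intro kernel_by_parts[OF \<alpha>, of _ "[:-1/6, 0, 1/2:]" _ "[:0, 1/6, 1/6:]"])
       (auto simp: power2_eq_square algebra_simps diff_divide_distrib)
qed

lemma moment_sequence_lin_kernel:
  assumes \<alpha>: "0 < \<alpha>" "\<alpha> < 1"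
  shows "moment_sequence (lin_kernel \<alpha>)"
proof (rule moment_sequence_integral)
  show "((\<lambda>\<theta>. 1 * (real m + 1 - \<theta>) powr - \<alpha>) has_integral lin_kernel \<alpha> m) {0..1}" for m
    by (rule kernel_has_integral[OF \<alpha>, of _ "1"]) simp
  show "moment_sequence (\<lambda>m. (real m + 1 - \<theta>) powr - \<alpha>)" if "\<theta> \<in> {0<..<1}" for \<theta>
    using moment_sequence_powr[of \<alpha> "1 - \<theta>"] \<alpha> that by (simp add: add_diff_eq)
qed simp

lemma moment_sequence_by_parts:
  assumes \<alpha>: "0 < \<alpha>" "\<alpha> < 1"
    and int: "\<And>m. ((\<lambda>\<theta>. W \<theta> * (real m + 1 - \<theta>) powr (- \<alpha> - 1)) has_integral g m) {0..1}"
    and W: "\<And>\<theta>. \<theta> \<in> {0<..<1} \<Longrightarrow> 0 \<le> W \<theta>"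
  shows "moment_sequence g"
proof (rule moment_sequence_integral[OF int W])
  show "moment_sequence (\<lambda>m. (real m + 1 - \<theta>) powr (- \<alpha> - 1))" if "\<theta> \<in> {0<..<1}" for \<theta>
    using moment_sequence_powr[of "\<alpha> + 1" "1 - \<theta>"] \<alpha> that by (simp add: add_diff_eq)
qed auto

lemma
  assumes \<alpha>: "0 < \<alpha>" "\<alpha> < 1"
  shows moment_sequence_quad_kernel: "moment_sequence (quad_kernel \<alpha>)"
    and moment_sequence_cubic_kernel: "moment_sequence (cubic_kernel \<alpha>)"
    and moment_sequence_quad_minus_cubic: "moment_sequence (\<lambda>m. quad_kernel \<alpha> m - cubic_kernel \<alpha> m)"
proof -
  show "moment_sequence (quad_kernel \<alpha>)"
    by (rule moment_sequence_by_parts[OF \<alpha> quad_kernel_by_parts[OF \<alpha>]]) (use \<alpha> in auto)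
  show "moment_sequence (cubic_kernel \<alpha>)"
    by (rule moment_sequence_by_parts[OF \<alpha> cubic_kernel_by_parts[OF \<alpha>]])
       (use \<alpha> in \<open>auto simp: power2_eq_square mult_le_one intro!: mult_nonneg_nonneg\<close>)
  \<comment> \<open>The difference of the two primitives keeps a sign because of the factor 2 -
    \<theta>.\<close>
  have int: "((\<lambda>\<theta>. \<alpha> * (\<theta> * (1 - \<theta>) * (2 - \<theta>) / 6) * (real m + 1 - \<theta>) powr (- \<alpha> - 1))
          has_integral quad_kernel \<alpha> m - cubic_kernel \<alpha> m) {0..1}" for m
  proof (rule has_integral_eq[OF _ has_integral_diff[OF quad_kernel_by_parts[OF \<alpha>] cubic_kernel_by_parts[OF \<alpha>]]])
    fix \<theta> :: real
    have "\<theta> * (1 - \<theta>) / 2 - \<theta> * (1 - \<theta>\<^sup>2) / 6 = \<theta> * (1 - \<theta>) * (2 - \<theta>) / 6"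
      by (simp add: field_simps power2_eq_square)
    then show "\<alpha> * (\<theta> * (1 - \<theta>) / 2) * (real m + 1 - \<theta>) powr (- \<alpha> - 1)
          - \<alpha> * (\<theta> * (1 - \<theta>\<^sup>2) / 6) * (real m + 1 - \<theta>) powr (- \<alpha> - 1)
        = \<alpha> * (\<theta> * (1 - \<theta>) * (2 - \<theta>) / 6) * (real m + 1 - \<theta>) powr (- \<alpha> - 1)"
      by (metis left_diff_distrib right_diff_distrib)
  qed
  show "moment_sequence (\<lambda>m. quad_kernel \<alpha> m - cubic_kernel \<alpha> m)"
    by (rule moment_sequence_by_parts[OF \<alpha> int]) (use \<alpha> in auto)
qed

subsection \<open>Summation by parts for power series\<close>

lemma powr_neg_diff_bounds:
  fixes \<alpha> x :: real
  assumes \<alpha>: "0 < \<alpha>" and x: "0 < x"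
  shows "\<alpha> * (x + 1) powr (- \<alpha> - 1) \<le> x powr - \<alpha> - (x + 1) powr - \<alpha>"
    and "x powr - \<alpha> - (x + 1) powr - \<alpha> \<le> \<alpha> * x powr (- \<alpha> - 1)"
proof -
  have "\<exists>\<xi>>x. \<xi> < x + 1 \<and> (x + 1) powr - \<alpha> - x powr - \<alpha> = (x + 1 - x) * (- \<alpha> * \<xi> powr (- \<alpha> - 1))"
    using x by (intro MVT2) (auto intro!: derivative_eq_intros)
  then obtain \<xi> where \<xi>: "x < \<xi>" "\<xi> < x + 1"
      "x powr - \<alpha> - (x + 1) powr - \<alpha> = \<alpha> * \<xi> powr (- \<alpha> - 1)" by auto
  then show "\<alpha> * (x + 1) powr (- \<alpha> - 1) \<le> x powr - \<alpha> - (x + 1) powr - \<alpha>"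
    and "x powr - \<alpha> - (x + 1) powr - \<alpha> \<le> \<alpha> * x powr (- \<alpha> - 1)"
    using \<alpha> x by (auto intro!: mult_left_mono powr_mono2')
qed

lemma sum_powr_head_le:
  fixes \<alpha> :: real
  assumes \<alpha>: "0 < \<alpha>" "\<alpha> < 1"
  shows "(\<Sum>m<M. (real m + 1) powr - \<alpha>) \<le> real M powr (1 - \<alpha>) / (1 - \<alpha>)"
proof (induction M)
  case (Suc M)
  have "(1 - \<alpha>) * (real M + 1) powr - \<alpha> \<le> (real M + 1) powr (1 - \<alpha>) - real M powr (1 - \<alpha>)"
  \<comment> \<open>At 0 the function x powr (1 - \<alpha>) is not differentiable; there the claim
    reads 1 - \<alpha> <= 1.\<close>
  proof (cases "M = 0")
    case False
    have "\<exists>\<xi>>real M. \<xi> < real M + 1 \<and> (real M + 1) powr (1 - \<alpha>) - real M powr (1 - \<alpha>)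
        = (real M + 1 - real M) * ((1 - \<alpha>) * \<xi> powr - \<alpha>)"
      using False by (intro MVT2) (auto intro!: derivative_eq_intros)
    then obtain \<xi> where "real M < \<xi>" "\<xi> < real M + 1"
      "(real M + 1) powr (1 - \<alpha>) - real M powr (1 - \<alpha>) = (1 - \<alpha>) * \<xi> powr - \<alpha>" by auto
    then show ?thesis using \<alpha> by (auto intro!: mult_left_mono powr_mono2')
  qed (use \<alpha> in auto)
  then have "(real M + 1) powr - \<alpha> \<le> ((real M + 1) powr (1 - \<alpha>) - real M powr (1 - \<alpha>)) / (1 - \<alpha>)"
    using \<alpha> by (simp add: field_simps)
  then show ?case using Suc.IH by (simp add: diff_divide_distrib add.commute)
qed simp

lemma sum_powr_tail_le:
  fixes \<alpha> :: real
  assumes \<alpha>: "0 < \<alpha>"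
  shows "(\<Sum>m = M..<N. (real m + 2) powr (- \<alpha> - 1)) \<le> (real M + 1) powr - \<alpha> / \<alpha>"
proof -
  have "\<alpha> * (real m + 2) powr (- \<alpha> - 1) \<le> (real m + 1) powr - \<alpha> - (real (Suc m) + 1) powr - \<alpha>" for m
    using powr_neg_diff_bounds(1)[OF \<alpha>, of "real m + 1"] by (simp add: add.commute add.left_commute)
  then have "\<alpha> * (\<Sum>m = M..<N. (real m + 2) powr (- \<alpha> - 1))
      \<le> (\<Sum>m = M..<N. (real m + 1) powr - \<alpha> - (real (Suc m) + 1) powr - \<alpha>)"
    unfolding sum_distrib_left by (intro sum_mono)
  also have "\<dots> \<le> (real M + 1) powr - \<alpha>"
  proof (cases "M \<le> N")
    case True
    then show ?thesis using sum_Suc_diff'[of M N "\<lambda>m. - ((real m + 1) powr - \<alpha>)"] by simp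
  qed simp
  finally show ?thesis using \<alpha> by (simp add: field_simps)
qed

text \<open>Summation by parts beyond the index \<open>M \<approx> 1 / norm (1 - \<zeta>)\<close>.\<close>

lemma power_sum_bound:
  fixes g :: "nat \<Rightarrow> real" and \<zeta> :: complex
  assumes \<alpha>: "0 < \<alpha>" "\<alpha> < 1" and C: "0 \<le> C" and \<zeta>: "norm \<zeta> \<le> 1" "\<zeta> \<noteq> 1"
    and g: "\<And>m. \<bar>g m\<bar> \<le> C * (real m + 1) powr - \<alpha>"
    and var: "\<And>M N. (\<Sum>m = M..<N. \<bar>g (Suc m) - g m\<bar>) \<le> C * (real M + 1) powr - \<alpha>"
  shows "norm (\<Sum>m<N. g m * \<zeta> ^ m) \<le> C * (3 / (1 - \<alpha>) + 3) * norm (1 - \<zeta>) powr (\<alpha> - 1)"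
proof -
  define D where "D = norm (1 - \<zeta>)"
  have D: "D > 0" using \<zeta> by (simp add: D_def)
  have D2: "D \<le> 2" using norm_triangle_ineq4[of 1 \<zeta>] \<zeta> by (simp add: D_def)
  \<comment> \<open>At this index the two estimates balance: M^(1 - \<alpha>) from the absolute
    values of the head and M^(-\<alpha>) / D from the summation by parts are both of order
    D^(\<alpha> - 1). The bound M <= 3 / D uses D <= 2.\<close>
  define M where "M = nat \<lceil>1 / D\<rceil>"
  have M1: "1 / D \<le> real M" unfolding M_def by (rule real_nat_ceiling_ge)
  have "real M \<le> 1 / D + 1" using D by (simp add: M_def)
  also have "\<dots> \<le> 3 / D" using D D2 by (simp add: field_simps)
  finally have M2: "real M \<le> 3 / D" .
  have head: "norm (\<Sum>m<K. g m * \<zeta> ^ m) \<le> C * (3 / (1 - \<alpha>)) * D powr (\<alpha> - 1)" if "K \<le> M" for K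
  proof -
    have "norm (\<Sum>m<K. g m * \<zeta> ^ m) \<le> (\<Sum>m<K. C * (real m + 1) powr - \<alpha>)"
    proof (rule sum_norm_le)
      fix m
      have "norm (g m * \<zeta> ^ m) \<le> \<bar>g m\<bar> * 1"
        using \<zeta> unfolding norm_mult norm_power by (intro mult_mono) (auto simp: power_le_one)
      then show "norm (g m * \<zeta> ^ m) \<le> C * (real m + 1) powr - \<alpha>" using g[of m] by simp
    qed
    also have "\<dots> \<le> C * (real K powr (1 - \<alpha>) / (1 - \<alpha>))"
      unfolding sum_distrib_left[symmetric] by (intro mult_left_mono sum_powr_head_le \<alpha> C)
    also have "\<dots> \<le> C * ((3 / D) powr (1 - \<alpha>) / (1 - \<alpha>))"
      using \<alpha> C M2 that by (intro mult_left_mono divide_right_mono powr_mono2) auto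
    also have "(3 / D) powr (1 - \<alpha>) = 3 powr (1 - \<alpha>) * D powr (\<alpha> - 1)"
      using D powr_minus_divide[of D "1 - \<alpha>"] by (simp add: powr_divide)
    also have "C * (3 powr (1 - \<alpha>) * D powr (\<alpha> - 1) / (1 - \<alpha>)) \<le> C * (3 * D powr (\<alpha> - 1) / (1 - \<alpha>))"
      using \<alpha> C powr_mono[of "1 - \<alpha>" 1 3] by (intro mult_left_mono divide_right_mono mult_right_mono) auto
    finally show ?thesis by simp
  qed
  show ?thesis
  proof (cases "N \<le> M")
    case True
    have "C * (3 / (1 - \<alpha>)) * D powr (\<alpha> - 1) \<le> C * (3 / (1 - \<alpha>) + 3) * D powr (\<alpha> - 1)"
      using C by (intro mult_right_mono mult_left_mono) auto
    with head[OF True] show ?thesis unfolding D_def by linarith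
  next
    case False
    then have MN: "M \<le> N" by simp
    \<comment> \<open>After multiplication by 1 - \<zeta> two boundary terms and the increments of
      \<open>g\<close> remain. From \<open>M\<close> on each of these three is at most C *
      D^\<alpha>, hence the constant 3 after division by D.\<close>
    have abel: "(1 - \<zeta>) * (\<Sum>m = M..<N. g m * \<zeta> ^ m)
        = g M * \<zeta> ^ M - g N * \<zeta> ^ N + (\<Sum>m = M..<N. (g (Suc m) - g m) * \<zeta> ^ Suc m)"
      using MN
    proof (induction N rule: dec_induct)
      case (step n)
      then show ?case
        unfolding sum.atLeastLessThan_Suc[OF step.hyps(1)] distrib_left step.IH
        by (simp add: left_diff_distrib)
    qed simp
    have pw: "norm (\<zeta> ^ m) \<le> 1" for m using \<zeta> by (simp add: norm_power power_le_one)
    have small: "C * (real K + 1) powr - \<alpha> \<le> C * D powr \<alpha>" if "M \<le> K" for K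
    proof -
      have "(real K + 1) powr - \<alpha> \<le> (1 / D) powr - \<alpha>"
        using \<alpha> D M1 that by (intro powr_mono2') auto
      also have "\<dots> = D powr \<alpha>" using D powr_minus_divide[of D \<alpha>] by (simp add: powr_divide powr_minus)
      finally show ?thesis using C by (rule mult_left_mono)
    qed
    have "norm ((1 - \<zeta>) * (\<Sum>m = M..<N. g m * \<zeta> ^ m))
        \<le> norm (g M * \<zeta> ^ M - g N * \<zeta> ^ N) + norm (\<Sum>m = M..<N. (g (Suc m) - g m) * \<zeta> ^ Suc m)"
      unfolding abel by (rule norm_triangle_ineq)
    also have "norm (g M * \<zeta> ^ M - g N * \<zeta> ^ N) \<le> \<bar>g M\<bar> * norm (\<zeta> ^ M) + \<bar>g N\<bar> * norm (\<zeta> ^ N)"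
      by (rule order_trans[OF norm_triangle_ineq4]) (simp add: norm_mult)
    also have "\<bar>g M\<bar> * norm (\<zeta> ^ M) \<le> C * D powr \<alpha>"
      using mult_left_le[OF pw[of M], of "\<bar>g M\<bar>"] g[of M] small[of M] by simp
    also have "\<bar>g N\<bar> * norm (\<zeta> ^ N) \<le> C * D powr \<alpha>"
      using mult_left_le[OF pw[of N], of "\<bar>g N\<bar>"] g[of N] small[OF MN] by simp
    also have "norm (\<Sum>m = M..<N. (g (Suc m) - g m) * \<zeta> ^ Suc m) \<le> (\<Sum>m = M..<N. \<bar>g (Suc m) - g m\<bar>)"
    proof (rule sum_norm_le)
      show "norm ((g (Suc m) - g m) * \<zeta> ^ Suc m) \<le> \<bar>g (Suc m) - g m\<bar>" for m
        using mult_left_le[OF pw[of "Suc m"], of "\<bar>g (Suc m) - g m\<bar>"]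
        by (simp add: norm_mult flip: of_real_diff)
    qed
    also have "\<dots> \<le> C * D powr \<alpha>" using var[of M N] small[of M] by simp
    finally have "D * norm (\<Sum>m = M..<N. g m * \<zeta> ^ m) \<le> 3 * C * D powr \<alpha>"
      by (simp add: norm_mult D_def)
    then have "norm (\<Sum>m = M..<N. g m * \<zeta> ^ m) \<le> 3 * C * D powr (\<alpha> - 1)"
      using D by (simp add: powr_diff field_simps)
    moreover have "(\<Sum>m<N. g m * \<zeta> ^ m) = (\<Sum>m<M. g m * \<zeta> ^ m) + (\<Sum>m = M..<N. g m * \<zeta> ^ m)"
      using MN by (simp add: lessThan_atLeast0 sum.atLeastLessThan_concat)
    ultimately have "norm (\<Sum>m<N. g m * \<zeta> ^ m) \<le> C * (3 / (1 - \<alpha>)) * D powr (\<alpha> - 1) + 3 * C * D powr (\<alpha> - 1)"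
      using head[of M] norm_triangle_ineq[of "\<Sum>m<M. g m * \<zeta> ^ m" "\<Sum>m = M..<N. g m * \<zeta> ^ m"] by simp
    then show ?thesis by (simp add: D_def algebra_simps)
  qed
qed

definition cfps :: "(nat \<Rightarrow> real) \<Rightarrow> complex fps" where
  "cfps f = Abs_fps (\<lambda>n. of_real (f n))"

lemma cfps_nth [simp]: "fps_nth (cfps f) n = of_real (f n)"
  by (simp add: cfps_def)

lemma fps_conv_radius_ge_1:
  fixes F :: "complex fps"
  assumes "\<And>n. norm (fps_nth F n) \<le> B"
  shows "fps_conv_radius F \<ge> 1"
  unfolding fps_conv_radius_def
proof (rule conv_radius_geI_ex')
  fix r :: real assume r: "0 < r" "ereal r < 1"
  show "summable (\<lambda>n. fps_nth F n * of_real r ^ n)"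
  proof (rule summable_comparison_test'[where N = 0])
    show "summable (\<lambda>n. B * r ^ n)" using r by (intro summable_mult summable_geometric) auto
    show "norm (fps_nth F n * of_real r ^ n) \<le> B * r ^ n" for n
      using r assms[of n] by (simp add: norm_mult norm_power mult_right_mono)
  qed
qed

lemma eval_fps_norm_le:
  fixes F :: "complex fps"
  assumes "norm z < fps_conv_radius F" "\<And>N. norm (\<Sum>n<N. fps_nth F n * z ^ n) \<le> B"
  shows "norm (eval_fps F z) \<le> B"
  using sums_eval_fps[OF assms(1)] assms(2)
  by (intro tendsto_upperbound[OF tendsto_norm]) (auto simp: sums_def)

text \<open>The variation of a decreasing nonnegative sequence from M on telescopes to at most e M,
  so the decay of e alone supplies both hypotheses of \<open>power_sum_bound\<close>.\<close>

lemma eval_fps_antimono_bound: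
  fixes e :: "nat \<Rightarrow> real"
  assumes \<alpha>: "0 < \<alpha>" "\<alpha> < 1" and \<zeta>: "norm \<zeta> < 1"
    and dec: "\<And>m. e (Suc m) \<le> e m" and nn: "\<And>m. 0 \<le> e m"
    and e: "\<And>m. e m \<le> C * (real m + 1) powr - \<alpha>"
  shows "norm (eval_fps (cfps e) \<zeta>) \<le> C * (3 / (1 - \<alpha>) + 3) * norm (1 - \<zeta>) powr (\<alpha> - 1)"
proof (rule eval_fps_norm_le)
  have C: "C \<ge> 0" using e[of 0] nn[of 0] by simp
  have "e m \<le> C" for m
    using lift_Suc_antimono_le[of e 0 m] dec e[of 0] by force
  then have "fps_conv_radius (cfps e) \<ge> 1"
    using nn by (intro fps_conv_radius_ge_1[of _ C]) auto
  then show "ereal (norm \<zeta>) < fps_conv_radius (cfps e)"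
    using \<zeta> by (metis ereal_less(3) order_less_le_trans)
  have var: "(\<Sum>m = M..<N. \<bar>e (Suc m) - e m\<bar>) \<le> C * (real M + 1) powr - \<alpha>" for M N
  proof (cases "M \<le> N")
    case True
    have "\<bar>e (Suc m) - e m\<bar> = - (e (Suc m) - e m)" for m using dec[of m] by simp
    then have "(\<Sum>m = M..<N. \<bar>e (Suc m) - e m\<bar>) = - (\<Sum>m = M..<N. e (Suc m) - e m)"
      by (simp only: sum_negf)
    also have "\<dots> = e M - e N" using True by (simp add: sum_Suc_diff')
    finally show ?thesis using e[of M] nn[of N] by simp
  qed (use C in auto)
  have "\<zeta> \<noteq> 1" using \<zeta> by auto
  with var show "norm (\<Sum>n<N. fps_nth (cfps e) n * \<zeta> ^ n) \<le> C * (3 / (1 - \<alpha>) + 3) * norm (1 - \<zeta>) powr (\<alpha> - 1)" for N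
    using power_sum_bound[OF \<alpha> C, of \<zeta> e] \<zeta> e nn by simp
qed

text \<open>Such weights arise from differentiating a power series. The product (m + 1) * e m need
  not be monotone, but its increments are at most its decrease plus 2 * e (m + 1); the tail sum of e
  brings in the factor 1 / \<alpha>, whence 1 + 2 / \<alpha>.\<close>

lemma eval_fps_weighted_antimono_bound:
  fixes e :: "nat \<Rightarrow> real"
  assumes \<alpha>: "0 < \<alpha>" "\<alpha> < 1" and \<zeta>: "norm \<zeta> < 1"
    and dec: "\<And>m. e (Suc m) \<le> e m" and nn: "\<And>m. 0 \<le> e m"
    and e: "\<And>m. e m \<le> C * (real m + 1) powr (- \<alpha> - 1)"
  shows "norm (eval_fps (cfps (\<lambda>m. (real m + 1) * e m)) \<zeta>)
    \<le> C * (1 + 2 / \<alpha>) * (3 / (1 - \<alpha>) + 3) * norm (1 - \<zeta>) powr (\<alpha> - 1)"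
proof (rule eval_fps_norm_le)
  define g where "g m = (real m + 1) * e m" for m
  have C: "C \<ge> 0" using e[of 0] nn[of 0] by simp
  have g_nn: "0 \<le> g m" for m using nn by (simp add: g_def)
  have g: "g m \<le> C * (real m + 1) powr - \<alpha>" for m
  proof -
    have "g m \<le> (real m + 1) * (C * (real m + 1) powr (- \<alpha> - 1))"
      unfolding g_def by (intro mult_left_mono e) simp
    also have "\<dots> = C * (real m + 1) powr - \<alpha>" by (simp add: powr_diff)
    finally show ?thesis .
  qed
  have powr_le: "(real m + 1) powr - \<alpha> \<le> 1" for m
    using powr_mono2'[of "-\<alpha>" 1 "real m + 1"] \<alpha> by simp
  then have "g m \<le> C" for m using g[of m] C mult_left_le[of "(real m + 1) powr - \<alpha>" C] by force
  then have "fps_conv_radius (cfps g) \<ge> 1"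
    using g_nn by (intro fps_conv_radius_ge_1[of _ C]) auto
  then show "ereal (norm \<zeta>) < fps_conv_radius (cfps (\<lambda>m. (real m + 1) * e m))"
    using \<zeta> unfolding g_def by (metis ereal_less(3) order_less_le_trans)
  have C': "C \<le> C * (1 + 2 / \<alpha>)" "0 \<le> C * (1 + 2 / \<alpha>)"
    using C \<alpha> by (auto simp: algebra_simps)
  have var: "(\<Sum>m = M..<N. \<bar>g (Suc m) - g m\<bar>) \<le> C * (1 + 2 / \<alpha>) * (real M + 1) powr - \<alpha>" for M N
  proof (cases "M \<le> N")
    case True
    have "(\<Sum>m = M..<N. \<bar>g (Suc m) - g m\<bar>) \<le> (\<Sum>m = M..<N. (- g (Suc m) - - g m) + 2 * e (Suc m))"
    proof (rule sum_mono)
      fix m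
      have "g (Suc m) - g m = (real m + 1) * (e (Suc m) - e m) + e (Suc m)"
        by (simp add: g_def algebra_simps)
      moreover have "(real m + 1) * (e (Suc m) - e m) \<le> 0"
        using dec[of m] by (intro mult_nonneg_nonpos) auto
      ultimately show "\<bar>g (Suc m) - g m\<bar> \<le> (- g (Suc m) - - g m) + 2 * e (Suc m)"
        using nn[of "Suc m"] by linarith
    qed
    also have "\<dots> = g M - g N + 2 * (\<Sum>m = M..<N. e (Suc m))"
      using sum_Suc_diff'[OF True, of "\<lambda>m. - g m"] unfolding sum.distrib by (simp add: sum_distrib_left)
    also have "\<dots> \<le> C * (real M + 1) powr - \<alpha> + 2 * (\<Sum>m = M..<N. C * (real m + 2) powr (- \<alpha> - 1))"
      using g[of M] g_nn[of N] e[of "Suc _"] by (intro add_mono mult_left_mono sum_mono) (auto simp: add.commute)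
    also have "(\<Sum>m = M..<N. C * (real m + 2) powr (- \<alpha> - 1)) \<le> C * ((real M + 1) powr - \<alpha> / \<alpha>)"
      unfolding sum_distrib_left[symmetric] by (intro mult_left_mono sum_powr_tail_le \<alpha> C)
    finally show ?thesis by (simp add: algebra_simps)
  qed (use C' in auto)
  have g': "\<bar>g m\<bar> \<le> C * (1 + 2 / \<alpha>) * (real m + 1) powr - \<alpha>" for m
    using g[of m] g_nn[of m] mult_right_mono[OF C'(1), of "(real m + 1) powr - \<alpha>"] by simp
  have "\<zeta> \<noteq> 1" using \<zeta> by auto
  then show "norm (\<Sum>n<N. fps_nth (cfps (\<lambda>m. (real m + 1) * e m)) n * \<zeta> ^ n)
      \<le> C * (1 + 2 / \<alpha>) * (3 / (1 - \<alpha>) + 3) * norm (1 - \<zeta>) powr (\<alpha> - 1)" for N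
    using power_sum_bound[OF \<alpha> C'(2) _ _ g' var, of \<zeta>] \<zeta> by (simp add: g_def)
qed

text \<open>Bounding m + 1 - \<theta> below by m gives a usable decay only for m >= 1. There m + 1
  <= 2 m costs the factor 2^\<beta> <= 4, and the value at 0 is put into the constant.\<close>

lemma powr_decay_shift:
  fixes e :: "nat \<Rightarrow> real"
  assumes \<beta>: "0 < \<beta>" "\<beta> \<le> 2" and e0: "0 \<le> e 0"
    and e: "\<And>m. m \<ge> 1 \<Longrightarrow> e m \<le> real m powr - \<beta>"
  shows "e m \<le> (4 + e 0) * (real m + 1) powr - \<beta>"
proof (cases "m = 0")
  case False
  then have m: "m \<ge> 1" by simp
  have "real m powr - \<beta> = 2 powr \<beta> * (2 * real m) powr - \<beta>"
    by (simp add: powr_mult powr_minus)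
  also have "\<dots> \<le> 4 * (real m + 1) powr - \<beta>"
  proof (rule mult_mono)
    show "2 powr \<beta> \<le> (4::real)" using powr_mono[of \<beta> 2 2] \<beta> by simp
    show "(2 * real m) powr - \<beta> \<le> (real m + 1) powr - \<beta>"
      using \<beta> m by (intro powr_mono2') auto
  qed auto
  also have "\<dots> \<le> (4 + e 0) * (real m + 1) powr - \<beta>" using e0 by (intro mult_right_mono) auto
  finally show ?thesis using e[OF m] by simp
qed (use e0 in simp)

lemma has_integral_const_Ioo: "((\<lambda>_::real. c) has_integral c) {0<..<1}" for c :: real
  using has_integral_const_real[of c 0 1] by (simp add: has_integral_Icc_iff_Ioo)

section \<open>Decay of the kernels\<close>

locale caputo_order =
  fixes \<alpha> :: real
  assumes \<alpha>_gt_0: "0 < \<alpha>" and \<alpha>_lt_1: "\<alpha> < 1"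
begin

lemmas \<alpha>_bounds = \<alpha>_gt_0 \<alpha>_lt_1

abbreviation "a \<equiv> lin_kernel \<alpha>"
abbreviation "b \<equiv> quad_kernel \<alpha>"
abbreviation "c \<equiv> cubic_kernel \<alpha>"

lemmas moment_a = moment_sequence_lin_kernel[OF \<alpha>_bounds]
lemmas moment_b = moment_sequence_quad_kernel[OF \<alpha>_bounds]
lemmas moment_c = moment_sequence_cubic_kernel[OF \<alpha>_bounds]
lemmas moment_b_minus_c = moment_sequence_quad_minus_cubic[OF \<alpha>_bounds]

lemma a_has_integral: "((\<lambda>\<theta>. (real m + 1 - \<theta>) powr - \<alpha>) has_integral a m) {0<..<1}"
  using kernel_has_integral[OF \<alpha>_bounds, of "\<lambda>_. 1" 1 m] by (simp add: has_integral_Icc_iff_Ioo)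

lemma a_le: "a m \<le> (4 + a 0) * (real m + 1) powr - \<alpha>"
proof (rule powr_decay_shift)
  fix m :: nat assume m: "m \<ge> 1"
  show "a m \<le> real m powr - \<alpha>"
    using m \<alpha>_bounds
    by (intro has_integral_le[OF a_has_integral has_integral_const_Ioo] powr_mono2') auto
qed (use \<alpha>_bounds moment_sequence_nonneg[OF moment_a] in auto)

lemma a_diff_has_integral:
  "((\<lambda>\<theta>. (real m + 1 - \<theta>) powr - \<alpha> - (real m + 1 - \<theta> + 1) powr - \<alpha>) has_integral a m - a (Suc m)) {0<..<1}"
  using has_integral_diff[OF a_has_integral[of m] a_has_integral[of "Suc m"]]
  by (simp add: algebra_simps)

text \<open>This lower bound is the source of coercivity: it decides the size of the real part of
  the symbol near \<zeta> = 1 and gives the strict inequality a 1 < a 0 behind the imaginary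
  part.\<close>

lemma a_diff_ge: "\<alpha> * (real m + 2) powr (- \<alpha> - 1) \<le> a m - a (Suc m)"
proof (rule has_integral_le[OF has_integral_const_Ioo a_diff_has_integral])
  fix \<theta> :: real assume \<theta>: "\<theta> \<in> {0<..<1}"
  have "\<alpha> * (real m + 2) powr (- \<alpha> - 1) \<le> \<alpha> * (real m + 1 - \<theta> + 1) powr (- \<alpha> - 1)"
    using \<theta> \<alpha>_bounds by (intro mult_left_mono powr_mono2') auto
  also have "\<dots> \<le> (real m + 1 - \<theta>) powr - \<alpha> - (real m + 1 - \<theta> + 1) powr - \<alpha>"
    using \<theta> by (intro powr_neg_diff_bounds \<alpha>_bounds) auto
  finally show "\<alpha> * (real m + 2) powr (- \<alpha> - 1) \<le> (real m + 1 - \<theta>) powr - \<alpha> - (real m + 1 - \<theta> + 1) powr - \<alpha>" .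
qed

lemma a_diff_le: "a m - a (Suc m) \<le> (4 + (a 0 - a 1)) * (real m + 1) powr (- \<alpha> - 1)"
proof -
  have "a m - a (Suc m) \<le> real m powr - (\<alpha> + 1)" if m: "m \<ge> 1" for m
  proof (rule has_integral_le[OF a_diff_has_integral has_integral_const_Ioo])
    fix \<theta> :: real assume \<theta>: "\<theta> \<in> {0<..<1}"
    have "(real m + 1 - \<theta>) powr - \<alpha> - (real m + 1 - \<theta> + 1) powr - \<alpha> \<le> \<alpha> * (real m + 1 - \<theta>) powr (- \<alpha> - 1)"
      using \<theta> by (intro powr_neg_diff_bounds \<alpha>_bounds) auto
    also have "\<dots> \<le> 1 * real m powr (- \<alpha> - 1)"
      using \<theta> m \<alpha>_bounds by (intro mult_mono powr_mono2') auto
    finally show "(real m + 1 - \<theta>) powr - \<alpha> - (real m + 1 - \<theta> + 1) powr - \<alpha> \<le> real m powr - (\<alpha> + 1)"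
      by simp
  qed
  from powr_decay_shift[of "\<alpha> + 1" "\<lambda>m. a m - a (Suc m)", OF _ _ _ this] show ?thesis
    using \<alpha>_bounds moment_sequence_Suc_le[OF moment_a, of 0] by simp
qed

text \<open>The second difference pairs with the test polynomial \<eta>^m (1 - \<eta>)^2. Monotone
  decrements allow the weighted estimate above to be applied to a m - a (m + 1).\<close>

lemma a_diff_antimono: "a (Suc m) - a (Suc (Suc m)) \<le> a m - a (Suc m)"
proof -
  define h where "h k = (if k = m then 1 else if k = Suc m then -2 else if k = Suc (Suc m) then 1 else (0::real))" for k
  have s: "(\<Sum>k<Suc (Suc (Suc m)). h k * g k) = g m - 2 * g (Suc m) + g (Suc (Suc m))" for g :: "nat \<Rightarrow> real"
  proof -
    have "(\<Sum>k<m. h k * g k) = 0" by (intro sum.neutral) (auto simp: h_def)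
    then show ?thesis by (simp add: h_def)
  qed
  have "0 \<le> \<eta> ^ m - 2 * \<eta> ^ Suc m + \<eta> ^ Suc (Suc m)" if "\<eta> \<in> {0..1}" for \<eta> :: real
  proof -
    have "\<eta> ^ m - 2 * \<eta> ^ Suc m + \<eta> ^ Suc (Suc m) = \<eta> ^ m * (1 - \<eta>)\<^sup>2"
      by (simp add: power2_eq_square algebra_simps)
    then show ?thesis using that by simp
  qed
  then show ?thesis
    using moment_a[unfolded moment_sequence_def, rule_format, of h "Suc (Suc (Suc m))"] unfolding s by simp
qed

lemma by_parts_decay:
  assumes int: "\<And>m. ((\<lambda>\<theta>. \<alpha> * W \<theta> * (real m + 1 - \<theta>) powr (- \<alpha> - 1)) has_integral e m) {0..1}"
    and W: "\<And>\<theta>. \<theta> \<in> {0<..<1} \<Longrightarrow> 0 \<le> W \<theta> \<and> W \<theta> \<le> 1" and e0: "0 \<le> e 0"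
  shows "e m \<le> (4 + e 0) * (real m + 1) powr (- \<alpha> - 1)"
proof -
  have "e m \<le> real m powr - (\<alpha> + 1)" if m: "m \<ge> 1" for m
  proof (rule has_integral_le[OF int[of m, unfolded has_integral_Icc_iff_Ioo] has_integral_const_Ioo])
    fix \<theta> :: real assume \<theta>: "\<theta> \<in> {0<..<1}"
    have "\<alpha> * W \<theta> * (real m + 1 - \<theta>) powr (- \<alpha> - 1) \<le> 1 * real m powr (- \<alpha> - 1)"
      using \<theta> m \<alpha>_bounds W[OF \<theta>] by (intro mult_mono powr_mono2' mult_le_one) auto
    then show "\<alpha> * W \<theta> * (real m + 1 - \<theta>) powr (- \<alpha> - 1) \<le> real m powr - (\<alpha> + 1)" by simp
  qed
  from powr_decay_shift[of "\<alpha> + 1" e, OF _ _ _ this] show ?thesis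
    using \<alpha>_bounds e0 by simp
qed

lemma b_le: "b m \<le> (4 + b 0) * (real m + 1) powr (- \<alpha> - 1)"
proof (rule by_parts_decay[OF quad_kernel_by_parts[OF \<alpha>_bounds]])
  fix \<theta> :: real assume "\<theta> \<in> {0<..<1}"
  then show "0 \<le> \<theta> * (1 - \<theta>) / 2 \<and> \<theta> * (1 - \<theta>) / 2 \<le> 1"
    using mult_le_one[of \<theta> "1 - \<theta>"] by auto
qed (rule moment_sequence_nonneg[OF moment_b])

lemma c_le: "c m \<le> (4 + c 0) * (real m + 1) powr (- \<alpha> - 1)"
proof (rule by_parts_decay[OF cubic_kernel_by_parts[OF \<alpha>_bounds]])
  fix \<theta> :: real assume "\<theta> \<in> {0<..<1}"
  then show "0 \<le> \<theta> * (1 - \<theta>\<^sup>2) / 6 \<and> \<theta> * (1 - \<theta>\<^sup>2) / 6 \<le> 1"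
    using mult_le_one[of \<theta> "1 - \<theta>\<^sup>2"] power_le_one[of \<theta> 2] by auto
qed (rule moment_sequence_nonneg[OF moment_c])

end

section \<open>Sign of imaginary parts, tested on geometric sequences\<close>

lemma conv_radius_moment_sequence:
  "moment_sequence f \<Longrightarrow> fps_conv_radius (cfps f) \<ge> 1"
  using moment_sequence_decseq[of f 0] moment_sequence_nonneg[of f]
  by (intro fps_conv_radius_ge_1[of _ "f 0"]) auto

lemma norm_less_conv_radius:
  fixes F :: "complex fps"
  shows "norm z < 1 \<Longrightarrow> fps_conv_radius F \<ge> 1 \<Longrightarrow> ereal (norm z) < fps_conv_radius F"
  by (metis ereal_less(3) order_less_le_trans)

text \<open>Both sides are linear in f. For f m = \<eta>^m the series is 1 / (1 - \<eta> \<zeta>)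
  and f 0 - f 1 is 1 - \<eta>, so the hypothesis is the conclusion for geometric sequences.\<close>

lemma moment_sequence_Im_le:
  fixes w \<zeta> :: complex
  assumes f: "moment_sequence f" and \<zeta>: "norm \<zeta> < 1"
    and geometric: "\<And>\<eta>. \<eta> \<in> {0..1} \<Longrightarrow> Im (w / (1 - of_real \<eta> * \<zeta>)) \<le> \<mu> * (1 - \<eta>)"
  shows "Im (w * eval_fps (cfps f) \<zeta>) \<le> \<mu> * (f 0 - f 1)"
proof -
  \<comment> \<open>Coefficients of the functional right-hand side minus left-hand side; they decay
    like |\<zeta>|^m and are absolutely summable.\<close>
  define h where "h m = (if m = 0 then \<mu> else if m = 1 then - \<mu> else 0) - Im (w * \<zeta> ^ m)" for m :: nat
  have fin: "(\<lambda>m. (if m = 0 then \<mu> else if m = 1 then - \<mu> else 0) * g m) sums (\<mu> * (g 0 - g 1))" for g :: "nat \<Rightarrow> real"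
  proof -
    have "(\<lambda>m. (if m = 0 then \<mu> else if m = 1 then - \<mu> else 0) * g m) sums
        (\<Sum>m\<in>{0, 1}. (if m = 0 then \<mu> else if m = 1 then - \<mu> else 0) * g m)"
      by (rule sums_finite) auto
    then show ?thesis by (simp add: algebra_simps)
  qed
  have geom: "(\<lambda>m. h m * \<eta> ^ m) sums (\<mu> * (1 - \<eta>) - Im (w / (1 - of_real \<eta> * \<zeta>)))" if \<eta>: "\<eta> \<in> {0..1}" for \<eta>
  proof -
    have "norm (of_real \<eta> * \<zeta>) < 1"
      using \<eta> \<zeta> mult_left_le_one_le[of "norm \<zeta>" \<eta>] by (auto simp: norm_mult)
    from sums_Im[OF sums_mult[OF geometric_sums[OF this], of w]]
    have "(\<lambda>m. Im (w * \<zeta> ^ m) * \<eta> ^ m) sums Im (w / (1 - of_real \<eta> * \<zeta>))"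
      by (simp add: power_mult_distrib algebra_simps flip: of_real_power)
    from sums_diff[OF fin[of "\<lambda>m. \<eta> ^ m"] this] show ?thesis
      by (simp add: h_def left_diff_distrib)
  qed
  have "(\<lambda>m. w * (of_real (f m) * \<zeta> ^ m)) sums (w * eval_fps (cfps f) \<zeta>)"
    using sums_mult[OF sums_eval_fps[OF norm_less_conv_radius[OF \<zeta> conv_radius_moment_sequence[OF f]]], of w] by simp
  from sums_diff[OF fin[of f] sums_Im[OF this]]
  have "(\<lambda>m. h m * f m) sums (\<mu> * (f 0 - f 1) - Im (w * eval_fps (cfps f) \<zeta>))"
    by (simp add: h_def left_diff_distrib algebra_simps)
  moreover have "0 \<le> (\<Sum>m. h m * f m)"
  proof (rule moment_sequence_suminf_nonneg[OF f])
    show "summable (\<lambda>m. \<bar>h m\<bar>)"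
    proof (rule summable_comparison_test')
      show "summable (\<lambda>m. norm w * norm \<zeta> ^ m)" using \<zeta> by (intro summable_mult summable_geometric) simp
      show "norm \<bar>h m\<bar> \<le> norm w * norm \<zeta> ^ m" if "m \<ge> 2" for m
        using abs_Im_le_cmod[of "w * \<zeta> ^ m"] that by (simp add: h_def norm_mult norm_power)
    qed
    show "0 \<le> (\<Sum>m. h m * \<eta> ^ m)" if "\<eta> \<in> {0..1}" for \<eta>
      using sums_unique[OF geom[OF that]] geometric[OF that] by simp
  qed
  ultimately show ?thesis using sums_unique by fastforce
qed

lemma Im_divide_one_minus:
  fixes w \<zeta> :: complex and \<eta> :: real
  shows "Im (w / (1 - of_real \<eta> * \<zeta>)) = Im (w * (1 - of_real \<eta> * cnj \<zeta>)) / (norm (1 - of_real \<eta> * \<zeta>))\<^sup>2"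
  by (subst complex_div_cnj) (simp flip: of_real_power)

text \<open>Multiplying by the conjugate denominator leaves polynomials in Re \<zeta>, Im \<zeta>
  and \<eta>. The 4 in the first estimate is the largest possible squared denominator. The
  multiplier -\<i> in the last one encodes a real part: Im (-\<i> B) = - Re B. The right-hand sides
  have the form \<mu> * (1 - \<eta>) demanded by \<open>moment_sequence_Im_le\<close>.\<close>

lemma geometric_Im_le:
  fixes \<zeta> :: complex
  assumes \<zeta>: "norm \<zeta> < 1" "Im \<zeta> \<ge> 0" and \<eta>: "\<eta> \<in> {0..1}"
  shows "Im ((1 - \<zeta>) / (1 - of_real \<eta> * \<zeta>)) \<le> - (Im \<zeta> / 4) * (1 - \<eta>)"
    and "Im ((1 - \<zeta>)\<^sup>2 / (1 - of_real \<eta> * \<zeta>)) \<le> 0 * (1 - \<eta>)"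
    and "Im ((1 - \<zeta>)\<^sup>2 * (2 - \<zeta>) / (1 - of_real \<eta> * \<zeta>)) \<le> 0 * (1 - \<eta>)"
    and "Im (- \<i> / (1 - of_real \<eta> * \<zeta>)) \<le> 0 * (1 - \<eta>)"
proof -
  define x y where "x = Re \<zeta>" and "y = Im \<zeta>"
  have \<zeta>_eq: "\<zeta> = Complex x y" by (simp add: x_def y_def)
  have r: "x\<^sup>2 + y\<^sup>2 \<le> 1"
    using \<zeta>(1) cmod_power2[of \<zeta>] power_le_one[of "norm \<zeta>" 2] by (simp add: x_def y_def)
  have y: "0 \<le> y" using \<zeta>(2) by (simp add: y_def)
  have "x \<le> norm \<zeta>" unfolding x_def by (rule complex_Re_le_cmod)
  then have x: "x < 1" using \<zeta>(1) by simp
  have lt1: "norm (of_real \<eta> * \<zeta>) < 1"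
    using \<eta> \<zeta> mult_left_le_one_le[of "norm \<zeta>" \<eta>] by (auto simp: norm_mult)
  define N where "N = (norm (1 - of_real \<eta> * \<zeta>))\<^sup>2"
  have "1 - of_real \<eta> * \<zeta> \<noteq> 0" using lt1 by auto
  then have N: "N > 0" by (simp add: N_def)
  have "norm (1 - of_real \<eta> * \<zeta>) \<le> 2" using norm_triangle_ineq4[of 1 "of_real \<eta> * \<zeta>"] lt1 by simp
  then have N4: "N \<le> 4" using power_mono[of "norm (1 - of_real \<eta> * \<zeta>)" 2 2] by (simp add: N_def)
  note div = Im_divide_one_minus[of _ \<eta> \<zeta>, folded N_def]
  show "Im ((1 - \<zeta>) / (1 - of_real \<eta> * \<zeta>)) \<le> - (Im \<zeta> / 4) * (1 - \<eta>)"
  proof -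
    have "Im ((1 - \<zeta>) * (1 - of_real \<eta> * cnj \<zeta>)) = - (y * (1 - \<eta>))"
      by (simp add: \<zeta>_eq algebra_simps)
    moreover have "y * (1 - \<eta>) / 4 \<le> y * (1 - \<eta>) / N"
      using y \<eta> N N4 by (intro divide_left_mono) auto
    ultimately show ?thesis unfolding div by (simp add: y_def)
  qed
  show "Im ((1 - \<zeta>)\<^sup>2 / (1 - of_real \<eta> * \<zeta>)) \<le> 0 * (1 - \<eta>)"
  proof -
    have "Im ((1 - \<zeta>)\<^sup>2 * (1 - of_real \<eta> * cnj \<zeta>)) = - (y * (2 - 2 * x - \<eta> * (1 - (x\<^sup>2 + y\<^sup>2))))"
      by (simp add: \<zeta>_eq power2_eq_square algebra_simps)
    moreover have "\<eta> * (1 - (x\<^sup>2 + y\<^sup>2)) \<le> 1 - (x\<^sup>2 + y\<^sup>2)"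
      using \<eta> r by (intro mult_left_le_one_le) auto
    moreover have "1 - (x\<^sup>2 + y\<^sup>2) \<le> 2 - 2 * x"
      using zero_le_power2[of "1 - x"] zero_le_power2[of y] unfolding power2_diff one_power2 by linarith
    ultimately show ?thesis unfolding div using y N by simp
  qed
  show "Im ((1 - \<zeta>)\<^sup>2 * (2 - \<zeta>) / (1 - of_real \<eta> * \<zeta>)) \<le> 0 * (1 - \<eta>)"
  proof -
    \<comment> \<open>The numerator is affine in \<eta>; up to the factor -y, \<open>P\<close> and
      \<open>Q\<close> are its values at \<eta> = 0 and \<eta> = 1.\<close>
    define P Q where "P = (1 - (x\<^sup>2 + y\<^sup>2)) + 4 * (1 - x)\<^sup>2" and "Q = (3 - 2 * x) * ((1 - x)\<^sup>2 + y\<^sup>2)"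
    have "Im ((1 - \<zeta>)\<^sup>2 * (2 - \<zeta>) * (1 - of_real \<eta> * cnj \<zeta>)) = - (y * ((1 - \<eta>) * P + \<eta> * Q))"
      by (simp add: \<zeta>_eq P_def Q_def power2_eq_square algebra_simps)
    moreover have "0 \<le> P" "0 \<le> Q" using r x by (auto simp: P_def Q_def)
    ultimately show ?thesis unfolding div using y N \<eta> by simp
  qed
  show "Im (- \<i> / (1 - of_real \<eta> * \<zeta>)) \<le> 0 * (1 - \<eta>)"
  proof -
    have "Im (- \<i> * (1 - of_real \<eta> * cnj \<zeta>)) = - (1 - \<eta> * x)" by (simp add: \<zeta>_eq)
    moreover have "\<eta> * x \<le> 1"
      using complex_Re_le_cmod[of "of_real \<eta> * \<zeta>"] lt1 by (simp add: x_def)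
    ultimately show ?thesis unfolding div using N by (auto simp: x_def divide_le_0_iff)
  qed
qed

lemma eval_fps_cfps_cnj: "eval_fps (cfps f) (cnj \<zeta>) = cnj (eval_fps (cfps f) \<zeta>)"
  if "norm \<zeta> < fps_conv_radius (cfps f)"
proof -
  have "(\<lambda>n. fps_nth (cfps f) n * cnj \<zeta> ^ n) sums cnj (eval_fps (cfps f) \<zeta>)"
    using sums_cnj[THEN iffD2, OF sums_eval_fps[OF that]] by simp
  then show ?thesis unfolding eval_fps_def by (rule sums_unique[symmetric])
qed

subsection \<open>Estimates of the symbol\<close>

lemma norm_diff_mono:
  fixes x y :: "'a :: real_normed_vector"
  shows "norm x \<le> p \<Longrightarrow> norm y \<le> q \<Longrightarrow> norm (x - y) \<le> p + q"
  using norm_triangle_ineq4[of x y] by linarith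

lemma norm_mult_mono:
  fixes x y :: complex
  shows "norm x \<le> p \<Longrightarrow> norm y \<le> q \<Longrightarrow> norm (x * y) \<le> p * q"
  unfolding norm_mult by (rule mult_mono) (auto intro: order_trans[OF norm_ge_zero])

lemma norm_power_mono:
  fixes x :: complex
  shows "norm x \<le> p \<Longrightarrow> norm (x ^ n) \<le> p ^ n"
  unfolding norm_power by (rule power_mono) auto

lemma conv_radius_closure:
  fixes F G :: "complex fps"
  shows "1 \<le> fps_conv_radius (fps_X :: complex fps)" "1 \<le> fps_conv_radius (1 :: complex fps)"
    and "1 \<le> fps_conv_radius (fps_const z :: complex fps)" "1 \<le> fps_conv_radius (numeral k :: complex fps)"
    and "1 \<le> fps_conv_radius F \<Longrightarrow> 1 \<le> fps_conv_radius (fps_deriv F)"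
    and "1 \<le> fps_conv_radius F \<Longrightarrow> 1 \<le> fps_conv_radius G \<Longrightarrow> 1 \<le> fps_conv_radius (F + G)"
    and "1 \<le> fps_conv_radius F \<Longrightarrow> 1 \<le> fps_conv_radius G \<Longrightarrow> 1 \<le> fps_conv_radius (F - G)"
    and "1 \<le> fps_conv_radius F \<Longrightarrow> 1 \<le> fps_conv_radius G \<Longrightarrow> 1 \<le> fps_conv_radius (F * G)"
    and "1 \<le> fps_conv_radius F \<Longrightarrow> 1 \<le> fps_conv_radius (F ^ n)"
  using fps_conv_radius_add[of F G] fps_conv_radius_diff[of F G] fps_conv_radius_mult[of F G]
    fps_conv_radius_power[of F n] fps_conv_radius_deriv[of F]
  by (auto intro: order_trans order_trans[OF min.boundedI])

lemmas eval_fps_simps = eval_fps_add eval_fps_diff eval_fps_mult eval_fps_power norm_less_conv_radius conv_radius_closure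

lemma norm_one_minus_bounds:
  fixes \<zeta> :: complex
  assumes "norm \<zeta> < 1"
  shows "0 < norm (1 - \<zeta>)" "norm (1 - \<zeta>) \<le> 2"
  using assms norm_triangle_ineq4[of 1 \<zeta>] by auto

context caputo_order
begin

lemma conv_radius_kernels [simp]:
  "1 \<le> fps_conv_radius (cfps a)" "1 \<le> fps_conv_radius (cfps b)" "1 \<le> fps_conv_radius (cfps c)"
  by (auto intro: conv_radius_moment_sequence moment_a moment_b moment_c)

text \<open>Away from the initial levels a backward difference of order k is multiplication by (1 -
  X)^k, so the scheme has the symbol (1 - X) a + (1 - X)^2 b + (1 - X)^3 c. One factor 1 - X is
  split off because the remaining series is what multiplies the initial value in the right-hand
  side.\<close>

definition diff_kernel :: "complex fps" where
  "diff_kernel = cfps a + (1 - fps_X) * cfps b + (1 - fps_X)\<^sup>2 * cfps c"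

definition symbol :: "complex fps" where
  "symbol = (1 - fps_X) * diff_kernel"

lemma conv_radius_symbol [simp]:
  "1 \<le> fps_conv_radius diff_kernel" "1 \<le> fps_conv_radius symbol"
  unfolding symbol_def diff_kernel_def by (intro conv_radius_closure conv_radius_kernels)+

lemma eval_symbol:
  assumes \<zeta>: "norm \<zeta> < 1"
  shows "eval_fps diff_kernel \<zeta> = eval_fps (cfps a) \<zeta> + (1 - \<zeta>) * eval_fps (cfps b) \<zeta> + (1 - \<zeta>)\<^sup>2 * eval_fps (cfps c) \<zeta>"
    and "eval_fps symbol \<zeta> = (1 - \<zeta>) * eval_fps diff_kernel \<zeta>"
    and "eval_fps (fps_deriv diff_kernel) \<zeta> = eval_fps (fps_deriv (cfps a)) \<zeta>
          + ((1 - \<zeta>) * eval_fps (fps_deriv (cfps b)) \<zeta> - eval_fps (cfps b) \<zeta>)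
          + ((1 - \<zeta>)\<^sup>2 * eval_fps (fps_deriv (cfps c)) \<zeta> - 2 * (1 - \<zeta>) * eval_fps (cfps c) \<zeta>)"
    and "eval_fps (fps_deriv symbol) \<zeta> = (1 - \<zeta>) * eval_fps (fps_deriv diff_kernel) \<zeta> - eval_fps diff_kernel \<zeta>"
proof -
  have d1: "fps_deriv diff_kernel = fps_deriv (cfps a) + ((1 - fps_X) * fps_deriv (cfps b) - cfps b)
      + ((1 - fps_X)\<^sup>2 * fps_deriv (cfps c) - 2 * (1 - fps_X) * cfps c)"
    unfolding diff_kernel_def by (simp add: power2_eq_square algebra_simps)
  have d2: "fps_deriv symbol = (1 - fps_X) * fps_deriv diff_kernel - diff_kernel"
    unfolding symbol_def by (simp add: algebra_simps)
  show "eval_fps symbol \<zeta> = (1 - \<zeta>) * eval_fps diff_kernel \<zeta>"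
    unfolding symbol_def using \<zeta> by (simp add: eval_fps_simps)
  show "eval_fps diff_kernel \<zeta> = eval_fps (cfps a) \<zeta> + (1 - \<zeta>) * eval_fps (cfps b) \<zeta> + (1 - \<zeta>)\<^sup>2 * eval_fps (cfps c) \<zeta>"
    unfolding diff_kernel_def using \<zeta> by (simp add: eval_fps_simps)
  show "eval_fps (fps_deriv diff_kernel) \<zeta> = eval_fps (fps_deriv (cfps a)) \<zeta>
          + ((1 - \<zeta>) * eval_fps (fps_deriv (cfps b)) \<zeta> - eval_fps (cfps b) \<zeta>)
          + ((1 - \<zeta>)\<^sup>2 * eval_fps (fps_deriv (cfps c)) \<zeta> - 2 * (1 - \<zeta>) * eval_fps (cfps c) \<zeta>)"
    unfolding d1 using \<zeta> by (simp add: eval_fps_simps)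
  show "eval_fps (fps_deriv symbol) \<zeta> = (1 - \<zeta>) * eval_fps (fps_deriv diff_kernel) \<zeta> - eval_fps diff_kernel \<zeta>"
    unfolding d2 using \<zeta> by (simp add: eval_fps_simps)
qed

text \<open>The derivative of a is more singular than a itself, so only a combination with the
  factor 1 - \<zeta> is estimated. The kernels b and c decay one order faster, and their derivatives
  already satisfy the same bound as the kernels.\<close>

lemma kernel_estimates:
  obtains C where "C > 0"
    and "\<And>\<zeta>. norm \<zeta> < 1 \<Longrightarrow> norm (eval_fps (cfps a) \<zeta>) \<le> C * norm (1 - \<zeta>) powr (\<alpha> - 1)"
    and "\<And>\<zeta>. norm \<zeta> < 1 \<Longrightarrow> norm (eval_fps (cfps b) \<zeta>) \<le> C * norm (1 - \<zeta>) powr (\<alpha> - 1)"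
    and "\<And>\<zeta>. norm \<zeta> < 1 \<Longrightarrow> norm (eval_fps (cfps c) \<zeta>) \<le> C * norm (1 - \<zeta>) powr (\<alpha> - 1)"
    and "\<And>\<zeta>. norm \<zeta> < 1 \<Longrightarrow> norm ((1 - \<zeta>) * eval_fps (fps_deriv (cfps a)) \<zeta> - eval_fps (cfps a) \<zeta>) \<le> C * norm (1 - \<zeta>) powr (\<alpha> - 1)"
    and "\<And>\<zeta>. norm \<zeta> < 1 \<Longrightarrow> norm (eval_fps (fps_deriv (cfps b)) \<zeta>) \<le> C * norm (1 - \<zeta>) powr (\<alpha> - 1)"
    and "\<And>\<zeta>. norm \<zeta> < 1 \<Longrightarrow> norm (eval_fps (fps_deriv (cfps c)) \<zeta>) \<le> C * norm (1 - \<zeta>) powr (\<alpha> - 1)"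
proof
  define S V where "S = 3 / (1 - \<alpha>) + 3" and "V = (1 + 2 / \<alpha>) * S"
  have S: "0 < S" and SV: "S \<le> V" using \<alpha>_bounds by (auto simp: S_def V_def add_pos_pos)
  have V: "0 < V" using S SV by simp
  note nn = moment_sequence_nonneg[OF moment_a, of 0] moment_sequence_nonneg[OF moment_a, of 1]
    moment_sequence_nonneg[OF moment_b, of 0] moment_sequence_nonneg[OF moment_c, of 0]
    moment_sequence_Suc_le[OF moment_a, of 0]
  define C where "C = (4 + a 0 + b 0 + c 0) * V"
  show "C > 0" using nn V by (simp add: C_def)
  have CS: "k * S \<le> C" and CV: "k * V \<le> C" if "0 \<le> k" "k \<le> 4 + a 0 + b 0 + c 0" for k
  proof -
    show "k * V \<le> C" unfolding C_def using that V by (intro mult_right_mono) auto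
    moreover have "k * S \<le> k * V" using that SV by (intro mult_left_mono) auto
    ultimately show "k * S \<le> C" by simp
  qed
  have le: "x \<le> C * D powr (\<alpha> - 1)" if "x \<le> y * D powr (\<alpha> - 1)" "y \<le> C" for x y and D :: real
    using that mult_right_mono[of y C "D powr (\<alpha> - 1)"] by simp
  have weaken: "k * (real m + 1) powr (- \<alpha> - 1) \<le> k * (real m + 1) powr - \<alpha>" if "0 \<le> k" for k m
    using that by (intro mult_left_mono powr_mono) auto
  fix \<zeta> :: complex assume \<zeta>: "norm \<zeta> < 1"
  show "norm (eval_fps (cfps a) \<zeta>) \<le> C * norm (1 - \<zeta>) powr (\<alpha> - 1)"
    by (rule le[OF eval_fps_antimono_bound[OF \<alpha>_bounds \<zeta> moment_sequence_Suc_le[OF moment_a]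
            moment_sequence_nonneg[OF moment_a] a_le, folded S_def] CS]) (use nn in auto)
  show "norm (eval_fps (cfps b) \<zeta>) \<le> C * norm (1 - \<zeta>) powr (\<alpha> - 1)"
    by (rule le[OF eval_fps_antimono_bound[OF \<alpha>_bounds \<zeta> moment_sequence_Suc_le[OF moment_b]
            moment_sequence_nonneg[OF moment_b] order_trans[OF b_le weaken], folded S_def] CS]) (use nn in auto)
  show "norm (eval_fps (cfps c) \<zeta>) \<le> C * norm (1 - \<zeta>) powr (\<alpha> - 1)"
    by (rule le[OF eval_fps_antimono_bound[OF \<alpha>_bounds \<zeta> moment_sequence_Suc_le[OF moment_c]
            moment_sequence_nonneg[OF moment_c] order_trans[OF c_le weaken], folded S_def] CS]) (use nn in auto)
  have W: "norm (eval_fps (cfps (\<lambda>m. (real m + 1) * e m)) \<zeta>) \<le> C * norm (1 - \<zeta>) powr (\<alpha> - 1)"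
    if "\<And>m. e (Suc m) \<le> e m" "\<And>m. 0 \<le> e m" "\<And>m. e m \<le> k * (real m + 1) powr (- \<alpha> - 1)"
      "0 \<le> k" "k \<le> 4 + a 0 + b 0 + c 0" for e k
    using eval_fps_weighted_antimono_bound[OF \<alpha>_bounds \<zeta> that(1-3)] CV[OF that(4,5)]
    by (intro le[of _ "k * V"]) (auto simp: V_def S_def mult.assoc)
  \<comment> \<open>Subtracting a produces exactly the decrements of a with weight m + 1, to which
    \<open>eval_fps_weighted_antimono_bound\<close> applies.\<close>
  have "cfps a - (1 - fps_X) * fps_deriv (cfps a) = cfps (\<lambda>m. (real m + 1) * (a m - a (Suc m)))"
    by (rule fps_ext) (simp add: left_diff_distrib fps_X_mult_nth algebra_simps split: nat.splits if_splits)
  then have "eval_fps (cfps a - (1 - fps_X) * fps_deriv (cfps a)) \<zeta> = eval_fps (cfps (\<lambda>m. (real m + 1) * (a m - a (Suc m)))) \<zeta>"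
    by simp
  then have "norm ((1 - \<zeta>) * eval_fps (fps_deriv (cfps a)) \<zeta> - eval_fps (cfps a) \<zeta>)
      = norm (eval_fps (cfps (\<lambda>m. (real m + 1) * (a m - a (Suc m)))) \<zeta>)"
    using \<zeta> by (simp add: eval_fps_simps norm_minus_commute)
  also have "\<dots> \<le> C * norm (1 - \<zeta>) powr (\<alpha> - 1)"
    by (rule W[OF a_diff_antimono _ a_diff_le])
       (use nn moment_sequence_Suc_le[OF moment_a] in auto)
  finally show "norm ((1 - \<zeta>) * eval_fps (fps_deriv (cfps a)) \<zeta> - eval_fps (cfps a) \<zeta>) \<le> C * norm (1 - \<zeta>) powr (\<alpha> - 1)" .
  have deriv: "fps_deriv (cfps e) = cfps (\<lambda>m. (real m + 1) * e (Suc m))" for e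
    by (rule fps_ext) (simp add: add.commute)
  have shift: "e (Suc m) \<le> k * (real m + 1) powr (- \<alpha> - 1)"
    if "moment_sequence e" "\<And>m. e m \<le> k * (real m + 1) powr (- \<alpha> - 1)" for e k m
    using moment_sequence_Suc_le[OF that(1), of m] that(2)[of m] by simp
  show "norm (eval_fps (fps_deriv (cfps b)) \<zeta>) \<le> C * norm (1 - \<zeta>) powr (\<alpha> - 1)"
    unfolding deriv
    by (rule W[OF moment_sequence_Suc_le[OF moment_b] moment_sequence_nonneg[OF moment_b] shift[OF moment_b b_le]])
       (use nn in auto)
  show "norm (eval_fps (fps_deriv (cfps c)) \<zeta>) \<le> C * norm (1 - \<zeta>) powr (\<alpha> - 1)"
    unfolding deriv
    by (rule W[OF moment_sequence_Suc_le[OF moment_c] moment_sequence_nonneg[OF moment_c] shift[OF moment_c c_le]])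
       (use nn in auto)
qed

lemma symbol_estimates:
  obtains C where "C > 0"
    and "\<And>\<zeta>. norm \<zeta> < 1 \<Longrightarrow> norm (eval_fps (cfps b) \<zeta>) \<le> C * norm (1 - \<zeta>) powr (\<alpha> - 1)"
    and "\<And>\<zeta>. norm \<zeta> < 1 \<Longrightarrow> norm (eval_fps (cfps c) \<zeta>) \<le> C * norm (1 - \<zeta>) powr (\<alpha> - 1)"
    and "\<And>\<zeta>. norm \<zeta> < 1 \<Longrightarrow> norm (eval_fps (fps_deriv (cfps b)) \<zeta>) \<le> C * norm (1 - \<zeta>) powr (\<alpha> - 1)"
    and "\<And>\<zeta>. norm \<zeta> < 1 \<Longrightarrow> norm (eval_fps (fps_deriv (cfps c)) \<zeta>) \<le> C * norm (1 - \<zeta>) powr (\<alpha> - 1)"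
    and "\<And>\<zeta>. norm \<zeta> < 1 \<Longrightarrow> norm (eval_fps diff_kernel \<zeta>) \<le> C * norm (1 - \<zeta>) powr (\<alpha> - 1)"
    and "\<And>\<zeta>. norm \<zeta> < 1 \<Longrightarrow> norm ((1 - \<zeta>) * eval_fps (fps_deriv diff_kernel) \<zeta>) \<le> C * norm (1 - \<zeta>) powr (\<alpha> - 1)"
    and "\<And>\<zeta>. norm \<zeta> < 1 \<Longrightarrow> norm (eval_fps symbol \<zeta>) \<le> C * norm (1 - \<zeta>) powr \<alpha>"
    and "\<And>\<zeta>. norm \<zeta> < 1 \<Longrightarrow> norm (eval_fps (fps_deriv symbol) \<zeta>) \<le> C * norm (1 - \<zeta>) powr (\<alpha> - 1)"
proof -
  obtain C where C: "C > 0"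
    and A: "\<And>\<zeta>. norm \<zeta> < 1 \<Longrightarrow> norm (eval_fps (cfps a) \<zeta>) \<le> C * norm (1 - \<zeta>) powr (\<alpha> - 1)"
    and B: "\<And>\<zeta>. norm \<zeta> < 1 \<Longrightarrow> norm (eval_fps (cfps b) \<zeta>) \<le> C * norm (1 - \<zeta>) powr (\<alpha> - 1)"
    and Cc: "\<And>\<zeta>. norm \<zeta> < 1 \<Longrightarrow> norm (eval_fps (cfps c) \<zeta>) \<le> C * norm (1 - \<zeta>) powr (\<alpha> - 1)"
    and A': "\<And>\<zeta>. norm \<zeta> < 1 \<Longrightarrow> norm ((1 - \<zeta>) * eval_fps (fps_deriv (cfps a)) \<zeta> - eval_fps (cfps a) \<zeta>) \<le> C * norm (1 - \<zeta>) powr (\<alpha> - 1)"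
    and B': "\<And>\<zeta>. norm \<zeta> < 1 \<Longrightarrow> norm (eval_fps (fps_deriv (cfps b)) \<zeta>) \<le> C * norm (1 - \<zeta>) powr (\<alpha> - 1)"
    and C': "\<And>\<zeta>. norm \<zeta> < 1 \<Longrightarrow> norm (eval_fps (fps_deriv (cfps c)) \<zeta>) \<le> C * norm (1 - \<zeta>) powr (\<alpha> - 1)"
    by (rule kernel_estimates) (rule that, blast+)
  have pos: "0 \<le> C * norm (1 - \<zeta>) powr (\<alpha> - 1)" for \<zeta> :: complex using C by simp
  have K: "norm (eval_fps diff_kernel \<zeta>) \<le> 7 * (C * norm (1 - \<zeta>) powr (\<alpha> - 1))" if \<zeta>: "norm \<zeta> < 1" for \<zeta>
  proof -
    note D = norm_one_minus_bounds(2)[OF \<zeta>]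
    define P where "P = C * norm (1 - \<zeta>) powr (\<alpha> - 1)"
    have "norm (eval_fps diff_kernel \<zeta>) \<le> P + 2 * P + 2\<^sup>2 * P"
      unfolding eval_symbol[OF \<zeta>] P_def
      by (intro norm_triangle_mono norm_mult_mono norm_power_mono D A B Cc \<zeta>)
    then show ?thesis by (simp add: P_def)
  qed
  have K': "norm ((1 - \<zeta>) * eval_fps (fps_deriv diff_kernel) \<zeta>) \<le> 24 * (C * norm (1 - \<zeta>) powr (\<alpha> - 1))" if \<zeta>: "norm \<zeta> < 1" for \<zeta>
  proof -
    note D = norm_one_minus_bounds(2)[OF \<zeta>]
    define P where "P = C * norm (1 - \<zeta>) powr (\<alpha> - 1)"
    define A1 B1 C1 where "A1 = eval_fps (fps_deriv (cfps a)) \<zeta>" and "B1 = eval_fps (fps_deriv (cfps b)) \<zeta>"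
      and "C1 = eval_fps (fps_deriv (cfps c)) \<zeta>"
    define A0 B0 C0 where "A0 = eval_fps (cfps a) \<zeta>" and "B0 = eval_fps (cfps b) \<zeta>" and "C0 = eval_fps (cfps c) \<zeta>"
    \<comment> \<open>The term \<open>A0\<close> is subtracted and added, as \<open>A1\<close> is
      controlled only through (1 - \<zeta>) * A1 - A0.\<close>
    have eq: "(1 - \<zeta>) * eval_fps (fps_deriv diff_kernel) \<zeta> = ((1 - \<zeta>) * A1 - A0) + A0
        + (1 - \<zeta>) * ((1 - \<zeta>) * B1 - B0) + (1 - \<zeta>) * ((1 - \<zeta>)\<^sup>2 * C1 - 2 * (1 - \<zeta>) * C0)"
      unfolding eval_symbol[OF \<zeta>] by (simp add: A1_def B1_def C1_def A0_def B0_def C0_def algebra_simps)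
    have two: "norm (2 :: complex) \<le> 2" by simp
    have tb: "norm ((1 - \<zeta>) * B1 - B0) \<le> 2 * P + P"
      unfolding P_def B1_def B0_def by (rule norm_diff_mono[OF norm_mult_mono[OF D B'[OF \<zeta>]] B[OF \<zeta>]])
    have tc: "norm ((1 - \<zeta>)\<^sup>2 * C1 - 2 * (1 - \<zeta>) * C0) \<le> 2\<^sup>2 * P + 2 * 2 * P"
      unfolding P_def C1_def C0_def
      by (rule norm_diff_mono[OF norm_mult_mono[OF norm_power_mono[OF D] C'[OF \<zeta>]]
            norm_mult_mono[OF norm_mult_mono[OF two D] Cc[OF \<zeta>]]])
    have "norm ((1 - \<zeta>) * eval_fps (fps_deriv diff_kernel) \<zeta>) \<le> P + P + 2 * (2 * P + P) + 2 * (2\<^sup>2 * P + 2 * 2 * P)"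
      unfolding eq by (intro norm_triangle_mono norm_mult_mono tb tc D)
        (use A[OF \<zeta>] A'[OF \<zeta>] in \<open>auto simp: P_def A0_def A1_def\<close>)
    then show ?thesis using pos[of \<zeta>] by (simp add: P_def)
  qed
  show ?thesis
  \<comment> \<open>31 = 24 + 7: the derivative of the symbol is the difference of the two
    quantities just bounded. The factors 7 and 24 come from norm (1 - \<zeta>) <= 2.\<close>
  proof (rule that[of "31 * C"])
    fix \<zeta> :: complex assume \<zeta>: "norm \<zeta> < 1"
    show "norm (eval_fps (cfps b) \<zeta>) \<le> 31 * C * norm (1 - \<zeta>) powr (\<alpha> - 1)"
      "norm (eval_fps (cfps c) \<zeta>) \<le> 31 * C * norm (1 - \<zeta>) powr (\<alpha> - 1)"
      "norm (eval_fps (fps_deriv (cfps b)) \<zeta>) \<le> 31 * C * norm (1 - \<zeta>) powr (\<alpha> - 1)"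
      "norm (eval_fps (fps_deriv (cfps c)) \<zeta>) \<le> 31 * C * norm (1 - \<zeta>) powr (\<alpha> - 1)"
      "norm (eval_fps diff_kernel \<zeta>) \<le> 31 * C * norm (1 - \<zeta>) powr (\<alpha> - 1)"
      "norm ((1 - \<zeta>) * eval_fps (fps_deriv diff_kernel) \<zeta>) \<le> 31 * C * norm (1 - \<zeta>) powr (\<alpha> - 1)"
      using B[OF \<zeta>] Cc[OF \<zeta>] B'[OF \<zeta>] C'[OF \<zeta>] K[OF \<zeta>] K'[OF \<zeta>] pos[of \<zeta>] by linarith+
    show "norm (eval_fps (fps_deriv symbol) \<zeta>) \<le> 31 * C * norm (1 - \<zeta>) powr (\<alpha> - 1)"
      using norm_diff_mono[OF K'[OF \<zeta>] K[OF \<zeta>]] unfolding eval_symbol(4)[OF \<zeta>] by simp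
    have "norm (eval_fps symbol \<zeta>) \<le> norm (1 - \<zeta>) * (7 * (C * norm (1 - \<zeta>) powr (\<alpha> - 1)))"
      unfolding eval_symbol(2)[OF \<zeta>] norm_mult by (intro mult_left_mono K \<zeta>) auto
    also have "\<dots> = 7 * C * norm (1 - \<zeta>) powr \<alpha>"
      using norm_one_minus_bounds(1)[OF \<zeta>] by (simp add: powr_diff)
    also have "\<dots> \<le> 31 * C * norm (1 - \<zeta>) powr \<alpha>" using C by (intro mult_right_mono) auto
    finally show "norm (eval_fps symbol \<zeta>) \<le> 31 * C * norm (1 - \<zeta>) powr \<alpha>" .
  qed (use C in simp)
qed

text \<open>With d m = a m - a (m + 1) the real part is at least the sum of the nonnegative terms d
  m * (1 - Re \<zeta>^(m + 1)). Only a window M <= m < 2 M with M of order 1 / D is kept: there the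
  powers of \<zeta> average out, while d m is at least of order D^(\<alpha> + 1), so M terms yield
  D^\<alpha>.\<close>

lemma Re_lin_symbol_ge:
  assumes \<zeta>: "norm \<zeta> < 1"
  shows "2 * \<alpha> * 16 powr (- \<alpha> - 1) * norm (1 - \<zeta>) powr \<alpha> \<le> Re ((1 - \<zeta>) * eval_fps (cfps a) \<zeta>)"
proof -
  define d where "d m = a m - a (Suc m)" for m
  define D where "D = norm (1 - \<zeta>)"
  have D: "D > 0" "D \<le> 2" using norm_one_minus_bounds[OF \<zeta>] by (auto simp: D_def)
  have d_nn: "0 \<le> d m" for m using moment_sequence_Suc_le[OF moment_a] by (simp add: d_def)
  have d_dec: "d n \<le> d m" if "m \<le> n" for m n
    using lift_Suc_antimono_le[of d m n] a_diff_antimono that by (simp add: d_def)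
  have pw: "norm (\<zeta> ^ m) \<le> 1" for m using \<zeta> by (simp add: norm_power power_le_one)
  \<comment> \<open>The geometric sum over the window is at most 2 / D in modulus, so length 4 / D
    leaves at least half of the window. With D <= 2 also M <= 6 / D and 2 M + 2 <= 16 / D, the
    origin of the 16.\<close>
  define M where "M = nat \<lceil>4 / D\<rceil>"
  have M1: "4 / D \<le> real M" unfolding M_def by (rule real_nat_ceiling_ge)
  have "real M \<le> 4 / D + 1" using D by (simp add: M_def)
  also have "\<dots> \<le> 6 / D" using D by (simp add: field_simps)
  finally have M2: "real M \<le> 6 / D" .
  define low where "low = 2 * \<alpha> * 16 powr (- \<alpha> - 1) * D powr \<alpha>"
  have low: "low \<le> d (2 * M) * (real M - 2 / D)"
  proof -
    have "low = \<alpha> * (16 / D) powr (- \<alpha> - 1) * (2 / D)"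
      using D by (simp add: low_def powr_divide powr_diff powr_minus field_simps)
    also have "\<dots> \<le> d (2 * M) * (real M - 2 / D)"
    proof (rule mult_mono)
      have "\<alpha> * (16 / D) powr (- \<alpha> - 1) \<le> \<alpha> * (real (2 * M) + 2) powr (- \<alpha> - 1)"
      proof (intro mult_left_mono powr_mono2')
        have "2 \<le> 2 * (2 / D)" using D by (simp add: field_simps)
        then show "real (2 * M) + 2 \<le> 16 / D" using M2 by (simp add: field_simps)
      qed (use \<alpha>_bounds in auto)
      also have "\<dots> \<le> d (2 * M)" unfolding d_def by (rule a_diff_ge)
      finally show "\<alpha> * (16 / D) powr (- \<alpha> - 1) \<le> d (2 * M)" .
      show "2 / D \<le> real M - 2 / D" using M1 by (simp add: field_simps)
    qed (use D d_nn in auto)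
    finally show ?thesis .
  qed
  have "Re (\<zeta> ^ Suc m) \<le> 1" for m using complex_Re_le_cmod[of "\<zeta> ^ Suc m"] pw[of "Suc m"] by linarith
  then have term_nn: "0 \<le> d m * (1 - Re (\<zeta> ^ Suc m))" for m
    using d_nn by (intro mult_nonneg_nonneg) auto
  have window: "d (2 * M) * (real M - 2 / D) \<le> (\<Sum>m = M..<2 * M. d m * (1 - Re (\<zeta> ^ Suc m)))"
  proof -
    have "(1 - \<zeta>) * (\<Sum>m = M..<2 * M. \<zeta> ^ Suc m) = \<zeta> ^ Suc M - \<zeta> ^ Suc (2 * M)"
    proof -
      have "(1 - \<zeta>) * (\<Sum>m = M..<2 * M. \<zeta> ^ Suc m) = - (\<Sum>m = M..<2 * M. \<zeta> ^ Suc (Suc m) - \<zeta> ^ Suc m)"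
        by (simp add: sum_distrib_left algebra_simps sum_negf[symmetric])
      then show ?thesis by (subst (asm) sum_Suc_diff') auto
    qed
    then have "D * norm (\<Sum>m = M..<2 * M. \<zeta> ^ Suc m) = norm (\<zeta> ^ Suc M - \<zeta> ^ Suc (2 * M))"
      by (metis D_def norm_mult)
    also have "\<dots> \<le> 1 + 1" by (intro norm_diff_mono pw)
    finally have "norm (\<Sum>m = M..<2 * M. \<zeta> ^ Suc m) \<le> 2 / D" using D by (simp add: field_simps)
    then have "Re (\<Sum>m = M..<2 * M. \<zeta> ^ Suc m) \<le> 2 / D" using complex_Re_le_cmod order_trans by blast
    then have "d (2 * M) * (real M - 2 / D) \<le> d (2 * M) * (\<Sum>m = M..<2 * M. 1 - Re (\<zeta> ^ Suc m))"
      using d_nn by (intro mult_left_mono) (auto simp: sum_subtractf)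
    also have "\<dots> \<le> (\<Sum>m = M..<2 * M. d m * (1 - Re (\<zeta> ^ Suc m)))"
      unfolding sum_distrib_left using d_dec \<open>\<And>m. Re (\<zeta> ^ Suc m) \<le> 1\<close>
      by (intro sum_mono mult_right_mono) auto
    finally show ?thesis .
  qed
  have partial: "low \<le> Re (of_real (a 0) - (\<Sum>m<N. of_real (d m) * \<zeta> ^ Suc m))" if N: "N \<ge> 2 * M" for N
  proof -
    have "low \<le> (\<Sum>m = M..<2 * M. d m * (1 - Re (\<zeta> ^ Suc m)))" using low window by linarith
    also have "\<dots> \<le> (\<Sum>m<N. d m * (1 - Re (\<zeta> ^ Suc m)))"
      using N term_nn by (intro sum_mono2) auto
    also have "\<dots> = (\<Sum>m<N. d m) - Re (\<Sum>m<N. of_real (d m) * \<zeta> ^ Suc m)"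
      by (simp add: right_diff_distrib sum_subtractf)
    also have "(\<Sum>m<N. d m) = a 0 - a N"
      using sum_lessThan_telescope'[of a N] by (simp add: d_def)
    finally show ?thesis using moment_sequence_nonneg[OF moment_a, of N] by simp
  qed
  have rad: "1 \<le> fps_conv_radius (cfps d)"
    using d_nn d_dec[of 0] by (intro fps_conv_radius_ge_1[of _ "d 0"]) auto
  have "(1 - fps_X) * cfps a = fps_const (of_real (a 0)) - fps_X * cfps d"
    by (rule fps_ext) (auto simp: left_diff_distrib fps_X_mult_nth d_def)
  then have "eval_fps ((1 - fps_X) * cfps a) \<zeta> = eval_fps (fps_const (of_real (a 0)) - fps_X * cfps d) \<zeta>" by simp
  then have eval: "(1 - \<zeta>) * eval_fps (cfps a) \<zeta> = of_real (a 0) - \<zeta> * eval_fps (cfps d) \<zeta>"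
    using \<zeta> rad by (simp add: eval_fps_simps)
  have "(\<lambda>m. of_real (d m) * \<zeta> ^ Suc m) sums (\<zeta> * eval_fps (cfps d) \<zeta>)"
    using sums_mult[OF sums_eval_fps[OF norm_less_conv_radius[OF \<zeta> rad]], of \<zeta>] by (simp add: mult_ac)
  then have "(\<lambda>N. Re (of_real (a 0) - (\<Sum>m<N. of_real (d m) * \<zeta> ^ Suc m))) \<longlonglongrightarrow> Re ((1 - \<zeta>) * eval_fps (cfps a) \<zeta>)"
    unfolding eval by (intro tendsto_intros) (simp add: sums_def)
  then have "low \<le> Re ((1 - \<zeta>) * eval_fps (cfps a) \<zeta>)"
    by (rule tendsto_lowerbound) (use partial in \<open>auto simp: eventually_sequentially\<close>)
  then show ?thesis by (simp add: low_def D_def)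
qed

end

text \<open>Two regimes. If y is small compared with P, the real part alone is at least c P / 2.
  Otherwise |Im z| >= s P with s = c d / (2 M), and norm z + Re z = (Im z)^2 / (norm z - Re z) with
  a denominator of at most 2 C P.\<close>

lemma norm_plus_Re_lower_bound:
  fixes z :: complex and P y :: real
  assumes pos: "0 < c" "0 < d" "0 < M" "0 < C" and P: "0 \<le> P" and y: "0 \<le> y"
    and upper: "norm z \<le> C * P" and Re: "c * P - M * y \<le> Re z" and Im: "d * y \<le> \<bar>Im z\<bar>"
  shows "min (c / 2) ((c * d / (2 * M))\<^sup>2 / (2 * C)) * P \<le> norm z + Re z"
proof (cases "M * y \<le> c / 2 * P")
  case True
  then have "c / 2 * P \<le> norm z + Re z" using Re norm_ge_zero[of z] by linarith
  moreover have "min (c / 2) ((c * d / (2 * M))\<^sup>2 / (2 * C)) * P \<le> c / 2 * P"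
    using P by (intro mult_right_mono) auto
  ultimately show ?thesis by linarith
next
  case False
  define s where "s = c * d / (2 * M)"
  have s: "s > 0" using pos by (simp add: s_def)
  have "s * P \<le> d * y" using False pos by (simp add: s_def field_simps)
  then have Im': "s * P \<le> \<bar>Im z\<bar>" using Im by linarith
  show ?thesis
  proof (cases "P = 0")
    case True
    then show ?thesis using complex_Re_le_cmod[of "- z"] by simp
  next
    case False
    then have P: "P > 0" using P by simp
    have "(s * P)\<^sup>2 \<le> (Im z)\<^sup>2" using power_mono[OF Im', of 2] s P by simp
    also have "\<dots> = (norm z + Re z) * (norm z - Re z)"
      by (simp add: algebra_simps power2_eq_square[symmetric] cmod_power2)
    also have "\<dots> \<le> (norm z + Re z) * (2 * C * P)"
      using complex_Re_le_cmod[of "- z"] upper by (intro mult_left_mono) auto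
    finally have "(s * P)\<^sup>2 \<le> (norm z + Re z) * (2 * C * P)" .
    then have "P * (s\<^sup>2 * P) \<le> P * ((norm z + Re z) * (2 * C))"
      by (simp add: power2_eq_square mult_ac)
    then have "s\<^sup>2 * P \<le> (norm z + Re z) * (2 * C)" using P by simp
    then have "s\<^sup>2 / (2 * C) * P \<le> norm z + Re z" using pos by (simp add: field_simps)
    moreover have "min (c / 2) (s\<^sup>2 / (2 * C)) * P \<le> s\<^sup>2 / (2 * C) * P"
      using P by (intro mult_right_mono) auto
    ultimately show ?thesis unfolding s_def by linarith
  qed
qed

text \<open>In the expansion the only term free of Im \<zeta> is (Re (1 - \<zeta>))^2 * Re B >= 0.
  All loss is therefore proportional to Im \<zeta>, the kind of loss that
  \<open>norm_plus_Re_lower_bound\<close> tolerates; 3 counts the remaining terms with their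
  coefficients.\<close>

lemma Re_square_mult_ge:
  fixes \<zeta> B :: complex
  assumes "norm \<zeta> < 1" "0 \<le> Im \<zeta>" "0 \<le> Re B"
  shows "- (3 * norm (1 - \<zeta>) * Im \<zeta> * norm B) \<le> Re ((1 - \<zeta>)\<^sup>2 * B)"
proof -
  define D x y where "D = norm (1 - \<zeta>)" and "x = Re (1 - \<zeta>)" and "y = Im \<zeta>"
  have y: "0 \<le> y" "y \<le> D" using assms abs_Im_le_cmod[of "1 - \<zeta>"] by (auto simp: y_def D_def)
  have x: "0 \<le> x" "x \<le> D"
    using assms complex_Re_le_cmod[of \<zeta>] complex_Re_le_cmod[of "1 - \<zeta>"] by (auto simp: x_def D_def)
  have B: "Re B \<le> norm B" "\<bar>Im B\<bar> \<le> norm B" by (auto simp: complex_Re_le_cmod abs_Im_le_cmod)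
  have "Re ((1 - \<zeta>)\<^sup>2 * B) = x * x * Re B - y * y * Re B + 2 * (x * y * Im B)"
    by (simp add: x_def y_def power2_eq_square algebra_simps)
  moreover have "y * y * Re B \<le> D * y * norm B"
    using y B assms(3) by (intro mult_mono) auto
  moreover have "\<bar>x * y * Im B\<bar> \<le> D * y * norm B"
    unfolding abs_mult using x y B by (intro mult_mono) auto
  moreover have "0 \<le> x * x * Re B" using assms(3) by simp
  ultimately show ?thesis unfolding D_def[symmetric] y_def[symmetric] by linarith
qed

text \<open>As for the square; the three terms containing Im \<zeta> have the coefficients 3, 3 and
  1.\<close>

lemma Re_cube_mult_ge:
  fixes \<zeta> B :: complex
  assumes "norm \<zeta> < 1" "0 \<le> Im \<zeta>" "0 \<le> Re B"
  shows "- (7 * (norm (1 - \<zeta>))\<^sup>2 * Im \<zeta> * norm B) \<le> Re ((1 - \<zeta>) ^ 3 * B)"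
proof -
  define D x y where "D = norm (1 - \<zeta>)" and "x = Re (1 - \<zeta>)" and "y = Im \<zeta>"
  have y: "0 \<le> y" "y \<le> D" using assms abs_Im_le_cmod[of "1 - \<zeta>"] by (auto simp: y_def D_def)
  have x: "0 \<le> x" "x \<le> D"
    using assms complex_Re_le_cmod[of \<zeta>] complex_Re_le_cmod[of "1 - \<zeta>"] by (auto simp: x_def D_def)
  have D: "0 \<le> D" by (simp add: D_def)
  have B: "Re B \<le> norm B" "\<bar>Im B\<bar> \<le> norm B" by (auto simp: complex_Re_le_cmod abs_Im_le_cmod)
  have "Re ((1 - \<zeta>) ^ 3 * B) = x * x * x * Re B - 3 * (x * y * y * Re B) + 3 * (x * x * y * Im B) - y * y * y * Im B"
    by (simp add: x_def y_def power3_eq_cube algebra_simps)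
  moreover have "x * y * y * Re B \<le> D * D * y * norm B"
    using x y B D assms(3) by (intro mult_mono) auto
  moreover have "\<bar>x * x * y * Im B\<bar> \<le> D * D * y * norm B"
    unfolding abs_mult using x y D B by (intro mult_mono) auto
  moreover have "\<bar>y * y * y * Im B\<bar> \<le> D * D * y * norm B"
    unfolding abs_mult using x y D B by (intro mult_mono) auto
  moreover have "0 \<le> x * x * x * Re B" using x assms(3) by simp
  ultimately show ?thesis unfolding D_def[symmetric] y_def[symmetric] power2_eq_square by linarith
qed

section \<open>The sector condition for the symbol\<close>

context caputo_order
begin

lemma conv_radius_b_minus_c [simp]: "1 \<le> fps_conv_radius (cfps (\<lambda>m. b m - c m))"
  by (rule conv_radius_moment_sequence[OF moment_b_minus_c])

text \<open>The quadratic and cubic parts are regrouped as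
  \<open>(1 - \<zeta>)\<^sup>2 * (b - c) + (1 - \<zeta>)\<^sup>2 * (2 - \<zeta>) * c\<close>: both multipliers have the right sign on geometric
  sequences, whereas \<open>(1 - \<zeta>) ^ 3\<close> alone has not.\<close>

lemma symbol_Im_le:
  assumes \<zeta>: "norm \<zeta> < 1" and y: "0 \<le> Im \<zeta>"
  shows "Im (eval_fps symbol \<zeta>) \<le> - ((a 0 - a 1) / 4 * Im \<zeta>)"
proof -
  note Im_le = geometric_Im_le[OF \<zeta> y]
  have "cfps b = cfps (\<lambda>m. b m - c m) + cfps c" by (rule fps_ext) simp
  then have "eval_fps (cfps b) \<zeta> = eval_fps (cfps (\<lambda>m. b m - c m) + cfps c) \<zeta>" by (rule arg_cong)
  then have b: "eval_fps (cfps b) \<zeta> = eval_fps (cfps (\<lambda>m. b m - c m)) \<zeta> + eval_fps (cfps c) \<zeta>"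
    using \<zeta> by (simp add: eval_fps_simps)
  have "eval_fps symbol \<zeta> = (1 - \<zeta>) * eval_fps (cfps a) \<zeta> + (1 - \<zeta>)\<^sup>2 * eval_fps (cfps (\<lambda>m. b m - c m)) \<zeta>
      + (1 - \<zeta>)\<^sup>2 * (2 - \<zeta>) * eval_fps (cfps c) \<zeta>"
    unfolding eval_symbol[OF \<zeta>] b by (simp add: power2_eq_square algebra_simps)
  then have "Im (eval_fps symbol \<zeta>) = Im ((1 - \<zeta>) * eval_fps (cfps a) \<zeta>)
      + Im ((1 - \<zeta>)\<^sup>2 * eval_fps (cfps (\<lambda>m. b m - c m)) \<zeta>) + Im ((1 - \<zeta>)\<^sup>2 * (2 - \<zeta>) * eval_fps (cfps c) \<zeta>)"
    by (simp only: plus_complex.simps)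
  moreover have "Im ((1 - \<zeta>) * eval_fps (cfps a) \<zeta>) \<le> - (Im \<zeta> / 4) * (a 0 - a 1)"
    by (rule moment_sequence_Im_le[OF moment_a \<zeta> Im_le(1)])
  moreover have "Im ((1 - \<zeta>)\<^sup>2 * eval_fps (cfps (\<lambda>m. b m - c m)) \<zeta>) \<le> 0 * ((b 0 - c 0) - (b 1 - c 1))"
    by (rule moment_sequence_Im_le[OF moment_b_minus_c \<zeta> Im_le(2)])
  moreover have "Im ((1 - \<zeta>)\<^sup>2 * (2 - \<zeta>) * eval_fps (cfps c) \<zeta>) \<le> 0 * (c 0 - c 1)"
    by (rule moment_sequence_Im_le[OF moment_c \<zeta> Im_le(3)])
  ultimately show ?thesis by (simp add: mult.commute)
qed

lemma symbol_sector:
  obtains k where "k > 0"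
    and "\<And>\<zeta>. norm \<zeta> < 1 \<Longrightarrow> k * norm (1 - \<zeta>) powr \<alpha> \<le> norm (eval_fps symbol \<zeta>) + Re (eval_fps symbol \<zeta>)"
proof -
  obtain C where C: "C > 0"
    and B: "\<And>\<zeta>. norm \<zeta> < 1 \<Longrightarrow> norm (eval_fps (cfps b) \<zeta>) \<le> C * norm (1 - \<zeta>) powr (\<alpha> - 1)"
    and Cc: "\<And>\<zeta>. norm \<zeta> < 1 \<Longrightarrow> norm (eval_fps (cfps c) \<zeta>) \<le> C * norm (1 - \<zeta>) powr (\<alpha> - 1)"
    and S: "\<And>\<zeta>. norm \<zeta> < 1 \<Longrightarrow> norm (eval_fps symbol \<zeta>) \<le> C * norm (1 - \<zeta>) powr \<alpha>"
    by (rule symbol_estimates) (rule that, blast+)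
  define c1 c2 where "c1 = 2 * \<alpha> * 16 powr (- \<alpha> - 1)" and "c2 = (a 0 - a 1) / 4"
  have c1: "c1 > 0" using \<alpha>_bounds by (simp add: c1_def)
  have "0 < \<alpha> * (real 0 + 2) powr (- \<alpha> - 1)" using \<alpha>_bounds by simp
  then have c2: "c2 > 0" using a_diff_ge[of 0] by (simp add: c2_def)
  \<comment> \<open>34 = 6 + 28, the losses from the quadratic and the cubic part; both use D * (C *
    D^(\<alpha> - 1)) <= 2 * C.\<close>
  define M where "M = 34 * C"
  define k where "k = min (c1 / 2) ((c1 * c2 / (2 * M))\<^sup>2 / (2 * C))"
  have upper: "k * norm (1 - \<zeta>) powr \<alpha> \<le> norm (eval_fps symbol \<zeta>) + Re (eval_fps symbol \<zeta>)"
    if \<zeta>: "norm \<zeta> < 1" and y: "0 \<le> Im \<zeta>" for \<zeta>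
    unfolding k_def
  proof (rule norm_plus_Re_lower_bound)
    define D where "D = norm (1 - \<zeta>)"
    have D: "0 < D" "D \<le> 2" using norm_one_minus_bounds[OF \<zeta>] by (auto simp: D_def)
    have "D powr \<alpha> \<le> 2 powr \<alpha>" using D \<alpha>_bounds by (intro powr_mono2) auto
    also have "\<dots> \<le> 2" using powr_mono[of \<alpha> 1 2] \<alpha>_bounds by simp
    finally have D\<alpha>: "D powr \<alpha> \<le> 2" .
    have DX: "D * X \<le> 2 * C" if "X \<le> C * D powr (\<alpha> - 1)" for X
    proof -
      have "D * X \<le> D * (C * D powr (\<alpha> - 1))" using that D by (intro mult_left_mono) auto
      also have "\<dots> = C * D powr \<alpha>" using D by (simp add: powr_diff)
      also have "\<dots> \<le> C * 2" using D\<alpha> C by (intro mult_left_mono) auto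
      finally show ?thesis by simp
    qed
    \<comment> \<open>The multiplier -\<i> turns the estimate of imaginary parts into nonnegativity
      of the real part.\<close>
    have nn: "0 \<le> Re (eval_fps (cfps f) \<zeta>)" if "moment_sequence f" for f
      using moment_sequence_Im_le[OF that \<zeta> geometric_Im_le(4)[OF \<zeta> y]] by simp
    have "3 * D * Im \<zeta> * norm (eval_fps (cfps b) \<zeta>) \<le> 6 * C * Im \<zeta>"
      using mult_right_mono[OF DX[OF B[OF \<zeta>, folded D_def]], of "3 * Im \<zeta>"] y by (simp add: mult_ac)
    moreover have "7 * D\<^sup>2 * Im \<zeta> * norm (eval_fps (cfps c) \<zeta>) \<le> 28 * C * Im \<zeta>"
    proof -
      have "D * (D * norm (eval_fps (cfps c) \<zeta>)) \<le> 2 * (2 * C)"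
        using D C by (intro mult_mono DX Cc[OF \<zeta>, folded D_def]) auto
      then have "D * (D * norm (eval_fps (cfps c) \<zeta>)) * (7 * Im \<zeta>) \<le> 2 * (2 * C) * (7 * Im \<zeta>)"
        using y by (intro mult_right_mono) auto
      then show ?thesis by (simp add: power2_eq_square mult_ac)
    qed
    moreover have "Re (eval_fps symbol \<zeta>) = Re ((1 - \<zeta>) * eval_fps (cfps a) \<zeta>)
        + Re ((1 - \<zeta>)\<^sup>2 * eval_fps (cfps b) \<zeta>) + Re ((1 - \<zeta>) ^ 3 * eval_fps (cfps c) \<zeta>)"
    proof -
      have "eval_fps symbol \<zeta> = (1 - \<zeta>) * eval_fps (cfps a) \<zeta> + (1 - \<zeta>)\<^sup>2 * eval_fps (cfps b) \<zeta>
          + (1 - \<zeta>) ^ 3 * eval_fps (cfps c) \<zeta>"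
        unfolding eval_symbol[OF \<zeta>] by (simp add: power2_eq_square power3_eq_cube algebra_simps)
      then show ?thesis by (simp only: plus_complex.simps)
    qed
    moreover have "c1 * D powr \<alpha> \<le> Re ((1 - \<zeta>) * eval_fps (cfps a) \<zeta>)"
      using Re_lin_symbol_ge[OF \<zeta>] by (simp add: c1_def D_def)
    ultimately show "c1 * norm (1 - \<zeta>) powr \<alpha> - M * Im \<zeta> \<le> Re (eval_fps symbol \<zeta>)"
      using Re_square_mult_ge[OF \<zeta> y nn[OF moment_b]] Re_cube_mult_ge[OF \<zeta> y nn[OF moment_c]]
      unfolding M_def D_def[symmetric] by linarith
    show "c2 * Im \<zeta> \<le> \<bar>Im (eval_fps symbol \<zeta>)\<bar>"
      using symbol_Im_le[OF \<zeta> y] unfolding c2_def by linarith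
  qed (use c1 c2 C S[OF \<zeta>] y in \<open>auto simp: M_def\<close>)
  show ?thesis
  proof
    show "k > 0" using c1 c2 C by (simp add: k_def M_def)
    fix \<zeta> :: complex assume \<zeta>: "norm \<zeta> < 1"
    show "k * norm (1 - \<zeta>) powr \<alpha> \<le> norm (eval_fps symbol \<zeta>) + Re (eval_fps symbol \<zeta>)"
    proof (cases "0 \<le> Im \<zeta>")
      case False
      \<comment> \<open>The coefficients are real, so the lower half of the disc follows by
        conjugation.\<close>
      have cnj: "eval_fps symbol (cnj \<zeta>) = cnj (eval_fps symbol \<zeta>)"
        using \<zeta> by (simp add: eval_symbol eval_fps_cfps_cnj norm_less_conv_radius)
      have n: "norm (1 - cnj \<zeta>) = norm (1 - \<zeta>)"
        by (metis complex_cnj_diff complex_cnj_one complex_mod_cnj)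
      show ?thesis using upper[of "cnj \<zeta>"] \<zeta> False unfolding cnj n by simp
    qed (use upper \<zeta> in blast)
  qed
qed

end

subsection \<open>Coefficient bounds for the generating function\<close>

lemma vector_derivative_circlepath_0:
  "0 \<le> t \<Longrightarrow> t \<le> 1 \<Longrightarrow>
    vector_derivative (circlepath 0 r) (at t within {0..1}) = 2 * of_real pi * \<i> * circlepath 0 r t"
  by (subst vector_derivative_circlepath01) (auto simp: circlepath)

text \<open>On the circle of radius r, (1 - r^2) / |1 - u|^2 is the real part of (1 + u) / (1 - u),
  whose mean is its value 1 at the centre.\<close>

lemma has_integral_Poisson:
  assumes r: "0 < r" "r < 1"
  shows "((\<lambda>t. 1 / (norm (1 - circlepath 0 r t))\<^sup>2) has_integral 1 / (1 - r\<^sup>2)) {0..1}"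
proof -
  define h :: "complex \<Rightarrow> complex" where "h u = (1 + u) / (1 - u)" for u
  have norm_path: "norm (circlepath 0 r t) = r" for t using r by (simp add: circlepath norm_mult)
  have nz: "circlepath 0 r t \<noteq> 0" for t using norm_path[of t] r by auto
  have "h holomorphic_on cball 0 r"
    unfolding h_def using r by (intro holomorphic_intros) auto
  then have "((\<lambda>u. h u / (u - 0)) has_contour_integral 2 * of_real pi * \<i> * h 0) (circlepath 0 r)"
    using r by (intro Cauchy_integral_circlepath_simple) auto
  then have "((\<lambda>t. h (circlepath 0 r t) / circlepath 0 r t * (2 * of_real pi * \<i> * circlepath 0 r t)) has_integral 2 * of_real pi * \<i> * h 0) {0..1}"
    unfolding has_contour_integral_def
    by (rule has_integral_eq[rotated]) (simp add: vector_derivative_circlepath_0)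
  then have "((\<lambda>t. 2 * of_real pi * \<i> * h (circlepath 0 r t)) has_integral 2 * of_real pi * \<i> * 1) {0..1}"
    using nz by (simp add: h_def mult_ac)
  from has_integral_mult_right[OF this, of "1 / (2 * of_real pi * \<i>)"]
  have "((\<lambda>t. h (circlepath 0 r t)) has_integral 1) {0..1}" by simp
  from has_integral_Re[OF this]
  have "((\<lambda>t. (1 - r\<^sup>2) * (1 / (norm (1 - circlepath 0 r t))\<^sup>2)) has_integral Re 1) {0..1}"
  proof (rule has_integral_eq[rotated])
    fix t :: real
    have "Re (h u) = (1 - (norm u)\<^sup>2) / (norm (1 - u))\<^sup>2" for u
      unfolding h_def cmod_power2 by (simp add: Re_divide algebra_simps power2_eq_square)
    then show "Re (h (circlepath 0 r t)) = (1 - r\<^sup>2) * (1 / (norm (1 - circlepath 0 r t))\<^sup>2)"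
      by (simp add: norm_path)
  qed
  from has_integral_mult_right[OF this, of "1 / (1 - r\<^sup>2)"] show ?thesis
    using r by (simp add: power2_eq_1_iff)
qed

text \<open>n times the n-th coefficient is a coefficient of the derivative. For r = n / (n + 1) the
  mean 1 / (1 - r^2) is at most 2 n, which cancels the n, and r^(-(n - 1)) is at most exp 1 <= 3;
  together 6.\<close>

lemma fps_coeff_bound_of_deriv:
  fixes f :: "complex \<Rightarrow> complex"
  assumes holo: "f holomorphic_on ball 0 1" and F: "f has_fps_expansion F" and B: "0 \<le> B"
    and bound: "\<And>\<zeta>. norm \<zeta> < 1 \<Longrightarrow> norm (deriv f \<zeta>) \<le> B / (norm (1 - \<zeta>))\<^sup>2"
    and n: "n \<ge> 1"
  shows "norm (fps_nth F n) \<le> 6 * B"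
proof -
  define r where "r = real n / (real n + 1)"
  have r: "0 < r" "r < 1" using n by (auto simp: r_def)
  have norm_path: "norm (circlepath 0 r t) = r" for t using r by (simp add: circlepath norm_mult)
  have nz: "circlepath 0 r t \<noteq> 0" for t using norm_path[of t] r by auto
  have dh: "deriv f holomorphic_on ball 0 1" using holo by (intro holomorphic_deriv) auto
  then have dh_r: "continuous_on (cball 0 r) (deriv f)" "deriv f holomorphic_on ball 0 r"
    using r by (auto intro!: holomorphic_on_imp_continuous_on elim: holomorphic_on_subset)
  have "((\<lambda>u. deriv f u / (u - 0) ^ Suc (n - 1)) has_contour_integral
      2 * of_real pi * \<i> / fact (n - 1) * (deriv ^^ (n - 1)) (deriv f) 0) (circlepath 0 r)"
    using Cauchy_has_contour_integral_higher_derivative_circlepath[OF dh_r, of 0 "n - 1"] r by simp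
  moreover have "(deriv ^^ (n - 1)) (deriv f) = (deriv ^^ n) f"
    using n by (metis Suc_diff_1 funpow_Suc_right less_eq_Suc_le One_nat_def o_apply)
  moreover have "(deriv ^^ n) f 0 / fact (n - 1) = of_nat n * fps_nth F n"
    using n fact_reduce[of n, where 'a = complex] by (simp add: fps_nth_fps_expansion[OF F])
  ultimately have ci: "((\<lambda>u. deriv f u / u ^ n) has_contour_integral 2 * of_real pi * \<i> * (of_nat n * fps_nth F n)) (circlepath 0 r)"
    using n by (simp add: field_simps)
  define g where "g t = deriv f (circlepath 0 r t) / circlepath 0 r t ^ n * (2 * of_real pi * \<i> * circlepath 0 r t)" for t
  have g: "(g has_integral 2 * of_real pi * \<i> * (of_nat n * fps_nth F n)) {0..1}"
    using ci unfolding has_contour_integral_def g_def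
    by (rule has_integral_eq[rotated]) (simp add: vector_derivative_circlepath_0)
  define q where "q t = 2 * pi * B * (1 / r) ^ (n - 1) * (1 / (norm (1 - circlepath 0 r t))\<^sup>2)" for t
  have q: "(q has_integral 2 * pi * B * (1 / r) ^ (n - 1) * (1 / (1 - r\<^sup>2))) {0..1}"
    unfolding q_def by (rule has_integral_mult_right[OF has_integral_Poisson[OF r]])
  have "norm (g t) \<le> q t" for t
  proof -
    have "norm (g t) = norm (deriv f (circlepath 0 r t)) * (2 * pi * (1 / r) ^ (n - 1))"
      using n r nz[of t] by (cases n) (auto simp: g_def norm_mult norm_divide norm_power norm_path power_divide)
    also have "\<dots> \<le> B / (norm (1 - circlepath 0 r t))\<^sup>2 * (2 * pi * (1 / r) ^ (n - 1))"
      using r by (intro mult_right_mono bound) (auto simp: norm_path)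
    finally show ?thesis by (simp add: q_def mult_ac)
  qed
  then have "norm (integral {0..1} g) \<le> integral {0..1} q"
    using g q by (intro integral_norm_bound_integral) (auto simp: has_integral_integrable)
  then have main: "2 * pi * (real n * norm (fps_nth F n)) \<le> 2 * pi * B * (1 / r) ^ (n - 1) * (1 / (1 - r\<^sup>2))"
    unfolding integral_unique[OF g] integral_unique[OF q] by (simp add: norm_mult)
  have "(1 / r) ^ (n - 1) \<le> 3"
  proof -
    have e: "1 / r = 1 + 1 / real n" using n by (simp add: r_def field_simps)
    have "(1 / r) ^ (n - 1) \<le> (1 / r) ^ n" using r by (intro power_increasing) auto
    also have "\<dots> \<le> exp 1" unfolding e using n exp_ge_one_plus_x_over_n_power_n[of n 1] by simp
    also have "exp 1 \<le> (3::real)" by (rule exp_le)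
    finally show ?thesis .
  qed
  moreover have "1 / (1 - r\<^sup>2) \<le> 2 * real n"
  proof -
    have "1 - r \<le> 1 - r\<^sup>2" using r by (simp add: power2_eq_square mult_left_le)
    then have "1 / (1 - r\<^sup>2) \<le> 1 / (1 - r)" using r by (intro frac_le) auto
    also have "\<dots> = real n + 1" using n by (simp add: r_def field_simps)
    also have "\<dots> \<le> 2 * real n" using n by simp
    finally show ?thesis .
  qed
  moreover have "0 \<le> 1 / (1 - r\<^sup>2)" using r by (simp add: power_le_one)
  ultimately have "(1 / r) ^ (n - 1) * (1 / (1 - r\<^sup>2)) \<le> 3 * (2 * real n)"
    by (intro mult_mono) auto
  then have "2 * pi * B * ((1 / r) ^ (n - 1) * (1 / (1 - r\<^sup>2))) \<le> 2 * pi * B * (3 * (2 * real n))"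
    using B by (intro mult_left_mono) auto
  with main have "2 * pi * (real n * norm (fps_nth F n)) \<le> 2 * pi * B * (3 * (2 * real n))"
    by (simp only: mult.assoc)
  also have "\<dots> = 2 * pi * (real n * (6 * B))" by simp
  finally show ?thesis using n by simp
qed

section \<open>The differentiated equation in the disc\<close>

context caputo_order
begin

text \<open>Right-hand side of the equation satisfied by the generating function of the solution at the
  positive time levels: \<open>w0\<close> is the initial value, while \<open>w1\<close> and \<open>w2\<close> correct for the reduced
  interpolation degree on the first two cells.\<close>

definition forcing :: "complex \<Rightarrow> complex \<Rightarrow> complex \<Rightarrow> complex fps" where
  "forcing w0 w1 w2 = fps_X * diff_kernel * fps_const w0 + fps_X * cfps b * fps_const w1
     + cfps c * (fps_X * fps_const w1 + fps_X\<^sup>2 * fps_const w2)"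

lemma conv_radius_forcing [simp]: "1 \<le> fps_conv_radius (forcing w0 w1 w2)"
  unfolding forcing_def by (intro conv_radius_closure conv_radius_symbol conv_radius_kernels)

lemma eval_forcing:
  assumes \<zeta>: "norm \<zeta> < 1"
  shows "eval_fps (forcing w0 w1 w2) \<zeta> = \<zeta> * eval_fps diff_kernel \<zeta> * w0 + \<zeta> * eval_fps (cfps b) \<zeta> * w1
      + eval_fps (cfps c) \<zeta> * (\<zeta> * w1 + \<zeta>\<^sup>2 * w2)"
    and "eval_fps (fps_deriv (forcing w0 w1 w2)) \<zeta> = eval_fps diff_kernel \<zeta> * w0 + \<zeta> * eval_fps (fps_deriv diff_kernel) \<zeta> * w0
      + (eval_fps (cfps b) \<zeta> + \<zeta> * eval_fps (fps_deriv (cfps b)) \<zeta>) * w1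
      + (eval_fps (fps_deriv (cfps c)) \<zeta> * (\<zeta> * w1 + \<zeta>\<^sup>2 * w2) + eval_fps (cfps c) \<zeta> * (w1 + 2 * \<zeta> * w2))"
proof -
  have d: "fps_deriv (forcing w0 w1 w2) = diff_kernel * fps_const w0 + fps_X * fps_deriv diff_kernel * fps_const w0
      + (cfps b + fps_X * fps_deriv (cfps b)) * fps_const w1
      + (fps_deriv (cfps c) * (fps_X * fps_const w1 + fps_X\<^sup>2 * fps_const w2) + cfps c * (fps_const w1 + 2 * fps_X * fps_const w2))"
    unfolding forcing_def by (simp add: power2_eq_square algebra_simps)
  show "eval_fps (forcing w0 w1 w2) \<zeta> = \<zeta> * eval_fps diff_kernel \<zeta> * w0 + \<zeta> * eval_fps (cfps b) \<zeta> * w1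
      + eval_fps (cfps c) \<zeta> * (\<zeta> * w1 + \<zeta>\<^sup>2 * w2)"
    unfolding forcing_def using \<zeta> by (simp add: eval_fps_simps)
  show "eval_fps (fps_deriv (forcing w0 w1 w2)) \<zeta> = eval_fps diff_kernel \<zeta> * w0 + \<zeta> * eval_fps (fps_deriv diff_kernel) \<zeta> * w0
      + (eval_fps (cfps b) \<zeta> + \<zeta> * eval_fps (fps_deriv (cfps b)) \<zeta>) * w1
      + (eval_fps (fps_deriv (cfps c)) \<zeta> * (\<zeta> * w1 + \<zeta>\<^sup>2 * w2) + eval_fps (cfps c) \<zeta> * (w1 + 2 * \<zeta> * w2))"
    unfolding d using \<zeta> by (simp add: eval_fps_simps)
qed

text \<open>With D = norm (1 - \<zeta>) the resolvent costs D^(-\<alpha>), uniformly in \<kappa>.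
  The forcing is O(D^(\<alpha> - 1)), so Y is O(1 / D). Differentiating the equation applies the
  same operator to Y' with the right-hand side forcing' - symbol' * Y, both parts O(D^(\<alpha> -
  2)); hence Y' is O(1 / D^2).\<close>

lemma generating_function_bound:
  obtains C where "C > 0"
    and "\<And>\<kappa> K M Y w0 w1 w2 F i n. \<kappa> > 0 \<Longrightarrow> M \<ge> 0 \<Longrightarrow>
      (\<And>i. i \<le> (K :: nat) \<Longrightarrow> Y i holomorphic_on ball 0 1) \<Longrightarrow>
      (\<And>\<zeta>. norm \<zeta> < 1 \<Longrightarrow> Y 0 \<zeta> = 0) \<Longrightarrow> (\<And>\<zeta>. norm \<zeta> < 1 \<Longrightarrow> Y K \<zeta> = 0) \<Longrightarrow>
      (\<And>i. 1 \<le> i \<Longrightarrow> i < K \<Longrightarrow> norm (w0 i) \<le> M \<and> norm (w1 i) \<le> M \<and> norm (w2 i) \<le> M) \<Longrightarrow>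
      (\<And>i \<zeta>. 1 \<le> i \<Longrightarrow> i < K \<Longrightarrow> norm \<zeta> < 1 \<Longrightarrow>
         eval_fps symbol \<zeta> * Y i \<zeta> - of_real \<kappa> * (Y (i + 1) \<zeta> - 2 * Y i \<zeta> + Y (i - 1) \<zeta>) = eval_fps (forcing (w0 i) (w1 i) (w2 i)) \<zeta>) \<Longrightarrow>
      Y i has_fps_expansion F \<Longrightarrow> i \<le> K \<Longrightarrow> 1 \<le> n \<Longrightarrow> norm (fps_nth F n) \<le> C * M"
proof -
  obtain C where C: "C > 0"
    and b0: "\<And>\<zeta>. norm \<zeta> < 1 \<Longrightarrow> norm (eval_fps (cfps b) \<zeta>) \<le> C * norm (1 - \<zeta>) powr (\<alpha> - 1)"
    and c0: "\<And>\<zeta>. norm \<zeta> < 1 \<Longrightarrow> norm (eval_fps (cfps c) \<zeta>) \<le> C * norm (1 - \<zeta>) powr (\<alpha> - 1)"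
    and b1: "\<And>\<zeta>. norm \<zeta> < 1 \<Longrightarrow> norm (eval_fps (fps_deriv (cfps b)) \<zeta>) \<le> C * norm (1 - \<zeta>) powr (\<alpha> - 1)"
    and c1: "\<And>\<zeta>. norm \<zeta> < 1 \<Longrightarrow> norm (eval_fps (fps_deriv (cfps c)) \<zeta>) \<le> C * norm (1 - \<zeta>) powr (\<alpha> - 1)"
    and k0: "\<And>\<zeta>. norm \<zeta> < 1 \<Longrightarrow> norm (eval_fps diff_kernel \<zeta>) \<le> C * norm (1 - \<zeta>) powr (\<alpha> - 1)"
    and k1: "\<And>\<zeta>. norm \<zeta> < 1 \<Longrightarrow> norm ((1 - \<zeta>) * eval_fps (fps_deriv diff_kernel) \<zeta>) \<le> C * norm (1 - \<zeta>) powr (\<alpha> - 1)"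
    and s1: "\<And>\<zeta>. norm \<zeta> < 1 \<Longrightarrow> norm (eval_fps (fps_deriv symbol) \<zeta>) \<le> C * norm (1 - \<zeta>) powr (\<alpha> - 1)"
    by (rule symbol_estimates) (rule that, blast+)
  obtain k where k: "k > 0"
    and sector: "\<And>\<zeta>. norm \<zeta> < 1 \<Longrightarrow> k * norm (1 - \<zeta>) powr \<alpha> \<le> norm (eval_fps symbol \<zeta>) + Re (eval_fps symbol \<zeta>)"
    by (rule symbol_sector) (rule that, blast+)
  \<comment> \<open>17 * C bounds the derivative of the forcing, C * (8 * C / k) the product of
    symbol' and Y, and 2 / k is the resolvent.\<close>
  define E where "E = 2 * (17 * C + C * (8 * C / k)) / k"
  have E: "E > 0" using C k by (simp add: E_def add_pos_pos)
  show ?thesis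
  proof (rule that[of "6 * E"], goal_cases)
    case 1
    show ?case using E by simp
  next
    case (2 \<kappa> K M Y w0 w1 w2 F i n)
    note \<kappa> = 2(1) and M = 2(2) and holo = 2(3) and Y0 = 2(4) and YK = 2(5) and w = 2(6) and eq = 2(7)
      and F = 2(8) and i = 2(9) and n = 2(10)
    have "norm (deriv (Y i) \<zeta>) \<le> E * M / (norm (1 - \<zeta>))\<^sup>2" if \<zeta>: "norm \<zeta> < 1" for \<zeta>
    proof -
      define D P where "D = norm (1 - \<zeta>)" and "P = C * D powr (\<alpha> - 1)"
      have D: "0 < D" "D \<le> 2" using norm_one_minus_bounds[OF \<zeta>] by (auto simp: D_def)
      have P: "0 \<le> P" using C by (simp add: P_def)
      note bounds = b0[OF \<zeta>, folded D_def, folded P_def] c0[OF \<zeta>, folded D_def, folded P_def]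
        b1[OF \<zeta>, folded D_def, folded P_def] c1[OF \<zeta>, folded D_def, folded P_def]
        k0[OF \<zeta>, folded D_def, folded P_def] k1[OF \<zeta>, folded D_def, folded P_def]
      have PD: "P / D powr \<alpha> = C / D" using D by (simp add: P_def powr_diff)
      have n\<zeta>: "norm \<zeta> \<le> 1" using \<zeta> by simp
      have D': "norm (1 - \<zeta>) \<le> 2" using D by (simp add: D_def)
      have n2: "norm (2 :: complex) \<le> 2" by simp
      have G: "norm (eval_fps (forcing (w0 j) (w1 j) (w2 j)) \<zeta>) \<le> 4 * P * M"
        if j: "1 \<le> j" "j < K" for j
      proof -
        note wj = w[OF j, THEN conjunct1] w[OF j, THEN conjunct2, THEN conjunct1] w[OF j, THEN conjunct2, THEN conjunct2]
        have "norm (eval_fps (forcing (w0 j) (w1 j) (w2 j)) \<zeta>) \<le> 1 * P * M + 1 * P * M + P * (1 * M + 1\<^sup>2 * M)"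
          unfolding eval_forcing[OF \<zeta>]
          by (intro norm_triangle_mono norm_mult_mono norm_power_mono n\<zeta> bounds wj)
        then show ?thesis by (simp add: algebra_simps)
      qed
      have G': "norm (eval_fps (fps_deriv (forcing (w0 j) (w1 j) (w2 j))) \<zeta>) \<le> 17 * P * M / D"
        if j: "1 \<le> j" "j < K" for j
      proof -
        note wj = w[OF j, THEN conjunct1] w[OF j, THEN conjunct2, THEN conjunct1] w[OF j, THEN conjunct2, THEN conjunct2]
        \<comment> \<open>The factor 1 - \<zeta> is carried along because the derivative of
          \<open>diff_kernel\<close> is bounded only together with it.\<close>
        have "(1 - \<zeta>) * eval_fps (fps_deriv (forcing (w0 j) (w1 j) (w2 j))) \<zeta> =
          (1 - \<zeta>) * (eval_fps diff_kernel \<zeta> * w0 j) + \<zeta> * ((1 - \<zeta>) * eval_fps (fps_deriv diff_kernel) \<zeta>) * w0 j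
          + (1 - \<zeta>) * ((eval_fps (cfps b) \<zeta> + \<zeta> * eval_fps (fps_deriv (cfps b)) \<zeta>) * w1 j)
          + (1 - \<zeta>) * (eval_fps (fps_deriv (cfps c)) \<zeta> * (\<zeta> * w1 j + \<zeta>\<^sup>2 * w2 j) + eval_fps (cfps c) \<zeta> * (w1 j + 2 * \<zeta> * w2 j))"
          unfolding eval_forcing[OF \<zeta>] by (simp add: algebra_simps)
        also have "norm \<dots> \<le> 2 * (P * M) + 1 * P * M + 2 * ((P + 1 * P) * M)
          + 2 * (P * (1 * M + 1\<^sup>2 * M) + P * (M + 2 * 1 * M))"
          by (intro norm_triangle_mono norm_mult_mono[OF D'] norm_mult_mono[of "\<zeta> * _"] norm_mult_mono[of \<zeta>]
              norm_mult_mono[of "_ + _"] norm_mult_mono[of "eval_fps _ _"] norm_mult_mono[of 2] norm_mult_mono[of "2 * \<zeta>"]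
              norm_mult_mono[of "\<zeta>\<^sup>2"] norm_power_mono n\<zeta> n2 bounds wj)
        also have "\<dots> = 17 * P * M" by (simp add: algebra_simps)
        finally have "D * norm (eval_fps (fps_deriv (forcing (w0 j) (w1 j) (w2 j))) \<zeta>) \<le> 17 * P * M"
          by (simp add: norm_mult D_def)
        then show ?thesis using D by (simp add: field_simps)
      qed
      have resolvent: "norm (y j) \<le> 2 * R / (k * D powr \<alpha>)"
        if "y 0 = 0" "y K = 0" "R \<ge> 0" "j \<le> K"
          "\<And>j. 1 \<le> j \<Longrightarrow> j < K \<Longrightarrow> norm (eval_fps symbol \<zeta> * y j - of_real \<kappa> * (y (j + 1) - 2 * y j + y (j - 1))) \<le> R"
        for y :: "nat \<Rightarrow> complex" and R j
      proof -
        have "norm (y j) * (k * D powr \<alpha>) \<le> norm (y j) * (norm (eval_fps symbol \<zeta>) + Re (eval_fps symbol \<zeta>))"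
          using sector[OF \<zeta>] by (intro mult_left_mono) (auto simp: D_def)
        also have "\<dots> \<le> 2 * R"
          by (rule laplacian_resolvent_bound[OF \<kappa> that(3,1,2) refl that(5,4)])
        finally show ?thesis using k D by (simp add: field_simps)
      qed
      have Yb: "norm (Y j \<zeta>) \<le> 8 * C / k * M / D" if "j \<le> K" for j
      proof -
        have "norm (Y j \<zeta>) \<le> 2 * (4 * P * M) / (k * D powr \<alpha>)"
          by (rule resolvent[of "\<lambda>j. Y j \<zeta>"]) (use Y0 YK \<zeta> P M that eq G in auto)
        also have "\<dots> = 8 * M / k * (P / D powr \<alpha>)" by simp
        finally show ?thesis unfolding PD by (simp add: mult_ac)
      qed
      have dY: "(Y j has_field_derivative deriv (Y j) \<zeta>) (at \<zeta>)" if "j \<le> K" for j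
        using holomorphic_derivI[OF holo[OF that] open_ball] \<zeta> by simp
      \<comment> \<open>The boundary components vanish throughout the disc, so their derivatives
        satisfy the zero boundary conditions as well.\<close>
      have const0: "deriv (Y j) \<zeta> = 0" if "\<And>z. norm z < 1 \<Longrightarrow> Y j z = 0" for j
      proof -
        have "((\<lambda>_. 0) has_field_derivative 0) (at \<zeta>)" by simp
        then have "(Y j has_field_derivative 0) (at \<zeta>)"
          by (rule has_field_derivative_transform_within_open[of _ _ _ "ball 0 1"]) (use \<zeta> that in auto)
        then show ?thesis by (rule DERIV_imp_deriv)
      qed
      define R where "R = (17 * C + C * (8 * C / k)) * M * (P / C) / D"
      have R: "17 * P * M / D + P * (8 * C / k * M / D) = R"
        using C D k by (simp add: R_def field_simps)
      have dbound: "norm (eval_fps symbol \<zeta> * deriv (Y j) \<zeta>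
            - of_real \<kappa> * (deriv (Y (j + 1)) \<zeta> - 2 * deriv (Y j) \<zeta> + deriv (Y (j - 1)) \<zeta>)) \<le> R"
        if j: "1 \<le> j" "j < K" for j
      proof -
        have ds: "(eval_fps symbol has_field_derivative eval_fps (fps_deriv symbol) \<zeta>) (at \<zeta>)"
          using \<zeta> by (intro has_field_derivative_eval_fps norm_less_conv_radius) auto
        have "((\<lambda>z. eval_fps symbol z * Y j z - of_real \<kappa> * (Y (j + 1) z - 2 * Y j z + Y (j - 1) z)) has_field_derivative
            (eval_fps (fps_deriv symbol) \<zeta> * Y j \<zeta> + deriv (Y j) \<zeta> * eval_fps symbol \<zeta>
            - of_real \<kappa> * (deriv (Y (j + 1)) \<zeta> - 2 * deriv (Y j) \<zeta> + deriv (Y (j - 1)) \<zeta>))) (at \<zeta>)"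
          using j by (intro DERIV_diff DERIV_add DERIV_mult ds dY DERIV_cmult) auto
        moreover have "(eval_fps (forcing (w0 j) (w1 j) (w2 j)) has_field_derivative
            eval_fps (fps_deriv (forcing (w0 j) (w1 j) (w2 j))) \<zeta>) (at \<zeta>)"
          using \<zeta> by (intro has_field_derivative_eval_fps norm_less_conv_radius) auto
        then have "((\<lambda>z. eval_fps symbol z * Y j z - of_real \<kappa> * (Y (j + 1) z - 2 * Y j z + Y (j - 1) z)) has_field_derivative
            eval_fps (fps_deriv (forcing (w0 j) (w1 j) (w2 j))) \<zeta>) (at \<zeta>)"
          by (rule has_field_derivative_transform_within_open[of _ _ _ "ball 0 1"]) (use \<zeta> eq[OF j] in auto)
        ultimately have "eval_fps (fps_deriv symbol) \<zeta> * Y j \<zeta> + deriv (Y j) \<zeta> * eval_fps symbol \<zeta>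
            - of_real \<kappa> * (deriv (Y (j + 1)) \<zeta> - 2 * deriv (Y j) \<zeta> + deriv (Y (j - 1)) \<zeta>)
            = eval_fps (fps_deriv (forcing (w0 j) (w1 j) (w2 j))) \<zeta>"
          by (rule DERIV_unique)
        then have "eval_fps symbol \<zeta> * deriv (Y j) \<zeta>
            - of_real \<kappa> * (deriv (Y (j + 1)) \<zeta> - 2 * deriv (Y j) \<zeta> + deriv (Y (j - 1)) \<zeta>)
            = eval_fps (fps_deriv (forcing (w0 j) (w1 j) (w2 j))) \<zeta> - eval_fps (fps_deriv symbol) \<zeta> * Y j \<zeta>"
          by (simp add: algebra_simps)
        also have "norm \<dots> \<le> 17 * P * M / D + P * (8 * C / k * M / D)"
          using j by (intro norm_diff_mono norm_mult_mono G' Yb s1[OF \<zeta>, folded D_def, folded P_def]) auto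
        finally show ?thesis unfolding R .
      qed
      have "norm (deriv (Y i) \<zeta>) \<le> 2 * R / (k * D powr \<alpha>)"
        by (rule resolvent[of "\<lambda>j. deriv (Y j) \<zeta>"])
           (use const0 Y0 YK i dbound C D k P M in \<open>auto simp: R_def\<close>)
      also have "\<dots> = E * M * (P / D powr \<alpha>) / C / D"
        using C D k by (simp add: R_def E_def field_simps)
      also have "\<dots> = E * M / D\<^sup>2" unfolding PD using C by (simp add: power2_eq_square)
      finally show ?thesis by (simp add: D_def)
    qed
    from fps_coeff_bound_of_deriv[OF holo[OF i] F _ this n]
    show ?case using E M by simp
  qed
qed

end

subsection \<open>Stability of the discrete convolution equation\<close>

text \<open>Shooting: the three-term equation is solved for its last value, starting from 0 at node
  0 and y at node 1. Every component is then a polynomial expression in s and g, so holomorphy in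
  \<zeta> is immediate.\<close>

fun shoot :: "real \<Rightarrow> (complex \<Rightarrow> complex) \<Rightarrow> (nat \<Rightarrow> complex \<Rightarrow> complex) \<Rightarrow> complex \<Rightarrow> nat \<Rightarrow> complex \<Rightarrow> complex" where
  "shoot \<kappa> s g y 0 \<zeta> = 0"
| "shoot \<kappa> s g y (Suc 0) \<zeta> = y"
| "shoot \<kappa> s g y (Suc (Suc i)) \<zeta> =
     (2 + s \<zeta> / \<kappa>) * shoot \<kappa> s g y (Suc i) \<zeta> - shoot \<kappa> s g y i \<zeta> - g (Suc i) \<zeta> / \<kappa>"

lemma shoot_eq:
  assumes "\<kappa> > 0" "i \<ge> 1"
  shows "s \<zeta> * shoot \<kappa> s g y i \<zeta>
    - \<kappa> * (shoot \<kappa> s g y (i + 1) \<zeta> - 2 * shoot \<kappa> s g y i \<zeta> + shoot \<kappa> s g y (i - 1) \<zeta>) = g i \<zeta>"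
proof -
  obtain j where "i = Suc j" using assms by (cases i) auto
  then show ?thesis using assms by (simp add: field_simps)
qed

lemma holomorphic_on_shoot:
  assumes "s holomorphic_on S" "\<And>i. g i holomorphic_on S"
  shows "shoot \<kappa> s g y i holomorphic_on S"
proof (induction i rule: induct_nat_012)
  case (ge2 i)
  then have "(\<lambda>\<zeta>. (2 + s \<zeta> / \<kappa>) * shoot \<kappa> s g y (Suc i) \<zeta> - shoot \<kappa> s g y i \<zeta> - g (Suc i) \<zeta> / \<kappa>) holomorphic_on S"
    by (cases "\<kappa> = 0") (auto intro!: holomorphic_intros assms)
  then show ?case by (simp add: shoot.simps(3)[abs_def])
qed (auto simp: shoot.simps[abs_def])

text \<open>A multiple of the homogeneous shooting solution corrects the particular one at node K.
  Its value at K cannot vanish, for then the resolvent bound with zero right-hand side would force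
  it to be 0 at node 1, where it is 1.\<close>

lemma holomorphic_dirichlet_solution:
  fixes s :: "complex \<Rightarrow> complex" and g :: "nat \<Rightarrow> complex \<Rightarrow> complex"
  assumes \<kappa>: "\<kappa> > 0" and K: "K \<ge> 1" and s: "s holomorphic_on S" and g: "\<And>i. g i holomorphic_on S"
    and sector: "\<And>\<zeta>. \<zeta> \<in> S \<Longrightarrow> norm (s \<zeta>) + Re (s \<zeta>) > 0"
  obtains Y where "\<And>i. Y i holomorphic_on S"
    and "\<And>\<zeta>. \<zeta> \<in> S \<Longrightarrow> Y 0 \<zeta> = 0" and "\<And>\<zeta>. \<zeta> \<in> S \<Longrightarrow> Y K \<zeta> = 0"
    and "\<And>i \<zeta>. i \<ge> 1 \<Longrightarrow> \<zeta> \<in> S \<Longrightarrow> s \<zeta> * Y i \<zeta> - of_real \<kappa> * (Y (i + 1) \<zeta> - 2 * Y i \<zeta> + Y (i - 1) \<zeta>) = g i \<zeta>"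
proof
  define \<phi> where "\<phi> = shoot \<kappa> s (\<lambda>_ _. 0) 1"
  define \<psi> where "\<psi> = shoot \<kappa> s g 0"
  define Y where "Y i \<zeta> = \<psi> i \<zeta> - \<psi> K \<zeta> / \<phi> K \<zeta> * \<phi> i \<zeta>" for i \<zeta>
  have nz: "\<phi> K \<zeta> \<noteq> 0" if "\<zeta> \<in> S" for \<zeta>
  proof
    assume 0: "\<phi> K \<zeta> = 0"
    have "norm (\<phi> 1 \<zeta>) * (norm (s \<zeta>) + Re (s \<zeta>)) \<le> 2 * 0"
    proof (rule laplacian_resolvent_bound[OF \<kappa>, where y = "\<lambda>i. \<phi> i \<zeta>" and g = "\<lambda>_. 0" and K = K])
      show "s \<zeta> * \<phi> i \<zeta> - \<kappa> * (\<phi> (i + 1) \<zeta> - 2 * \<phi> i \<zeta> + \<phi> (i - 1) \<zeta>) = 0" if "1 \<le> i" for i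
        unfolding \<phi>_def by (rule shoot_eq[OF \<kappa> that])
    qed (use K 0 in \<open>auto simp: \<phi>_def\<close>)
    then show False using sector[OF that] by (simp add: \<phi>_def)
  qed
  have "\<phi> i holomorphic_on S" "\<psi> i holomorphic_on S" for i
    unfolding \<phi>_def \<psi>_def by (intro holomorphic_on_shoot s g holomorphic_intros)+
  then show "Y i holomorphic_on S" for i
    unfolding Y_def[abs_def] using nz by (intro holomorphic_intros)
  show "Y 0 \<zeta> = 0" for \<zeta> by (simp add: Y_def \<phi>_def \<psi>_def)
  show "Y K \<zeta> = 0" if "\<zeta> \<in> S" for \<zeta> using nz[OF that] by (simp add: Y_def)
  fix i \<zeta> assume i: "(i :: nat) \<ge> 1" and \<zeta>: "\<zeta> \<in> S"
  define q where "q = \<psi> K \<zeta> / \<phi> K \<zeta>"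
  have "s \<zeta> * Y i \<zeta> - of_real \<kappa> * (Y (i + 1) \<zeta> - 2 * Y i \<zeta> + Y (i - 1) \<zeta>)
    = (s \<zeta> * \<psi> i \<zeta> - \<kappa> * (\<psi> (i + 1) \<zeta> - 2 * \<psi> i \<zeta> + \<psi> (i - 1) \<zeta>))
      - q * (s \<zeta> * \<phi> i \<zeta> - \<kappa> * (\<phi> (i + 1) \<zeta> - 2 * \<phi> i \<zeta> + \<phi> (i - 1) \<zeta>))"
    unfolding Y_def q_def[symmetric] by (simp add: algebra_simps)
  also have "\<dots> = g i \<zeta> - q * 0"
    unfolding \<phi>_def \<psi>_def shoot_eq[OF \<kappa> i] ..
  finally show "s \<zeta> * Y i \<zeta> - of_real \<kappa> * (Y (i + 1) \<zeta> - 2 * Y i \<zeta> + Y (i - 1) \<zeta>) = g i \<zeta>" by simp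
qed

section \<open>The discrete equation as an equation of power series\<close>

context caputo_order
begin

text \<open>The approximation on the uniform mesh, cell by cell and without its scaling factor. The
  second and third differences start with cells 2 and 3 because the first two stencils have fewer
  nodes.\<close>

definition discrete_caputo :: "(nat \<Rightarrow> real) \<Rightarrow> nat \<Rightarrow> real" where
  "discrete_caputo u n = (\<Sum>k = 1..n. a (n - k) * (u k - u (k - 1))
     + (if 2 \<le> k then b (n - k) * (u k - 2 * u (k - 1) + u (k - 2)) else 0)
     + (if 3 \<le> k then c (n - k) * (u k - 3 * u (k - 1) + 3 * u (k - 2) - u (k - 3)) else 0))"

text \<open>Level 0 is left out: the scheme imposes neither its equation nor its boundary values
  there.\<close>

definition tail_fps :: "(nat \<Rightarrow> real) \<Rightarrow> complex fps" where
  "tail_fps u = Abs_fps (\<lambda>n. if n = 0 then 0 else of_real (u n))"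

lemma tail_fps_nth: "fps_nth (tail_fps u) n = (if n = 0 then 0 else of_real (u n))"
  by (simp add: tail_fps_def)

text \<open>Each truncated difference \<open>W1\<close>, \<open>W2\<close>, \<open>W3\<close> is 1 -
  X times the preceding one up to a term of degree 1 or 2 from the starting levels. These terms,
  multiplied by the kernels, make up the forcing.\<close>

lemma discrete_caputo_fps:
  assumes n: "n \<ge> 1"
  shows "of_real (discrete_caputo u n) = fps_nth (symbol * tail_fps u
    - forcing (of_real (u 0)) (of_real (u 1 - u 0)) (of_real (u 2 - 3 * u 1 + 2 * u 0))) n"
proof -
  define W1 W2 W3 :: "complex fps" where
    "W1 = Abs_fps (\<lambda>k. if 1 \<le> k then of_real (u k - u (k - 1)) else 0)" and
    "W2 = Abs_fps (\<lambda>k. if 2 \<le> k then of_real (u k - 2 * u (k - 1) + u (k - 2)) else 0)" and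
    "W3 = Abs_fps (\<lambda>k. if 3 \<le> k then of_real (u k - 3 * u (k - 1) + 3 * u (k - 2) - u (k - 3)) else 0)"
  have W1: "W1 = (1 - fps_X) * tail_fps u - fps_X * fps_const (of_real (u 0))"
  proof (rule fps_ext)
    show "fps_nth W1 k = fps_nth ((1 - fps_X) * tail_fps u - fps_X * fps_const (of_real (u 0))) k" for k
      by (cases k) (auto simp: W1_def tail_fps_nth left_diff_distrib fps_X_mult_nth)
  qed
  have W2: "W2 = (1 - fps_X) * W1 - fps_X * fps_const (of_real (u 1 - u 0))"
  proof (rule fps_ext)
    fix k
    consider "k = 0" | "k = 1" | j where "k = Suc (Suc j)" by (metis One_nat_def not0_implies_Suc)
    then show "fps_nth W2 k = fps_nth ((1 - fps_X) * W1 - fps_X * fps_const (of_real (u 1 - u 0))) k"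
      by cases (auto simp: W1_def W2_def left_diff_distrib fps_X_mult_nth)
  qed
  have W3: "W3 = (1 - fps_X) * W2 - fps_X * (fps_X * fps_const (of_real (u 2 - 2 * u 1 + u 0)))"
  proof (rule fps_ext)
    fix k
    consider "k = 0" | "k = 1" | "k = 2" | j where "k = Suc (Suc (Suc j))"
      by (metis One_nat_def numeral_2_eq_2 not0_implies_Suc)
    then show "fps_nth W3 k = fps_nth ((1 - fps_X) * W2 - fps_X * (fps_X * fps_const (of_real (u 2 - 2 * u 1 + u 0)))) k"
      by cases (auto simp: W2_def W3_def left_diff_distrib fps_X_mult_nth)
  qed
  have "symbol * tail_fps u - forcing (of_real (u 0)) (of_real (u 1 - u 0)) (of_real (u 2 - 3 * u 1 + 2 * u 0))
     = W1 * cfps a + W2 * cfps b + W3 * cfps c"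
  proof -
    \<comment> \<open>With w1 = u 1 - u 0 and the second difference e at level 2, (1 - X) X w1 + X^2
      e = X w1 + X^2 (e - w1); this explains the third argument u 2 - 3 * u 1 + 2 * u 0.\<close>
    have s: "fps_const (of_real (u 2 - 2 * u 1 + u 0)) = (fps_const (of_real (u 2 - 3 * u 1 + 2 * u 0)) + fps_const (of_real (u 1 - u 0)) :: complex fps)"
      by simp
    show ?thesis unfolding W3 W2 W1 s symbol_def forcing_def diff_kernel_def by (simp only: power2_eq_square) algebra
  qed
  moreover have "fps_nth (W1 * cfps a + W2 * cfps b + W3 * cfps c) n
     = (\<Sum>k = 1..n. fps_nth W1 k * of_real (a (n - k)) + fps_nth W2 k * of_real (b (n - k)) + fps_nth W3 k * of_real (c (n - k)))"
  proof -
    have "fps_nth (W1 * cfps a + W2 * cfps b + W3 * cfps c) n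
      = (\<Sum>k = 0..n. fps_nth W1 k * of_real (a (n - k)) + fps_nth W2 k * of_real (b (n - k)) + fps_nth W3 k * of_real (c (n - k)))"
      by (simp add: fps_mult_nth sum.distrib)
    then show ?thesis
      by (simp add: sum.atLeast_Suc_atMost W1_def W2_def W3_def)
  qed
  moreover have "of_real (discrete_caputo u n)
     = (\<Sum>k = 1..n. fps_nth W1 k * of_real (a (n - k)) + fps_nth W2 k * of_real (b (n - k)) + fps_nth W3 k * of_real (c (n - k)))"
    unfolding discrete_caputo_def of_real_sum by (intro sum.cong) (auto simp: W1_def W2_def W3_def)
  ultimately show ?thesis by simp
qed

lemma symbol_0: "fps_nth symbol 0 = of_real (a 0 + b 0 + c 0)"
  by (simp add: symbol_def diff_kernel_def fps_mult_nth_0 fps_power_zeroth)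

lemma a_0_pos: "a 0 > 0"
proof -
  have "0 < \<alpha> * (real 0 + 2) powr (- \<alpha> - 1)" using \<alpha>_bounds by simp
  then show ?thesis using a_diff_ge[of 0] moment_sequence_nonneg[OF moment_a, of 1] by simp
qed

text \<open>Once the lower coefficients vanish, the n-th ones solve a homogeneous Dirichlet problem
  with z = a 0 + b 0 + c 0 > 0. Stopping at N matters, as the scheme says nothing about later
  levels.\<close>

lemma fps_system_unique:
  fixes E :: "nat \<Rightarrow> complex fps"
  assumes \<kappa>: "\<kappa> > 0"
    and bd: "\<And>n. n \<le> N \<Longrightarrow> fps_nth (E 0) n = 0" "\<And>n. n \<le> N \<Longrightarrow> fps_nth (E K) n = 0"
    and eq: "\<And>i n. 1 \<le> i \<Longrightarrow> i < K \<Longrightarrow> n \<le> N \<Longrightarrow> fps_nth (symbol * E i) n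
       = of_real \<kappa> * (fps_nth (E (i + 1)) n - 2 * fps_nth (E i) n + fps_nth (E (i - 1)) n)"
    and i: "i \<le> K" and n: "n \<le> N"
  shows "fps_nth (E i) n = 0"
  using i n
proof (induction n arbitrary: i rule: less_induct)
  case (less n)
  define z where "z = a 0 + b 0 + c 0"
  have z: "z > 0"
    using a_0_pos moment_sequence_nonneg[OF moment_b, of 0] moment_sequence_nonneg[OF moment_c, of 0] by (simp add: z_def)
  have "norm (fps_nth (E i) n) * (norm (of_real z :: complex) + Re (of_real z)) \<le> 2 * 0"
  proof (rule laplacian_resolvent_bound[OF \<kappa> order_refl bd(1)[OF less.prems(2)] bd(2)[OF less.prems(2)] _ _ less.prems(1)])
    fix j assume j: "1 \<le> j" "j < K"
    have "fps_nth (symbol * E j) n = (\<Sum>k = 0..n. fps_nth symbol k * fps_nth (E j) (n - k))"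
      by (rule fps_mult_nth)
    also have "\<dots> = (\<Sum>k = 0..n. if k = 0 then fps_nth symbol 0 * fps_nth (E j) n else 0)"
      using less.IH[of "n - _" j] j less.prems by (intro sum.cong) auto
    also have "\<dots> = of_real z * fps_nth (E j) n" by (simp add: symbol_0 z_def)
    finally show "of_real z * fps_nth (E j) n - of_real \<kappa> * (fps_nth (E (j + 1)) n - 2 * fps_nth (E j) n + fps_nth (E (j - 1)) n) = 0"
      using eq[OF j less.prems(2)] by simp
  qed auto
  then show ?case using z by (simp add: mult_le_0_iff)
qed

lemma discrete_caputo_first:
  "discrete_caputo u 1 = a 0 * (u 1 - u 0)"
  "discrete_caputo u 2 = a 1 * (u 1 - u 0) + a 0 * (u 2 - u 1) + b 0 * (u 2 - 2 * u 1 + u 0)"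
proof -
  have "{1..2 :: nat} = {1, 2}" by auto
  then show "discrete_caputo u 2 = a 1 * (u 1 - u 0) + a 0 * (u 2 - u 1) + b 0 * (u 2 - 2 * u 1 + u 0)"
    by (simp add: discrete_caputo_def)
qed (simp add: discrete_caputo_def)

text \<open>For z > 0 the weight norm z + Re z is 2 z, so the general bound becomes the discrete
  maximum principle with constant 1 / z.\<close>

lemma real_resolvent_bound:
  fixes y :: "nat \<Rightarrow> real"
  assumes \<kappa>: "\<kappa> > 0" and z: "z > 0" and M: "M \<ge> 0" and bd: "y 0 = 0" "y K = 0"
    and g: "\<And>i. 1 \<le> i \<Longrightarrow> i < K \<Longrightarrow> \<bar>z * y i - \<kappa> * (y (i + 1) - 2 * y i + y (i - 1))\<bar> \<le> z * M"
    and i: "i \<le> K"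
  shows "\<bar>y i\<bar> \<le> M"
proof -
  have "norm (of_real (y i) :: complex) * (norm (of_real z :: complex) + Re (of_real z)) \<le> 2 * (z * M)"
  proof (rule laplacian_resolvent_bound[OF \<kappa>, of _ "\<lambda>i. of_real (y i)" K _ "\<lambda>i. of_real (z * y i - \<kappa> * (y (i + 1) - 2 * y i + y (i - 1)))"])
    show "norm (of_real (z * y j - \<kappa> * (y (j + 1) - 2 * y j + y (j - 1))) :: complex) \<le> z * M" if "1 \<le> j" "j < K" for j
      using g[OF that] unfolding norm_of_real .
  qed (use bd z M i in auto)
  then show ?thesis using z by (simp add: algebra_simps)
qed

text \<open>Levels 1 and 2 are implicit Euler-like steps with at most quadratic interpolation,
  bounded directly by M and 3 * M. They enter the forcing, whose data are then at most 8 * M, which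
  gives 8 * C0 for the later levels.\<close>

theorem discrete_subdiffusion_stable:
  obtains C where "C > 0"
    and "\<And>\<kappa> K N M v n i. \<kappa> > 0 \<Longrightarrow> (\<And>i. 1 \<le> i \<Longrightarrow> i < K \<Longrightarrow> \<bar>v 0 i\<bar> \<le> M) \<Longrightarrow> M \<ge> 0 \<Longrightarrow>
      (\<And>n. 1 \<le> n \<Longrightarrow> n \<le> N \<Longrightarrow> v n 0 = 0 \<and> v n K = 0) \<Longrightarrow>
      (\<And>n i. 1 \<le> n \<Longrightarrow> n \<le> N \<Longrightarrow> 1 \<le> i \<Longrightarrow> i < K \<Longrightarrow>
         discrete_caputo (\<lambda>m. v m i) n = \<kappa> * (v n (i + 1) - 2 * v n i + v n (i - 1))) \<Longrightarrow>
      n \<le> N \<Longrightarrow> 1 \<le> i \<Longrightarrow> i < K \<Longrightarrow> \<bar>v (n :: nat) (i :: nat)\<bar> \<le> C * M"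
proof -
  obtain C0 where C0: "C0 > 0"
    and bound: "\<And>\<kappa> K M Y w0 w1 w2 F i n. \<kappa> > 0 \<Longrightarrow> M \<ge> 0 \<Longrightarrow>
      (\<And>i. i \<le> (K :: nat) \<Longrightarrow> Y i holomorphic_on ball 0 1) \<Longrightarrow>
      (\<And>\<zeta>. norm \<zeta> < 1 \<Longrightarrow> Y 0 \<zeta> = 0) \<Longrightarrow> (\<And>\<zeta>. norm \<zeta> < 1 \<Longrightarrow> Y K \<zeta> = 0) \<Longrightarrow>
      (\<And>i. 1 \<le> i \<Longrightarrow> i < K \<Longrightarrow> norm (w0 i) \<le> M \<and> norm (w1 i) \<le> M \<and> norm (w2 i) \<le> M) \<Longrightarrow>
      (\<And>i \<zeta>. 1 \<le> i \<Longrightarrow> i < K \<Longrightarrow> norm \<zeta> < 1 \<Longrightarrow>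
         eval_fps symbol \<zeta> * Y i \<zeta> - of_real \<kappa> * (Y (i + 1) \<zeta> - 2 * Y i \<zeta> + Y (i - 1) \<zeta>) = eval_fps (forcing (w0 i) (w1 i) (w2 i)) \<zeta>) \<Longrightarrow>
      Y i has_fps_expansion F \<Longrightarrow> i \<le> K \<Longrightarrow> 1 \<le> n \<Longrightarrow> norm (fps_nth F n) \<le> C0 * M"
    by (rule generating_function_bound) (rule that, blast+)
  obtain k where k: "k > 0"
    and sector: "\<And>\<zeta>. norm \<zeta> < 1 \<Longrightarrow> k * norm (1 - \<zeta>) powr \<alpha> \<le> norm (eval_fps symbol \<zeta>) + Re (eval_fps symbol \<zeta>)"
    by (rule symbol_sector) (rule that, blast+)
  show ?thesis
  proof (rule that[of "3 + 8 * C0"])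
    fix \<kappa> :: real and K N n i :: nat and M :: real and v :: "nat \<Rightarrow> nat \<Rightarrow> real"
    assume \<kappa>: "\<kappa> > 0" and v0: "\<And>i. 1 \<le> i \<Longrightarrow> i < K \<Longrightarrow> \<bar>v 0 i\<bar> \<le> M" and M: "M \<ge> 0"
      and bd: "\<And>n. 1 \<le> n \<Longrightarrow> n \<le> N \<Longrightarrow> v n 0 = 0 \<and> v n K = 0"
      and eq: "\<And>n i. 1 \<le> n \<Longrightarrow> n \<le> N \<Longrightarrow> 1 \<le> i \<Longrightarrow> i < K \<Longrightarrow>
         discrete_caputo (\<lambda>m. v m i) n = \<kappa> * (v n (i + 1) - 2 * v n i + v n (i - 1))"
      and n: "n \<le> N" and i: "1 \<le> i" "i < K"
    have v1: "\<bar>v 1 j\<bar> \<le> M" if j: "j \<le> K" and N: "1 \<le> N" for j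
    proof (rule real_resolvent_bound[OF \<kappa> a_0_pos M _ _ _ j])
      fix j assume j: "1 \<le> j" "j < K"
      have "a 0 * v 1 j - \<kappa> * (v 1 (j + 1) - 2 * v 1 j + v 1 (j - 1)) = a 0 * v 0 j"
        using eq[of 1 j] N j unfolding discrete_caputo_first by (simp add: algebra_simps)
      then show "\<bar>a 0 * v 1 j - \<kappa> * (v 1 (j + 1) - 2 * v 1 j + v 1 (j - 1))\<bar> \<le> a 0 * M"
        using v0[OF j] a_0_pos by (simp add: abs_mult)
    qed (use bd[of 1] N in auto)
    have v2: "\<bar>v 2 j\<bar> \<le> 3 * M" if j: "j \<le> K" and N: "2 \<le> N" for j
    proof -
      have b0: "0 \<le> b 0" and a1: "0 \<le> a 1" "a 1 \<le> a 0"
        using moment_sequence_nonneg[OF moment_b] moment_sequence_nonneg[OF moment_a] moment_sequence_Suc_le[OF moment_a, of 0] by auto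
      have z: "a 0 + b 0 > 0" using a_0_pos b0 by simp
      show ?thesis
      proof (rule real_resolvent_bound[OF \<kappa> z _ _ _ _ j])
        fix j assume j: "1 \<le> j" "j < K"
        \<comment> \<open>The factor b 0 - a 1 may have either sign; 0 <= a 1 <= a 0 bounds it by a
          0 + b 0 in modulus, so the total is (1 + 2) * M.\<close>
        have "(a 0 + b 0) * v 2 j - \<kappa> * (v 2 (j + 1) - 2 * v 2 j + v 2 (j - 1))
            = (a 0 + b 0) * v 1 j + (b 0 - a 1) * (v 1 j - v 0 j)"
          using eq[of 2 j] N j unfolding discrete_caputo_first by (simp add: algebra_simps)
        also have "\<bar>\<dots>\<bar> \<le> \<bar>(a 0 + b 0) * v 1 j\<bar> + \<bar>(b 0 - a 1) * (v 1 j - v 0 j)\<bar>" by (rule abs_triangle_ineq)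
        also have "\<bar>(a 0 + b 0) * v 1 j\<bar> \<le> (a 0 + b 0) * M"
          unfolding abs_mult using v1[of j] j N z by (intro mult_mono) auto
        also have "\<bar>(b 0 - a 1) * (v 1 j - v 0 j)\<bar> \<le> (a 0 + b 0) * (2 * M)"
          unfolding abs_mult using v1[of j] v0[OF j] j N a1 b0 by (intro mult_mono) auto
        finally show "\<bar>(a 0 + b 0) * v 2 j - \<kappa> * (v 2 (j + 1) - 2 * v 2 j + v 2 (j - 1))\<bar> \<le> (a 0 + b 0) * (3 * M)"
          by (simp add: algebra_simps)
      qed (use bd[of 2] N M in auto)
    qed
    consider "n = 0" | "n = 1" | "n = 2" | "3 \<le> n" by linarith
    then show "\<bar>v n i\<bar> \<le> (3 + 8 * C0) * M"
    proof cases
      case 4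
      define w0 w1 w2 :: "nat \<Rightarrow> complex" where "w0 j = of_real (v 0 j)" and "w1 j = of_real (v 1 j - v 0 j)"
        and "w2 j = of_real (v 2 j - 3 * v 1 j + 2 * v 0 j)" for j
      \<comment> \<open>8 = 3 + 3 * 1 + 2 * 1, from the bounds for v 2, v 1 and v 0 in
        \<open>w2\<close>.\<close>
      have w: "norm (w0 j) \<le> 8 * M \<and> norm (w1 j) \<le> 8 * M \<and> norm (w2 j) \<le> 8 * M" if j: "1 \<le> j" "j < K" for j
        unfolding w0_def w1_def w2_def norm_of_real
        using v0[OF j] v1[of j] v2[of j] j n 4 by linarith
      have sec: "norm (eval_fps symbol \<zeta>) + Re (eval_fps symbol \<zeta>) > 0" if \<zeta>: "\<zeta> \<in> ball 0 1" for \<zeta>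
      proof -
        have n\<zeta>: "norm \<zeta> < 1" using \<zeta> by simp
        have "0 < k * norm (1 - \<zeta>) powr \<alpha>" using k norm_one_minus_bounds(1)[OF n\<zeta>] by simp
        then show ?thesis using sector[OF n\<zeta>] by (rule less_le_trans)
      qed
      have sub: "ball 0 1 \<subseteq> eball (0 :: complex) (fps_conv_radius F)" if "1 \<le> fps_conv_radius F" for F :: "complex fps"
        using norm_less_conv_radius[OF _ that] by (auto simp: in_eball_iff)
      \<comment> \<open>\<open>Y\<close> depends on \<open>v\<close> only through the levels 0 to 2
        and solves the system at all orders; that its coefficients are the values of
        \<open>v\<close> up to level N is shown afterwards.\<close>
      obtain Y where Y: "\<And>j. Y j holomorphic_on ball 0 1" "\<And>\<zeta>. \<zeta> \<in> ball 0 1 \<Longrightarrow> Y 0 \<zeta> = 0"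
          "\<And>\<zeta>. \<zeta> \<in> ball 0 1 \<Longrightarrow> Y K \<zeta> = 0"
          "\<And>j \<zeta>. j \<ge> 1 \<Longrightarrow> \<zeta> \<in> ball 0 1 \<Longrightarrow> eval_fps symbol \<zeta> * Y j \<zeta> - of_real \<kappa> * (Y (j + 1) \<zeta> - 2 * Y j \<zeta> + Y (j - 1) \<zeta>)
             = eval_fps (forcing (w0 j) (w1 j) (w2 j)) \<zeta>"
        by (rule holomorphic_dirichlet_solution[of \<kappa> K "eval_fps symbol" "ball 0 1" "\<lambda>j. eval_fps (forcing (w0 j) (w1 j) (w2 j))"])
           (use \<kappa> i sec in \<open>auto intro!: holomorphic_on_eval_fps sub\<close>)
      define F where "F j = fps_expansion (Y j) 0" for j
      have F: "Y j has_fps_expansion F j" for j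
        unfolding F_def by (rule has_fps_expansion_fps_expansion[of "ball 0 1"]) (auto simp: Y)
      have F_eq: "symbol * F j - fps_const (of_real \<kappa>) * (F (j + 1) - fps_const 2 * F j + F (j - 1)) = forcing (w0 j) (w1 j) (w2 j)"
        if j: "1 \<le> j" for j
      proof (rule fps_expansion_unique_complex)
        have ev: "eval_fps G has_fps_expansion G" if "1 \<le> fps_conv_radius G" for G :: "complex fps"
          using that by (intro eval_fps_has_fps_expansion) (auto simp: less_le_trans[of 0 1])
        show "(\<lambda>\<zeta>. eval_fps symbol \<zeta> * Y j \<zeta> - of_real \<kappa> * (Y (j + 1) \<zeta> - 2 * Y j \<zeta> + Y (j - 1) \<zeta>)) has_fps_expansion
            symbol * F j - fps_const (of_real \<kappa>) * (F (j + 1) - fps_const 2 * F j + F (j - 1))"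
          by (intro fps_expansion_intros F ev conv_radius_symbol)
        have "eventually (\<lambda>\<zeta>. \<zeta> \<in> ball 0 1) (nhds (0 :: complex))"
          by (intro eventually_nhds_in_open) auto
        then have "eventually (\<lambda>\<zeta>. eval_fps symbol \<zeta> * Y j \<zeta> - of_real \<kappa> * (Y (j + 1) \<zeta> - 2 * Y j \<zeta> + Y (j - 1) \<zeta>)
            = eval_fps (forcing (w0 j) (w1 j) (w2 j)) \<zeta>) (nhds 0)"
          by eventually_elim (use Y(4) j in auto)
        then show "(\<lambda>\<zeta>. eval_fps symbol \<zeta> * Y j \<zeta> - of_real \<kappa> * (Y (j + 1) \<zeta> - 2 * Y j \<zeta> + Y (j - 1) \<zeta>)) has_fps_expansion
            forcing (w0 j) (w1 j) (w2 j)"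
          by (subst has_fps_expansion_cong[OF _ refl]) (auto intro: ev)
      qed
      have F_0: "F j = 0" if "\<And>\<zeta>. \<zeta> \<in> ball 0 1 \<Longrightarrow> Y j \<zeta> = 0" for j
      proof (rule fps_expansion_unique_complex[OF F])
        have "eventually (\<lambda>\<zeta>. \<zeta> \<in> ball 0 1) (nhds (0 :: complex))"
          by (intro eventually_nhds_in_open) auto
        then have "eventually (\<lambda>\<zeta>. Y j \<zeta> = 0) (nhds 0)" by eventually_elim (rule that)
        then show "Y j has_fps_expansion 0"
          by (subst has_fps_expansion_cong[OF _ refl]) auto
      qed
      define V where "V j = tail_fps (\<lambda>m. v m j)" for j
      \<comment> \<open>At m = 0 both sides vanish, as neither the tails nor the forcing have a
        constant term.\<close>
      have V_eq: "fps_nth (symbol * V j - forcing (w0 j) (w1 j) (w2 j)) m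
          = of_real \<kappa> * (fps_nth (V (j + 1)) m - 2 * fps_nth (V j) m + fps_nth (V (j - 1)) m)"
        if j: "1 \<le> j" "j < K" and m: "m \<le> N" for j m
      proof (cases "m = 0")
        case True
        then show ?thesis by (simp add: V_def tail_fps_nth forcing_def fps_mult_nth_0)
      next
        case False
        then have m1: "1 \<le> m" by simp
        have "fps_nth (symbol * V j - forcing (w0 j) (w1 j) (w2 j)) m = of_real (discrete_caputo (\<lambda>m. v m j) m)"
          unfolding V_def w0_def w1_def w2_def by (rule discrete_caputo_fps[OF m1, symmetric])
        then show ?thesis
          unfolding eq[OF m1 m j] using m1 by (simp add: V_def tail_fps_nth)
      qed
      have "fps_nth (F i - V i) n = 0"
      proof (rule fps_system_unique[OF \<kappa>, where E = "\<lambda>j. F j - V j" and N = N and K = K])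
        show "fps_nth (F 0 - V 0) m = 0" "fps_nth (F K - V K) m = 0" if "m \<le> N" for m
          using bd[of m] that F_0[OF Y(2)] F_0[OF Y(3)] by (auto simp: V_def tail_fps_nth)
        show "fps_nth (symbol * (F j - V j)) m = of_real \<kappa> * (fps_nth (F (j + 1) - V (j + 1)) m
            - 2 * fps_nth (F j - V j) m + fps_nth (F (j - 1) - V (j - 1)) m)"
          if j: "1 \<le> j" "j < K" and m: "m \<le> N" for j m
          using V_eq[OF j m] arg_cong[OF F_eq[OF j(1)], of "\<lambda>G. fps_nth G m"]
          by (simp add: right_diff_distrib) (simp add: algebra_simps)
      qed (use i n in auto)
      then have "fps_nth (F i) n = of_real (v n i)" using 4 by (simp add: V_def tail_fps_nth)
      moreover have "norm (fps_nth (F i) n) \<le> C0 * (8 * M)"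
        by (rule bound[OF \<kappa>, where K = K and Y = Y and ?w0.0 = w0 and ?w1.0 = w1 and ?w2.0 = w2 and i = i])
           (use M Y F w i 4 in auto)
      ultimately show ?thesis using M by (simp add: algebra_simps)
    next
      case 1
      have "1 * M \<le> (3 + 8 * C0) * M" using C0 M by (intro mult_right_mono) auto
      then show ?thesis using v0[OF i] 1 by simp
    next
      case 2
      have "1 * M \<le> (3 + 8 * C0) * M" using C0 M by (intro mult_right_mono) auto
      then show ?thesis using v1[of i] i n 2 by simp
    next
      case 3
      have "3 * M \<le> (3 + 8 * C0) * M" using C0 M by (intro mult_right_mono) auto
      then show ?thesis using v2[of i] i n 3 by simp
    qed
  qed (use C0 in simp)
qed

end

subsection \<open>Reduction of the scheme on the uniform mesh\<close>

lemma interp_poly_eqI: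
  assumes "finite S" "S \<noteq> {}" "inj_on t S" "degree q < card S" "\<And>i. i \<in> S \<Longrightarrow> poly q (t i) = v i"
  shows "interp_poly t S v = q"
  unfolding interp_poly_def by (rule the1_equality[OF interp_poly_unique]) (use assms in auto)

text \<open>Newton's backward form at node k: the linear factors are \<sigma>, \<sigma> + 1 and
  \<sigma> + 2 with \<sigma> = s / \<tau> - k, and d1, d2, d3 are the backward differences. A
  shorter stencil is obtained by setting the last differences to 0.\<close>

definition newton_poly :: "real \<Rightarrow> nat \<Rightarrow> real \<Rightarrow> real \<Rightarrow> real \<Rightarrow> real \<Rightarrow> real poly" where
  "newton_poly \<tau> k d0 d1 d2 d3 = [:d0:] + smult d1 [:- real k, 1 / \<tau>:]
     + smult (d2 / 2) ([:- real k, 1 / \<tau>:] * [:1 - real k, 1 / \<tau>:])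
     + smult (d3 / 6) ([:- real k, 1 / \<tau>:] * [:1 - real k, 1 / \<tau>:] * [:2 - real k, 1 / \<tau>:])"

lemma degree_newton_poly:
  "degree (newton_poly \<tau> k d0 d1 d2 d3) \<le> 3"
  "degree (newton_poly \<tau> k d0 d1 d2 0) \<le> 2"
  "degree (newton_poly \<tau> k d0 d1 0 0) \<le> 1"
proof -
  have 1: "degree [:x, y:] \<le> 1" for x y :: real by simp
  have 2: "degree ([:x, y:] * [:x', y':]) \<le> 2" for x y x' y' :: real
    using degree_mult_le[of "[:x, y:]" "[:x', y':]"] 1[of x y] 1[of x' y'] by linarith
  have 3: "degree ([:x, y:] * [:x', y':] * [:x'', y'':]) \<le> 3" for x y x' y' x'' y'' :: real
    using degree_mult_le[of "[:x, y:] * [:x', y':]" "[:x'', y'':]"] 2[of x y x' y'] 1[of x'' y''] by linarith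
  have s: "degree (smult d p) \<le> m" if "degree p \<le> m'" "m' \<le> m" for d :: real and p m m'
    using degree_smult_le[of d p] that by linarith
  show "degree (newton_poly \<tau> k d0 d1 d2 d3) \<le> 3"
    unfolding newton_poly_def by (intro degree_add_le s[OF 1] s[OF 2] s[OF 3]) auto
  show "degree (newton_poly \<tau> k d0 d1 d2 0) \<le> 2"
    unfolding newton_poly_def smult_0_left div_0 by (intro degree_add_le s[OF 1] s[OF 2]) auto
  show "degree (newton_poly \<tau> k d0 d1 0 0) \<le> 1"
    unfolding newton_poly_def smult_0_left div_0 by (intro degree_add_le s[OF 1]) auto
qed

lemma poly_newton_poly:
  fixes \<tau> s d0 d1 d2 d3 :: real and k :: nat
  defines "\<sigma> \<equiv> s / \<tau> - real k"
  shows "poly (newton_poly \<tau> k d0 d1 d2 d3) s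
    = d0 + d1 * \<sigma> + d2 / 2 * (\<sigma> * (\<sigma> + 1)) + d3 / 6 * (\<sigma> * (\<sigma> + 1) * (\<sigma> + 2))"
proof -
  have "poly [:- real k, 1 / \<tau>:] s = \<sigma>" "poly [:1 - real k, 1 / \<tau>:] s = \<sigma> + 1" "poly [:2 - real k, 1 / \<tau>:] s = \<sigma> + 2"
    by (simp_all add: \<sigma>_def)
  then show ?thesis unfolding newton_poly_def by (simp only: poly_add poly_smult poly_mult) simp
qed

text \<open>Here \<theta> = \<sigma> + 1 runs over [0, 1] on the cell. The basis polynomials become
  \<theta> (\<theta> - 1) / 2 and (\<theta>^3 - \<theta>) / 6, and their derivatives are the kernel
  weights.\<close>

lemma poly_pderiv_newton_poly:
  fixes \<tau> s d0 d1 d2 d3 :: real and k :: nat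
  defines "\<theta> \<equiv> s / \<tau> - (real k - 1)"
  assumes "\<tau> > 0"
  shows "poly (pderiv (newton_poly \<tau> k d0 d1 d2 d3)) s
    = 1 / \<tau> * (d1 * 1 + d2 * (\<theta> - 1 / 2) + d3 * ((3 * \<theta>\<^sup>2 - 1) / 6))"
proof -
  define x where "x = s / \<tau>"
  have s: "s = x * \<tau>" using assms by (simp add: x_def)
  show ?thesis
    unfolding newton_poly_def \<theta>_def x_def[symmetric] unfolding s using \<open>\<tau> > 0\<close>
    by (simp add: pderiv_add pderiv_smult pderiv_mult pderiv_pCons field_simps power2_eq_square)
qed

lemma interp_poly_uniform_mesh:
  fixes v :: "nat \<Rightarrow> real"
  assumes t: "\<And>m. t m = real m * \<tau>" and \<tau>: "\<tau> > 0" and k: "k \<ge> 1"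
  shows "interp_poly t (stencil k) v = newton_poly \<tau> k (v k) (v k - v (k - 1))
    (if 2 \<le> k then v k - 2 * v (k - 1) + v (k - 2) else 0)
    (if 3 \<le> k then v k - 3 * v (k - 1) + 3 * v (k - 2) - v (k - 3) else 0)"
proof -
  have inj: "inj_on t S" for S using \<tau> by (auto simp: inj_on_def t)
  have pt: "t i / \<tau> = real i" for i using \<tau> by (simp add: t)
  \<comment> \<open>Writing k as j + 3 removes the truncated subtractions.\<close>
  have "k = 1 \<or> k = 2 \<or> k = (k - 3) + 3" using k by arith
  then consider "k = 1" | "k = 2" | j where "k = j + 3" by blast
  then show ?thesis
  proof cases
    case 1
    have "interp_poly t {0, 1} v = newton_poly \<tau> 1 (v 1) (v 1 - v 0) 0 0"
    proof (rule interp_poly_eqI[OF _ _ inj])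
      show "degree (newton_poly \<tau> 1 (v 1) (v 1 - v 0) 0 0) < card {0, 1 :: nat}"
        using degree_newton_poly(3)[of \<tau> 1 "v 1" "v 1 - v 0"] by simp
    qed (auto simp: poly_newton_poly pt)
    then show ?thesis using 1 by (simp add: stencil_def)
  next
    case 2
    have "interp_poly t {0, 1, 2} v = newton_poly \<tau> 2 (v 2) (v 2 - v 1) (v 2 - 2 * v 1 + v 0) 0"
    proof (rule interp_poly_eqI[OF _ _ inj])
      show "degree (newton_poly \<tau> 2 (v 2) (v 2 - v 1) (v 2 - 2 * v 1 + v 0) 0) < card {0, 1, 2 :: nat}"
        using degree_newton_poly(2)[of \<tau> 2 "v 2" "v 2 - v 1" "v 2 - 2 * v 1 + v 0"] by simp
    qed (auto simp: poly_newton_poly pt field_simps)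
    then show ?thesis using 2 by (simp add: stencil_def)
  next
    case (3 j)
    have S: "{j..j + 3} = {j, j + 1, j + 2, j + 3}" by auto
    let ?q = "newton_poly \<tau> (j + 3) (v (j + 3)) (v (j + 3) - v (j + 2)) (v (j + 3) - 2 * v (j + 2) + v (j + 1))
        (v (j + 3) - 3 * v (j + 2) + 3 * v (j + 1) - v j)"
    have "interp_poly t {j..j + 3} v = ?q"
    proof (rule interp_poly_eqI[OF _ _ inj])
      show "degree ?q < card {j..j + 3}"
        using degree_newton_poly(1) by (rule le_less_trans) simp
      show "poly ?q (t i) = v i" if "i \<in> {j..j + 3}" for i
        using that unfolding S by (auto simp: poly_newton_poly pt field_simps)
    qed auto
    then show ?thesis using 3 by (simp add: stencil_def)
  qed
qed

context caputo_order
begin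

text \<open>The substitution s = (\<theta> + k - 1) \<tau> turns t n - s into \<tau> (n - k + 1 -
  \<theta>), so the kernel index is n - k; the 1 / \<tau> from the derivative cancels against ds and
  only \<tau>^(-\<alpha>) remains.\<close>

lemma cell_integral:
  assumes \<tau>: "\<tau> > 0" and k: "1 \<le> k" "k \<le> n" and t: "\<And>m. t m = real m * \<tau>"
  shows "integral {t (k - 1)..t k} (\<lambda>s. (t n - s) powr - \<alpha> * poly (pderiv (newton_poly \<tau> k d0 d1 d2 d3)) s)
    = \<tau> powr - \<alpha> * (a (n - k) * d1 + b (n - k) * d2 + c (n - k) * d3)"
proof -
  define w where "w \<theta> = d1 * 1 + d2 * (\<theta> - 1 / 2) + d3 * ((3 * \<theta>\<^sup>2 - 1) / 6)" for \<theta> :: real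
  define I where "I = d1 * a (n - k) + d2 * b (n - k) + d3 * c (n - k)"
  define f where "f \<theta> = w \<theta> * (real (n - k) + 1 - \<theta>) powr - \<alpha>" for \<theta>
  have "((\<lambda>\<theta>. d1 * (1 * (real (n - k) + 1 - \<theta>) powr - \<alpha>) + d2 * ((\<theta> - 1 / 2) * (real (n - k) + 1 - \<theta>) powr - \<alpha>)
      + d3 * ((3 * \<theta>\<^sup>2 - 1) / 6 * (real (n - k) + 1 - \<theta>) powr - \<alpha>)) has_integral I) {0..1}"
    unfolding I_def
    by (intro has_integral_add has_integral_mult_right kernel_has_integral[OF \<alpha>_bounds, of _ 1]
          kernel_has_integral[OF \<alpha>_bounds, of _ "[:-1/2, 1:]"] kernel_has_integral[OF \<alpha>_bounds, of _ "[:-1/6, 0, 1/2:]"])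
       (auto simp: power2_eq_square field_simps)
  then have "(f has_integral I) {0..1}"
    by (simp only: f_def[abs_def] w_def distrib_right mult.assoc)
  then have "(f has_integral I) (cbox 0 1)" by simp
  from has_integral_affinity'[OF this, of "1 / \<tau>" "- (real k - 1)"]
  have "((\<lambda>s. f (s / \<tau> - (real k - 1))) has_integral I * \<tau>) {t (k - 1)..t k}"
    using \<tau> k by (simp add: t of_nat_diff field_simps)
  then have "((\<lambda>s. \<tau> powr - \<alpha> / \<tau> * f (s / \<tau> - (real k - 1))) has_integral \<tau> powr - \<alpha> / \<tau> * (I * \<tau>)) {t (k - 1)..t k}"
    by (rule has_integral_mult_right)
  moreover have "\<tau> powr - \<alpha> / \<tau> * f (s / \<tau> - (real k - 1))
      = (t n - s) powr - \<alpha> * poly (pderiv (newton_poly \<tau> k d0 d1 d2 d3)) s" if s: "s \<in> {t (k - 1)..t k}" for s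
  proof -
    have "s \<le> t n" using s k \<tau> by (auto simp: t intro: order_trans mult_right_mono)
    have "real (n - k) + 1 - (s / \<tau> - (real k - 1)) = (t n - s) / \<tau>"
      using k \<tau> by (simp add: t of_nat_diff field_simps)
    then have "f (s / \<tau> - (real k - 1)) = w (s / \<tau> - (real k - 1)) * ((t n - s) powr - \<alpha> / \<tau> powr - \<alpha>)"
      using \<open>s \<le> t n\<close> \<tau> by (simp add: f_def powr_divide)
    then show ?thesis
      unfolding poly_pderiv_newton_poly[OF \<tau>] w_def[symmetric] using \<tau> by simp
  qed
  ultimately have "((\<lambda>s. (t n - s) powr - \<alpha> * poly (pderiv (newton_poly \<tau> k d0 d1 d2 d3)) s) has_integral
      \<tau> powr - \<alpha> / \<tau> * (I * \<tau>)) {t (k - 1)..t k}"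
    by (rule has_integral_eq[rotated])
  from integral_unique[OF this] show ?thesis using \<tau> by (simp add: I_def mult.commute)
qed

lemma caputo_approx_uniform_mesh:
  assumes \<tau>: "\<tau> > 0" and t: "\<And>m. t m = real m * \<tau>"
  shows "caputo_approx \<alpha> t n v = \<tau> powr - \<alpha> / Gamma (1 - \<alpha>) * discrete_caputo v n"
proof -
  have "integral {t (k - 1)..t k} (\<lambda>s. (t n - s) powr - \<alpha> * poly (pderiv (interp_poly t (stencil k) v)) s)
    = \<tau> powr - \<alpha> * (a (n - k) * (v k - v (k - 1))
     + (if 2 \<le> k then b (n - k) * (v k - 2 * v (k - 1) + v (k - 2)) else 0)
     + (if 3 \<le> k then c (n - k) * (v k - 3 * v (k - 1) + 3 * v (k - 2) - v (k - 3)) else 0))"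
    if k: "k \<in> {1..n}" for k
    unfolding interp_poly_uniform_mesh[OF t \<tau> k[THEN atLeastAtMost_iff[THEN iffD1], THEN conjunct1]]
    using k by (subst cell_integral[OF \<tau> _ _ t]) auto
  then show ?thesis
    unfolding caputo_approx_def discrete_caputo_def by (simp add: sum_distrib_left)
qed

end

section \<open>Maximum norm and the difference of two solutions\<close>

lemma abs_le_max_norm: "1 \<le> i \<Longrightarrow> i < K \<Longrightarrow> \<bar>w i\<bar> \<le> max_norm K w"
  unfolding max_norm_def by (intro Max_ge) auto

lemma max_norm_nonneg: "0 \<le> max_norm K w"
  unfolding max_norm_def by (intro Max_ge) auto

lemma max_norm_leI: "0 \<le> B \<Longrightarrow> (\<And>i. 1 \<le> i \<Longrightarrow> i < K \<Longrightarrow> \<bar>w i\<bar> \<le> B) \<Longrightarrow> max_norm K w \<le> B"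
  unfolding max_norm_def by (subst Max_le_iff) auto

text \<open>The coefficients are never computed: their defining identity replaces the sum by the
  integrals it stands for.\<close>

lemma scheme_solution_caputo:
  assumes \<alpha>: "0 < \<alpha>" "\<alpha> < 1" and T: "0 < T" and Kt: "1 \<le> Kt"
    and u: "scheme_solution \<alpha> T L \<rho> f \<phi> Kt Kx u" and n: "1 \<le> n" "n \<le> Kt" and i: "1 \<le> i" "i < Kx"
  shows "caputo_approx \<alpha> (uniform_mesh T Kt) n (\<lambda>m. u m i)
    = \<rho> * ((u n (i + 1) - 2 * u n i + u n (i - 1)) / (L / real Kx)\<^sup>2) + f (uniform_mesh L Kx i, uniform_mesh T Kt n)"
proof -
  have "strict_mono (uniform_mesh T Kt)" using T Kt by (intro strict_mono_uniform_mesh) auto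
  from theI'[OF scheme_coeff_unique[OF \<alpha> this], folded scheme_coeff_def, THEN conjunct1, rule_format, of n "\<lambda>m. u m i"]
  show ?thesis using u n i unfolding scheme_solution_def Let_def by simp
qed

theorem theorem2:
  fixes \<alpha> T L \<rho> :: real and f :: "real \<times> real \<Rightarrow> real"
  assumes "0 < \<alpha>" "\<alpha> < 1" "0 < T" "0 < L" "0 < \<rho>"
    and "continuous_on ({0..L} \<times> {0..T}) f"
  shows "unconditionally_stable \<alpha> T L \<rho> f"
proof -
  interpret caputo_order \<alpha> by unfold_locales (use assms in auto)
  obtain C where C: "C > 0"
    and stable: "\<And>\<kappa> K N M v n i. \<kappa> > 0 \<Longrightarrow> (\<And>i. 1 \<le> i \<Longrightarrow> i < K \<Longrightarrow> \<bar>v 0 i\<bar> \<le> M) \<Longrightarrow> M \<ge> 0 \<Longrightarrow>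
      (\<And>n. 1 \<le> n \<Longrightarrow> n \<le> N \<Longrightarrow> v n 0 = 0 \<and> v n K = 0) \<Longrightarrow>
      (\<And>n i. 1 \<le> n \<Longrightarrow> n \<le> N \<Longrightarrow> 1 \<le> i \<Longrightarrow> i < K \<Longrightarrow>
         discrete_caputo (\<lambda>m. v m i) n = \<kappa> * (v n (i + 1) - 2 * v n i + v n (i - 1))) \<Longrightarrow>
      n \<le> N \<Longrightarrow> 1 \<le> i \<Longrightarrow> i < K \<Longrightarrow> \<bar>v (n :: nat) (i :: nat)\<bar> \<le> C * M"
    by (rule discrete_subdiffusion_stable) (rule that, blast+)
  show ?thesis
    unfolding unconditionally_stable_def
  proof (intro exI[of _ C] conjI allI impI C)
    fix Kt Kx :: nat and \<phi> \<psi> :: "real \<Rightarrow> real" and u w :: "nat \<Rightarrow> nat \<Rightarrow> real" and n :: nat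
    assume Kt: "1 \<le> Kt" and Kx: "1 \<le> Kx" and u: "scheme_solution \<alpha> T L \<rho> f \<phi> Kt Kx u"
      and w: "scheme_solution \<alpha> T L \<rho> f \<psi> Kt Kx w" and n: "n \<le> Kt"
    define v where "v n i = u n i - w n i" for n i
    define t where "t = uniform_mesh T Kt"
    define \<tau> where "\<tau> = T / real Kt"
    have \<tau>: "\<tau> > 0" using assms Kt by (simp add: \<tau>_def)
    have t: "t m = real m * \<tau>" for m by (simp add: t_def \<tau>_def uniform_mesh_def)
    have mono: "strict_mono t"
      unfolding t_def using assms Kt by (intro strict_mono_uniform_mesh) auto
    define G where "G = Gamma (1 - \<alpha>)"
    have G: "G > 0" using assms by (simp add: G_def Gamma_real_pos)
    \<comment> \<open>The mesh sizes enter through this single positive number, and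
      \<open>stable\<close> holds for every positive \<kappa> with the same C; hence no relation
      between h and \<tau> arises.\<close>
    define \<kappa> where "\<kappa> = G * \<tau> powr \<alpha> * \<rho> / (L / real Kx)\<^sup>2"
    have \<kappa>: "\<kappa> > 0" using G \<tau> assms Kx by (simp add: \<kappa>_def)
    have eq: "discrete_caputo (\<lambda>m. v m i) k = \<kappa> * (v k (i + 1) - 2 * v k i + v k (i - 1))"
      if k: "1 \<le> k" "k \<le> Kt" and i: "1 \<le> i" "i < Kx" for k i
    proof -
      have "caputo_approx \<alpha> t k (\<lambda>m. v m i) = caputo_approx \<alpha> t k (\<lambda>m. u m i) - caputo_approx \<alpha> t k (\<lambda>m. w m i)"
        using caputo_approx_linear[OF assms(1,2) mono, of k 1 "\<lambda>m. u m i" "-1" "\<lambda>m. w m i"] by (simp add: v_def)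
      also have "\<dots> = \<rho> * (v k (i + 1) - 2 * v k i + v k (i - 1)) / (L / real Kx)\<^sup>2"
        unfolding t_def scheme_solution_caputo[OF assms(1-3) Kt u k i] scheme_solution_caputo[OF assms(1-3) Kt w k i]
        by (simp add: v_def diff_divide_distrib add_divide_distrib right_diff_distrib distrib_left)
      finally have "\<tau> powr - \<alpha> / G * discrete_caputo (\<lambda>m. v m i) k = \<rho> * (v k (i + 1) - 2 * v k i + v k (i - 1)) / (L / real Kx)\<^sup>2"
        unfolding caputo_approx_uniform_mesh[OF \<tau> t] G_def .
      then have "G * \<tau> powr \<alpha> * (\<tau> powr - \<alpha> / G * discrete_caputo (\<lambda>m. v m i) k)
          = \<kappa> * (v k (i + 1) - 2 * v k i + v k (i - 1))"
        by (simp add: \<kappa>_def)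
      moreover have "G * \<tau> powr \<alpha> * (\<tau> powr - \<alpha> / G * x) = x" for x
        using G \<tau> by (simp add: powr_minus field_simps)
      ultimately show ?thesis by simp
    qed
    have bd: "v k 0 = 0 \<and> v k Kx = 0" if "1 \<le> k" "k \<le> Kt" for k
      using u w that unfolding scheme_solution_def Let_def v_def by simp
    show "max_norm Kx (\<lambda>i. u n i - w n i) \<le> C * max_norm Kx (\<lambda>i. u 0 i - w 0 i)"
      unfolding v_def[symmetric]
    proof (rule max_norm_leI)
      fix i assume i: "1 \<le> i" "i < Kx"
      show "\<bar>v n i\<bar> \<le> C * max_norm Kx (v 0)"
        by (rule stable[OF \<kappa> _ _ _ _ n i, where v = v]) (use abs_le_max_norm[of _ Kx "v 0"] max_norm_nonneg bd eq in auto)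
    qed (use C max_norm_nonneg in simp)
  qed
qed

end
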